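(* Let $\mathcal{K}'\subset\mathbb{R}^2$ be a two-dimensional lattice with torus $Q'=\mathbb{R}^2/\mathcal{K}'$, let $\mathcal{P}'=\{P'_j\}_{j=1}^J$ be a $\mathcal{K}'$-periodic polygonal partition of $\mathbb{R}^2$, and let $n=n(x,y)>0$ be a refractive index, independent of $z$, $\mathcal{K}'$-periodic and constant on each $P'_j$. Let $\beta\in\mathbb{R}$ and let $\boldsymbol{\xi}'$ belong to the first Brillouin zone $\mathcal{B}'$ of $\mathcal{K}'$. Let $$M := \mathbf{curl}\,\tfrac{1}{n^2}\,\mathrm{curl} - \mathbf{grad}\,\mathrm{div}.$$ Consider $\mathbf{h}'=(h_x,h_y)\in \mathrm{H}^1_{\mathrm{loc}}(\mathbb{R}^2)^2$ such that $M\mathbf{h}'=\mathbf{f}'$ in $\mathbb{R}^2$ for some $\mathbf{f}'\in \mathrm{L}^2_{\mathrm{loc}}(\mathbb{R}^2)^2$; or the components $\mathbf{h}'=(h_x,h_y)$ of a field $\mathbf{h}=(h_x,h_y,h_z)\in \mathrm{H}^1_{\mathrm{loc}}(\mathbb{R}^2)^3$ that satisfies, for some $\kappa\in\mathbb{R}$, $$\nabla'_{(0,0,\beta)}\times\big(\tfrac{1}{n^2}\nabla'_{(0,0,\beta)}\times\mathbf{h}\big)=\kappa^2\mathbf{h},\qquad \nabla'_{(0,0,\beta)}\cdot\mathbf{h}=0\quad\text{in }\mathbb{R}^2 .$$ Then, in either case, $$\mathbf{h}'=(h_x,h_y)\in \mathrm{H}^{3/2-\eta}_{\mathrm{loc}}(\mathbb{R}^2)^2\qquad\text{for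 any }\eta>0 .$$
   Context: All differential equations are understood in the sense of distributions; functions are complex-valued. Two-dimensional operators: for a scalar $\varphi$, $\mathbf{curl}\,\varphi=(\partial_y\varphi,-\partial_x\varphi)$ and $\mathbf{grad}\,\varphi=(\partial_x\varphi,\partial_y\varphi)$; for a vector field $\mathbf{v}=(v_x,v_y)$, $\mathrm{curl}\,\mathbf{v}=\partial_xv_y-\partial_yv_x$ and $\mathrm{div}\,\mathbf{v}=\partial_xv_x+\partial_yv_y$. So $M\mathbf{v}=\mathbf{curl}(n^{-2}\,\mathrm{curl}\,\mathbf{v})-\mathbf{grad}(\mathrm{div}\,\mathbf{v})$. $\nabla'_{(0,0,\beta)}:=(\partial_x,\partial_y,i\beta)$, used formally as a gradient vector acting on three-component functions of $(x,y)$ through cross and dot products. Lattice: $\mathcal{K}'=\{k_1\mathbf{a}_1+k_2\mathbf{a}_2: k_1,k_2\in\mathbb{Z}\}$ with $\mathbf{a}_1,\mathbf{a}_2\in\mathbb{R}^2$ linearly independent. The first Brillouin zone $\mathcal{B}'$ is the Wigner-Seitz cell (points at least as close to $0$ as to any other lattice point) of the reciprocal lattice $\{\mathbf{g}\in\mathbb{R}^2:\mathbf{g}\cdot\mathbf{k}\in2\pi\mathbb{Z}\ \forall\mathbf{k}\in\mathcal{K}'\}$. Periodic polygonal partition: a finite family of pairwise disjoint Lipschitz open sets $P'_1,\dots,P'_J\subset\mathbb{R}^2$ with piecewise straight boundary, such that $\mathbb{R}^2=\overline{\cup_jP'_j}$ and $P'_j+\mathbf{k}=P'_j$ for all $\mathbf{k}\in\mathcal{K}'$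 and all $j$; the quotients $Q'_j=P'_j/\mathcal{K}'$ form a finite partition of the torus $Q'$ into polygonal subdomains. Any finite number of subdomains may meet at a corner. "For any $\eta>0$" is understood for those $\eta$ with nonnegative Sobolev exponent. *)

theory Defs
  imports "HOL-Analysis.Analysis"
begin

type_synonym plane = "real \<times> real"
type_synonym cfun = "plane \<Rightarrow> complex"

section \<open>Lattices and polygonal partitions\<close>

definition lattice_basis :: "plane \<Rightarrow> plane \<Rightarrow> bool" where
  "lattice_basis a1 a2 \<longleftrightarrow> a1 \<noteq> a2 \<and> independent {a1, a2}"

definition lattice_of :: "plane \<Rightarrow> plane \<Rightarrow> plane set" where
  "lattice_of a1 a2 =
     {of_int k1 *\<^sub>R a1 + of_int k2 *\<^sub>R a2 | k1 k2 :: int. True}"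

definition reciprocal_lattice :: "plane set \<Rightarrow> plane set" where
  "reciprocal_lattice K = {g. \<forall>k\<in>K. \<exists>m::int. g \<bullet> k = 2 * pi * of_int m}"

definition brillouin_zone :: "plane set \<Rightarrow> plane set" where
  "brillouin_zone K = {\<xi>. \<forall>g\<in>reciprocal_lattice K. dist \<xi> 0 \<le> dist \<xi> g}"

text \<open>Near each boundary point, in suitable orthonormal coordinates \<open>(s, t)\<close> centred there,
  the set is the region below the graph of a Lipschitz function.\<close>

definition lipschitz_open_set :: "plane set \<Rightarrow> bool" where
  "lipschitz_open_set A \<longleftrightarrow> open A \<and>
     (\<forall>p\<in>frontier A. \<exists>d e \<delta> \<epsilon> C g.
        norm d = 1 \<and> norm e = 1 \<and> d \<bullet> e = 0 \<and> 0 < \<delta> \<and> 0 < \<epsilon> \<and>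
        C-lipschitz_on {-\<delta><..<\<delta>} (g :: real \<Rightarrow> real) \<and>
        (\<forall>s t. \<bar>s\<bar> < \<delta> \<longrightarrow> \<bar>t\<bar> < \<epsilon> \<longrightarrow>
           (p + s *\<^sub>R d + t *\<^sub>R e \<in> A \<longleftrightarrow> t < g s)))"

text \<open>The sets at hand are periodic, hence in general unbounded, so finiteness of the number of
  edges is imposed on bounded regions; for a lattice-periodic set this means finitely many edges
  modulo the lattice.\<close>

definition piecewise_straight_boundary :: "plane set \<Rightarrow> bool" where
  "piecewise_straight_boundary A \<longleftrightarrow>
     (\<forall>r. \<exists>E. finite E \<and>
        frontier A \<inter> cball 0 r = (\<Union>(a, b)\<in>E. closed_segment a b))"

definition periodic_polygonal_partition :: "plane set \<Rightarrow> nat \<Rightarrow> (nat \<Rightarrow> plane set) \<Rightarrow> bool" where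
  "periodic_polygonal_partition K J P \<longleftrightarrow>
     disjoint_family_on P {1..J} \<and>
     closure (\<Union>j\<in>{1..J}. P j) = UNIV \<and>
     (\<forall>j\<in>{1..J}. lipschitz_open_set (P j) \<and> piecewise_straight_boundary (P j) \<and>
        (\<forall>k\<in>K. (\<lambda>p. p + k) ` P j = P j))"

section \<open>Distributions on the plane\<close>

definition dir_deriv :: "plane \<Rightarrow> cfun \<Rightarrow> cfun" where
  "dir_deriv v \<phi> = (\<lambda>p. frechet_derivative \<phi> (at p) v)"

definition smooth :: "cfun \<Rightarrow> bool" where
  "smooth \<phi> \<longleftrightarrow> (\<forall>vs. foldr dir_deriv vs \<phi> differentiable_on UNIV)"

definition test_fun :: "cfun \<Rightarrow> bool" where
  "test_fun \<phi> \<longleftrightarrow> smooth \<phi> \<and> compact (closure {p. \<phi> p \<noteq> 0})"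

text \<open>A distribution is represented by any functional on functions that restricts to it on test
  functions; only the values on test functions matter, whence the relation \<open>=\<^sub>D\<close>.\<close>

type_synonym distr = "cfun \<Rightarrow> complex"

definition distr_eq :: "distr \<Rightarrow> distr \<Rightarrow> bool" (infix "=\<^sub>D" 50) where
  "S =\<^sub>D T \<longleftrightarrow> (\<forall>\<phi>. test_fun \<phi> \<longrightarrow> S \<phi> = T \<phi>)"

definition L1_loc :: "cfun set" where
  "L1_loc = {u \<in> borel_measurable lebesgue. \<forall>K. compact K \<longrightarrow> set_integrable lebesgue K u}"

definition L2_loc :: "cfun set" where
  "L2_loc = {u \<in> borel_measurable lebesgue.
     \<forall>K. compact K \<longrightarrow> set_integrable lebesgue K (\<lambda>p. (cmod (u p))\<^sup>2)}"

definition L2 :: "cfun set" where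
  "L2 = {u \<in> borel_measurable lebesgue. integrable lebesgue (\<lambda>p. (cmod (u p))\<^sup>2)}"

definition regular :: "cfun \<Rightarrow> distr" where
  "regular u = (\<lambda>\<phi>. \<integral>p. u p * \<phi> p \<partial>lebesgue)"

definition dx :: "distr \<Rightarrow> distr" where
  "dx T = (\<lambda>\<phi>. - T (dir_deriv (1, 0) \<phi>))"

definition dy :: "distr \<Rightarrow> distr" where
  "dy T = (\<lambda>\<phi>. - T (dir_deriv (0, 1) \<phi>))"

text \<open>Multiplication by a discontinuous coefficient makes sense for regular distributions; the
  density is unique almost everywhere, so the choice is immaterial.\<close>

definition density_of :: "distr \<Rightarrow> cfun" where
  "density_of T = (SOME u. u \<in> L1_loc \<and> T =\<^sub>D regular u)"

definition coeff_mult :: "(plane \<Rightarrow> real) \<Rightarrow> distr \<Rightarrow> distr" where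
  "coeff_mult c T = regular (\<lambda>p. of_real (c p) * density_of T p)"

section \<open>Sobolev spaces\<close>

text \<open>Sobolev--Slobodeckij spaces of order \<open>s \<ge> 0\<close>: with \<open>m = \<lfloor>s\<rfloor>\<close>, the weak derivatives up to
  order \<open>m\<close> lie in \<open>L\<^sup>2\<close> and, if \<open>s\<close> is not an integer, those of order \<open>m\<close> have a finite Gagliardo
  seminorm of order \<open>s - m\<close>. The exponent \<open>2 + 2\<sigma>\<close> reflects the dimension two; the diagonal,
  where the quotient is 0, is a null set.\<close>

definition gagliardo_sq :: "real \<Rightarrow> cfun \<Rightarrow> ennreal" where
  "gagliardo_sq \<sigma> u = (\<integral>\<^sup>+p. (\<integral>\<^sup>+q.
     ennreal ((cmod (u p - u q))\<^sup>2 / dist p q powr (2 + 2 * \<sigma>)) \<partial>lebesgue) \<partial>lebesgue)"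

definition sobolev :: "real \<Rightarrow> cfun set" where
  "sobolev s = {u \<in> L2. \<forall>i j. i + j \<le> nat \<lfloor>s\<rfloor> \<longrightarrow>
     (\<exists>g\<in>L2. (dx ^^ i) ((dy ^^ j) (regular u)) =\<^sub>D regular g \<and>
        (i + j = nat \<lfloor>s\<rfloor> \<and> 0 < frac s \<longrightarrow> gagliardo_sq (frac s) g < \<infinity>))}"

definition sobolev_loc :: "real \<Rightarrow> cfun set" where
  "sobolev_loc s = {u. \<forall>\<phi>. test_fun \<phi> \<longrightarrow> (\<lambda>p. \<phi> p * u p) \<in> sobolev s}"

section \<open>Differential operators\<close>

definition curl_of_scalar :: "distr \<Rightarrow> distr \<times> distr" where
  "curl_of_scalar T = (dy T, \<lambda>\<phi>. - dx T \<phi>)"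

definition grad :: "distr \<Rightarrow> distr \<times> distr" where
  "grad T = (dx T, dy T)"

fun curl_of_vector :: "distr \<times> distr \<Rightarrow> distr" where
  "curl_of_vector (Vx, Vy) = (\<lambda>\<phi>. dx Vy \<phi> - dy Vx \<phi>)"

fun divergence :: "distr \<times> distr \<Rightarrow> distr" where
  "divergence (Vx, Vy) = (\<lambda>\<phi>. dx Vx \<phi> + dy Vy \<phi>)"

definition M_op :: "(plane \<Rightarrow> real) \<Rightarrow> distr \<times> distr \<Rightarrow> distr \<times> distr" where
  "M_op n V =
     (let (Cx, Cy) = curl_of_scalar (coeff_mult (\<lambda>p. 1 / (n p)\<^sup>2) (curl_of_vector V));
          (Gx, Gy) = grad (divergence V)
      in (\<lambda>\<phi>. Cx \<phi> - Gx \<phi>, \<lambda>\<phi>. Cy \<phi> - Gy \<phi>))"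

text \<open>The formal products \<open>\<nabla> \<times> V\<close> and \<open>\<nabla> \<bullet> V\<close> with \<open>\<nabla> = (\<partial>\<^sub>x, \<partial>\<^sub>y, \<i>\<beta>)\<close>.\<close>

fun nabla_cross :: "real \<Rightarrow> distr \<times> distr \<times> distr \<Rightarrow> distr \<times> distr \<times> distr" where
  "nabla_cross \<beta> (Vx, Vy, Vz) =
     (\<lambda>\<phi>. dy Vz \<phi> - \<i> * of_real \<beta> * Vy \<phi>,
      \<lambda>\<phi>. \<i> * of_real \<beta> * Vx \<phi> - dx Vz \<phi>,
      \<lambda>\<phi>. dx Vy \<phi> - dy Vx \<phi>)"

fun nabla_dot :: "real \<Rightarrow> distr \<times> distr \<times> distr \<Rightarrow> distr" where
  "nabla_dot \<beta> (Vx, Vy, Vz) = (\<lambda>\<phi>. dx Vx \<phi> + dy Vy \<phi> + \<i> * of_real \<beta> * Vz \<phi>)"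

fun coeff_mult3 :: "(plane \<Rightarrow> real) \<Rightarrow> distr \<times> distr \<times> distr \<Rightarrow> distr \<times> distr \<times> distr" where
  "coeff_mult3 c (Vx, Vy, Vz) = (coeff_mult c Vx, coeff_mult c Vy, coeff_mult c Vz)"

fun distr_eq2 :: "distr \<times> distr \<Rightarrow> distr \<times> distr \<Rightarrow> bool" where
  "distr_eq2 (Sx, Sy) (Tx, Ty) \<longleftrightarrow> Sx =\<^sub>D Tx \<and> Sy =\<^sub>D Ty"

fun distr_eq3 :: "distr \<times> distr \<times> distr \<Rightarrow> distr \<times> distr \<times> distr \<Rightarrow> bool" where
  "distr_eq3 (Sx, Sy, Sz) (Tx, Ty, Tz) \<longleftrightarrow> Sx =\<^sub>D Tx \<and> Sy =\<^sub>D Ty \<and> Sz =\<^sub>D Tz"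

definition solves_M :: "(plane \<Rightarrow> real) \<Rightarrow> cfun \<times> cfun \<Rightarrow> cfun \<times> cfun \<Rightarrow> bool" where
  "solves_M n h f \<longleftrightarrow>
     distr_eq2 (M_op n (map_prod regular regular h)) (map_prod regular regular f)"

definition solves_maxwell ::
    "(plane \<Rightarrow> real) \<Rightarrow> real \<Rightarrow> real \<Rightarrow> cfun \<times> cfun \<times> cfun \<Rightarrow> bool" where
  "solves_maxwell n \<beta> \<kappa> h \<longleftrightarrow>
     (let (hx, hy, hz) = h; V = (regular hx, regular hy, regular hz) in
      distr_eq3
        (nabla_cross \<beta> (coeff_mult3 (\<lambda>p. 1 / (n p)\<^sup>2) (nabla_cross \<beta> V)))
        (\<lambda>\<phi>. of_real (\<kappa>\<^sup>2) * regular hx \<phi>,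
         \<lambda>\<phi>. of_real (\<kappa>\<^sup>2) * regular hy \<phi>,
         \<lambda>\<phi>. of_real (\<kappa>\<^sup>2) * regular hz \<phi>) \<and>
      nabla_dot \<beta> V =\<^sub>D (\<lambda>\<phi>. 0))"

end

theory Submission
  imports Defs
begin

text \<open>
  Let \<open>w = curl h' / n\<^sup>2\<close> and \<open>d = div h'\<close>. In both cases of the theorem the second-order equations say
  that \<open>(w, d)\<close> solves a Cauchy--Riemann system whose right-hand side is locally square integrable. For
  compactly supported fields the squared \<open>L\<^sup>2\<close> norm of the full gradient equals the sum of those of
  divergence and curl (\<open>energy_identity\<close>), so \<open>w\<close> and \<open>d\<close> are in \<open>H\<^sup>1\<close> locally, across all interfaces.

  The field \<open>h'\<close> itself satisfies \<open>div h' = d\<close> and \<open>curl h' = n\<^sup>2 w\<close>, and the coefficient \<open>n\<^sup>2\<close> jumps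
  across the interfaces. These lie on finitely many lines in every bounded region, and an \<open>H\<^sup>1\<close> function
  has only \<open>O(\<delta>)\<close> of its squared norm in a strip of width \<open>\<delta>\<close> around a line. Translation by \<open>k\<close>
  therefore changes \<open>n\<^sup>2 w\<close> by \<open>O(\<bar>k\<bar> powr (1 / 2))\<close> in \<open>L\<^sup>2\<close> (\<open>jump_multiplier_half_holder\<close>). The energy
  identity, applied to the difference between the localised field and its translate, gives the same
  rate for the gradient of \<open>h'\<close> (\<open>gradient_difference\<close>). Integrating the squared rate against the
  kernel \<open>1 / \<bar>k\<bar> powr (2 + 2 \<sigma>)\<close> shows that the Gagliardo seminorm of order \<open>\<sigma>\<close> of the gradient is
  finite for every \<open>\<sigma> < 1 / 2\<close> (\<open>gagliardo_finite\<close>), which is the claim for exponents above one; below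
  one the first-order translation estimate for \<open>H\<^sup>1\<close> functions is enough.

  All estimates are proved for mollified functions and carried over by Fatou's lemma along a
  subsequence that converges almost everywhere. Two further uses of mollification bring the
  distributional hypotheses into this form: the fundamental lemma of the calculus of variations, which
  makes the density in \<open>coeff_mult\<close> unique almost everywhere, and the construction of a global weak
  gradient from the localised ones in \<open>sobolev_loc\<close> (\<open>patch_weak_derivative\<close>).
\<close>

(* Points of the plane are handled as vectors: quantifiers over pairs stay unsplit. *)
declare split_paired_All [simp del] split_paired_Ex [simp del]

section \<open>Smooth functions and test functions\<close>

lemma smooth_iff: "smooth f \<longleftrightarrow> (\<forall>p. f differentiable at p) \<and> (\<forall>v. smooth (dir_deriv v f))"
proof
  assume s: "smooth f"
  have "f differentiable at p" for p
    using s[unfolded smooth_def, rule_format, of "[]"] by (simp add: differentiable_on_def)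
  moreover have "smooth (dir_deriv v f)" for v
    unfolding smooth_def using s[unfolded smooth_def, rule_format, of "_ @ [v]"] by simp
  ultimately show "(\<forall>p. f differentiable at p) \<and> (\<forall>v. smooth (dir_deriv v f))" by blast
next
  assume *: "(\<forall>p. f differentiable at p) \<and> (\<forall>v. smooth (dir_deriv v f))"
  show "smooth f" unfolding smooth_def
  proof
    fix vs show "foldr dir_deriv vs f differentiable_on UNIV"
    proof (cases vs rule: rev_cases)
      case Nil then show ?thesis using * by (simp add: differentiable_on_def)
    next
      case (snoc ys y) then show ?thesis using * by (simp add: smooth_def)
    qed
  qed
qed

text \<open>Smoothness refers to all iterated directional derivatives at once, so it is proved
  coinductively: exhibit a class of differentiable functions that contains \<open>f\<close> and is closed under
  directional derivatives.\<close>

lemma smooth_coinduct: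
  assumes "P f"
    and "\<And>f p. P f \<Longrightarrow> f differentiable at p"
    and "\<And>f v. P f \<Longrightarrow> P (dir_deriv v f)"
  shows "smooth f"
proof -
  have "P (foldr dir_deriv vs f)" for vs
    by (induction vs) (auto simp: assms(1) intro: assms(3))
  then show ?thesis
    unfolding smooth_def differentiable_on_def using assms(2) by auto
qed

lemma dir_deriv_eqI: "(f has_derivative f') (at p) \<Longrightarrow> dir_deriv v f p = f' v"
  unfolding dir_deriv_def using frechet_derivative_at by metis

lemma has_derivative_dir_deriv:
  "f differentiable at p \<Longrightarrow> (f has_derivative (\<lambda>v. dir_deriv v f p)) (at p)"
  unfolding dir_deriv_def by (simp add: frechet_derivative_works[symmetric])

text \<open>The derivatives of \<open>exp (- 1 / t)\<close>, extended by zero to \<open>t \<le> 0\<close>, are linear combinations of the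
  functions \<open>exp (- 1 / t) / t ^ k\<close>; the whole family is therefore closed under differentiation.\<close>

definition flat_exp :: "nat \<Rightarrow> real \<Rightarrow> real" where
  "flat_exp k t = (if t > 0 then exp (- (1 / t)) / t ^ k else 0)"

text \<open>Only \<open>t = 0\<close> needs an argument: there the difference quotient is \<open>s ^ (k + 1) / exp s\<close> with
  \<open>s = 1 / t\<close>, which tends to zero.\<close>

lemma flat_exp_deriv:
  "(flat_exp k has_real_derivative (flat_exp (k + 2) t - k * flat_exp (k + 1) t)) (at t)"
proof -
  consider "t > 0" | "t < 0" | "t = 0" by linarith
  then show ?thesis
  proof cases
    case 1
    have "((\<lambda>t. exp (- (1 / t)) / t ^ k) has_real_derivative
        (flat_exp (k + 2) t - k * flat_exp (k + 1) t)) (at t)"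
      using 1
      by (auto intro!: derivative_eq_intros simp: flat_exp_def divide_simps power2_eq_square power_add)
        (cases k; simp add: algebra_simps)
    then show ?thesis
      by (rule DERIV_cong_ev[OF refl _ refl, THEN iffD1, rotated])
        (auto simp: flat_exp_def eventually_nhds intro!: exI[of _ "{0<..}"] 1)
  next
    case 2
    have "((\<lambda>t. 0) has_real_derivative (flat_exp (k + 2) t - k * flat_exp (k + 1) t)) (at t)"
      using 2 by (auto simp: flat_exp_def)
    then show ?thesis
      by (rule DERIV_cong_ev[OF refl _ refl, THEN iffD1, rotated])
        (auto simp: flat_exp_def eventually_nhds intro!: exI[of _ "{..<0}"] 2)
  next
    case 3
    have "((\<lambda>s. s ^ (k + 1) / exp s) \<longlongrightarrow> (0::real)) at_top"
      by (rule tendsto_power_div_exp_0)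
    then have "((\<lambda>h. inverse h ^ (k + 1) / exp (inverse h)) \<longlongrightarrow> (0::real)) (at_right 0)"
      by (rule filterlim_compose[OF _ filterlim_inverse_at_top_right])
    then have r: "((\<lambda>h. flat_exp k h / h) \<longlongrightarrow> 0) (at_right 0)"
      by (rule Lim_transform_eventually)
        (auto simp: eventually_at_filter flat_exp_def exp_minus field_simps)
    have l: "((\<lambda>h. flat_exp k h / h) \<longlongrightarrow> 0) (at_left 0)"
      by (rule Lim_transform_eventually[OF tendsto_const])
        (auto simp: eventually_at_filter flat_exp_def)
    have "((\<lambda>h. flat_exp k h / h) \<longlongrightarrow> 0) (at 0)"
      using l r by (simp add: filterlim_split_at)
    then show ?thesis
      using 3 by (simp add: DERIV_def flat_exp_def)
  qed
qed

definition bump :: "real \<Rightarrow> nat \<Rightarrow> cfun" where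
  "bump \<epsilon> k p = of_real (flat_exp k (\<epsilon>\<^sup>2 - p \<bullet> p))"

lemma bump_deriv:
  "(bump \<epsilon> k has_derivative (\<lambda>v. (-2) * of_real (p \<bullet> v) *
      (bump \<epsilon> (k + 2) p + (- of_nat k) * bump \<epsilon> (k + 1) p))) (at p)"
proof -
  have "((\<lambda>p. flat_exp k (\<epsilon>\<^sup>2 - p \<bullet> p)) has_derivative (\<lambda>v.
      (- (p \<bullet> v + v \<bullet> p)) * (flat_exp (k + 2) (\<epsilon>\<^sup>2 - p \<bullet> p) - k * flat_exp (k + 1) (\<epsilon>\<^sup>2 - p \<bullet> p)))) (at p)"
    by (rule has_derivative_eq_rhs, rule DERIV_compose_FDERIV[OF flat_exp_deriv])
      (auto intro!: derivative_eq_intros)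
  from has_derivative_of_real[OF this, where 'a = complex] show ?thesis
    unfolding bump_def[abs_def] by (rule has_derivative_eq_rhs) (auto simp: inner_commute)
qed

text \<open>All closure properties of smooth functions follow from one induction: the algebra generated by
  the smooth functions, their compositions with affine maps, and the bumps consists of differentiable
  functions and is closed under directional derivatives, hence contains smooth functions only.\<close>

inductive smooth_alg :: "cfun \<Rightarrow> bool" where
  base: "smooth f \<Longrightarrow> smooth_alg (\<lambda>q. f (a + c *\<^sub>R q))"
| bump: "smooth_alg (bump \<epsilon> k)"
| const: "smooth_alg (\<lambda>q. z)"
| lin: "smooth_alg (\<lambda>q. of_real (q \<bullet> a))"
| add: "smooth_alg f \<Longrightarrow> smooth_alg g \<Longrightarrow> smooth_alg (\<lambda>q. f q + g q)"
| mult: "smooth_alg f \<Longrightarrow> smooth_alg g \<Longrightarrow> smooth_alg (\<lambda>q. f q * g q)"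
| cnj: "smooth_alg f \<Longrightarrow> smooth_alg (\<lambda>q. cnj (f q))"

lemma smooth_alg_deriv:
  "smooth_alg f \<Longrightarrow> (\<forall>p. f differentiable at p) \<and> (\<forall>v. smooth_alg (dir_deriv v f))"
proof (induction rule: smooth_alg.induct)
  case (base f a c)
  have *: "((\<lambda>q. f (a + c *\<^sub>R q)) has_derivative (\<lambda>v. dir_deriv (c *\<^sub>R v) f (a + c *\<^sub>R p))) (at p)" for p
  proof -
    have "f differentiable at (a + c *\<^sub>R p)" using base smooth_iff by blast
    note has_derivative_dir_deriv[OF this]
    then have "(f has_derivative (\<lambda>v. dir_deriv v f (a + c *\<^sub>R p))) (at (a + c *\<^sub>R p))" .
    moreover have "((\<lambda>q. a + c *\<^sub>R q) has_derivative (\<lambda>v. c *\<^sub>R v)) (at p)"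
      by (auto intro!: derivative_eq_intros)
    ultimately show ?thesis
      by (rule has_derivative_compose[rotated])
  qed
  have "dir_deriv v (\<lambda>q. f (a + c *\<^sub>R q)) = (\<lambda>p. dir_deriv (c *\<^sub>R v) f (a + c *\<^sub>R p))" for v
    by (rule ext) (rule dir_deriv_eqI[OF *])
  moreover have "smooth_alg (\<lambda>p. dir_deriv (c *\<^sub>R v) f (a + c *\<^sub>R p))" for v
    using base smooth_iff smooth_alg.base by blast
  ultimately show ?case using differentiableI[OF *] by metis
next
  case (bump \<epsilon> k)
  have eq: "dir_deriv v (bump \<epsilon> k) = (\<lambda>p. (-2) * of_real (p \<bullet> v) *
      (bump \<epsilon> (k + 2) p + (- of_nat k) * bump \<epsilon> (k + 1) p))" for v
    by (rule ext) (rule dir_deriv_eqI[OF bump_deriv])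
  have "smooth_alg (\<lambda>p. (-2) * of_real (p \<bullet> v) *
      (bump \<epsilon> (k + 2) p + (- of_nat k) * bump \<epsilon> (k + 1) p))" for v
    by (intro smooth_alg.mult smooth_alg.add smooth_alg.const smooth_alg.lin smooth_alg.bump)
  then have "\<forall>v. smooth_alg (dir_deriv v (bump \<epsilon> k))" by (simp only: eq) simp
  moreover have "\<forall>p. bump \<epsilon> k differentiable at p" using differentiableI[OF bump_deriv] by blast
  ultimately show ?case by blast
next
  case (const z)
  have "dir_deriv v (\<lambda>q. z) = (\<lambda>q. 0)" for v
    by (rule ext) (rule dir_deriv_eqI[OF has_derivative_const])
  then show ?case by (simp add: smooth_alg.const)
next
  case (lin a)
  have *: "((\<lambda>q. of_real (q \<bullet> a)) has_derivative (\<lambda>v. of_real (v \<bullet> a) :: complex)) (at p)" for p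
    by (auto intro!: derivative_eq_intros)
  have "dir_deriv v (\<lambda>q. of_real (q \<bullet> a)) = (\<lambda>q. of_real (v \<bullet> a))" for v
    by (rule ext) (rule dir_deriv_eqI[OF *])
  then show ?case using differentiableI[OF *] by (simp add: smooth_alg.const)
next
  case (add f g)
  have *: "((\<lambda>q. f q + g q) has_derivative (\<lambda>v. dir_deriv v f p + dir_deriv v g p)) (at p)" for p
    using add by (intro has_derivative_add has_derivative_dir_deriv) auto
  have "dir_deriv v (\<lambda>q. f q + g q) = (\<lambda>p. dir_deriv v f p + dir_deriv v g p)" for v
    by (rule ext) (rule dir_deriv_eqI[OF *])
  then show ?case using differentiableI[OF *] add.IH by (simp add: smooth_alg.add)
next
  case (mult f g)
  have *: "((\<lambda>q. f q * g q) has_derivative (\<lambda>v. f p * dir_deriv v g p + dir_deriv v f p * g p)) (at p)" for p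
    using mult by (intro has_derivative_mult has_derivative_dir_deriv) auto
  have "dir_deriv v (\<lambda>q. f q * g q) = (\<lambda>p. f p * dir_deriv v g p + dir_deriv v f p * g p)" for v
    by (rule ext) (rule dir_deriv_eqI[OF *])
  then show ?case using differentiableI[OF *] mult.IH mult.hyps
    by (simp add: smooth_alg.add smooth_alg.mult)
next
  case (cnj f)
  have *: "((\<lambda>q. cnj (f q)) has_derivative (\<lambda>v. cnj (dir_deriv v f p))) (at p)" for p
    using cnj by (intro has_derivative_cnj has_derivative_dir_deriv) auto
  have "dir_deriv v (\<lambda>q. cnj (f q)) = (\<lambda>p. cnj (dir_deriv v f p))" for v
    by (rule ext) (rule dir_deriv_eqI[OF *])
  then show ?case using differentiableI[OF *] cnj.IH by (simp add: smooth_alg.cnj)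
qed

lemma smooth_alg_iff: "smooth_alg f \<longleftrightarrow> smooth f"
proof
  assume "smooth_alg f"
  then show "smooth f" by (rule smooth_coinduct[of smooth_alg]) (use smooth_alg_deriv in blast)+
next
  assume "smooth f"
  from smooth_alg.base[OF this, of 0 1] show "smooth_alg f" by simp
qed

lemmas smooth_affine = smooth_alg.base[unfolded smooth_alg_iff]
lemmas smooth_bump = smooth_alg.bump[unfolded smooth_alg_iff]
lemmas smooth_const = smooth_alg.const[unfolded smooth_alg_iff]
lemmas smooth_add = smooth_alg.add[unfolded smooth_alg_iff]
lemmas smooth_mult = smooth_alg.mult[unfolded smooth_alg_iff]
lemmas smooth_cnj = smooth_alg.cnj[unfolded smooth_alg_iff]

lemma smooth_has_derivative: "smooth f \<Longrightarrow> (f has_derivative (\<lambda>v. dir_deriv v f p)) (at p)"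
  using smooth_iff has_derivative_dir_deriv by blast

lemma smooth_dir_deriv: "smooth f \<Longrightarrow> smooth (dir_deriv v f)"
  using smooth_iff by blast

lemma smooth_continuous_on: "smooth f \<Longrightarrow> continuous_on A f"
  by (meson has_derivative_continuous_on has_derivative_at_withinI smooth_has_derivative)

lemma dir_deriv_mult:
  assumes "smooth f" "smooth g"
  shows "dir_deriv v (\<lambda>q. f q * g q) p = f p * dir_deriv v g p + dir_deriv v f p * g p"
  by (intro dir_deriv_eqI has_derivative_mult smooth_has_derivative assms)

lemma dir_deriv_cnj:
  assumes "smooth f" shows "dir_deriv v (\<lambda>q. cnj (f q)) p = cnj (dir_deriv v f p)"
  by (intro dir_deriv_eqI has_derivative_cnj smooth_has_derivative assms)

lemma dir_deriv_affine:
  assumes "smooth f"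
  shows "dir_deriv v (\<lambda>q. f (a + c *\<^sub>R q)) p = of_real c * dir_deriv v f (a + c *\<^sub>R p)"
proof -
  have "((\<lambda>q. a + c *\<^sub>R q) has_derivative (\<lambda>v. c *\<^sub>R v)) (at p)"
    by (auto intro!: derivative_eq_intros)
  from has_derivative_compose[OF this smooth_has_derivative[OF assms]]
  have "dir_deriv v (\<lambda>q. f (a + c *\<^sub>R q)) p = dir_deriv (c *\<^sub>R v) f (a + c *\<^sub>R p)"
    by (rule dir_deriv_eqI)
  also have "\<dots> = c *\<^sub>R dir_deriv v f (a + c *\<^sub>R p)"
    by (rule linear_cmul[OF has_derivative_linear[OF smooth_has_derivative[OF assms]]])
  finally show ?thesis by (simp add: scaleR_conv_of_real)
qed

lemma dir_deriv_split:
  assumes "smooth f"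
  shows "dir_deriv v f p = of_real (fst v) * dir_deriv (1, 0) f p + of_real (snd v) * dir_deriv (0, 1) f p"
proof -
  have l: "linear (\<lambda>v. dir_deriv v f p)"
    by (rule has_derivative_linear[OF smooth_has_derivative[OF assms]])
  have "dir_deriv v f p = dir_deriv (fst v *\<^sub>R (1, 0) + snd v *\<^sub>R (0, 1)) f p"
    by (simp)
  also have "\<dots> = fst v *\<^sub>R dir_deriv (1, 0) f p + snd v *\<^sub>R dir_deriv (0, 1) f p"
    using linear_add[OF l] linear_cmul[OF l] by presburger
  finally show ?thesis by (simp add: scaleR_conv_of_real)
qed

lemma test_fun_iff: "test_fun f \<longleftrightarrow> smooth f \<and> (\<exists>R. \<forall>p. norm p > R \<longrightarrow> f p = 0)"
proof -
  have "compact (closure {p. f p \<noteq> 0}) \<longleftrightarrow> bounded {p. f p \<noteq> 0}"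
    by (metis bounded_closure bounded_subset closed_closure closure_subset compact_eq_bounded_closed)
  also have "\<dots> \<longleftrightarrow> (\<exists>R. \<forall>p. norm p > R \<longrightarrow> f p = 0)"
    unfolding bounded_iff by (auto simp: not_less) (meson not_less)+
  finally show ?thesis by (simp add: test_fun_def)
qed

lemma test_fun_smooth: "test_fun f \<Longrightarrow> smooth f"
  by (simp add: test_fun_def)

lemma test_fun_support:
  assumes "test_fun f"
  obtains R where "R > 0" "\<And>p. norm p > R \<Longrightarrow> f p = 0" "\<And>p v. norm p > R \<Longrightarrow> dir_deriv v f p = 0"
proof -
  obtain R where R: "\<And>p. norm p > R \<Longrightarrow> f p = 0" using assms unfolding test_fun_iff by blast
  have "dir_deriv v f p = 0" if "norm p > max R 1" for p v
  proof -
    have "open {p::plane. norm p > R}" by (intro open_Collect_less continuous_intros)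
    then have "(f has_derivative (\<lambda>v. 0)) (at p)"
      by (rule has_derivative_transform_within_open[OF has_derivative_const]) (use that R in simp_all)
    from dir_deriv_eqI[OF this] show ?thesis .
  qed
  then show thesis by (intro that[of "max R 1"] R) auto
qed

lemma test_fun_dir_deriv: "test_fun f \<Longrightarrow> test_fun (dir_deriv v f)"
  by (subst test_fun_iff) (meson smooth_dir_deriv test_fun_smooth test_fun_support)

lemma test_fun_mult: "test_fun f \<Longrightarrow> smooth g \<Longrightarrow> test_fun (\<lambda>p. f p * g p)"
  by (auto simp: test_fun_iff smooth_mult)

lemma test_fun_add:
  assumes "test_fun f" "test_fun g" shows "test_fun (\<lambda>p. f p + g p)"
proof -
  obtain R S where "\<And>p. norm p > R \<Longrightarrow> f p = 0" "\<And>p. norm p > S \<Longrightarrow> g p = 0"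
    using assms unfolding test_fun_iff by blast
  then have "\<forall>p. norm p > max R S \<longrightarrow> f p + g p = 0" by simp
  then show ?thesis using assms smooth_add unfolding test_fun_iff by blast
qed

lemma test_fun_affine:
  assumes "test_fun f" "c \<noteq> 0" shows "test_fun (\<lambda>p. f (a + c *\<^sub>R p))"
proof -
  obtain R where R: "\<And>p. norm p > R \<Longrightarrow> f p = 0" using assms unfolding test_fun_iff by blast
  have "f (a + c *\<^sub>R p) = 0" if "norm p > (R + norm a) / \<bar>c\<bar>" for p
  proof (rule R)
    have "R + norm a < \<bar>c\<bar> * norm p" using that assms(2) by (simp add: field_simps)
    also have "\<dots> = norm (c *\<^sub>R p)" by simp
    also have "\<dots> \<le> norm (a + c *\<^sub>R p) + norm a" by (metis add.commute add_diff_cancel_left' norm_triangle_ineq4)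
    finally show "norm (a + c *\<^sub>R p) > R" by simp
  qed
  then show ?thesis unfolding test_fun_iff[of "\<lambda>p. f (a + c *\<^sub>R p)"]
    using smooth_affine[OF test_fun_smooth[OF assms(1)]] by (intro conjI exI[of _ "(R + norm a) / \<bar>c\<bar>"]) auto
qed

lemma test_fun_bounded:
  assumes "test_fun f" obtains B where "B > 0" "\<And>p. norm (f p) \<le> B"
proof -
  obtain R where R: "\<And>p. norm p > R \<Longrightarrow> f p = 0" using assms unfolding test_fun_iff by blast
  have "bounded (f ` cball 0 R)"
    by (intro compact_imp_bounded compact_continuous_image smooth_continuous_on test_fun_smooth assms) auto
  then obtain B where B: "B > 0" "\<And>p. p \<in> cball 0 R \<Longrightarrow> norm (f p) \<le> B"
    unfolding bounded_pos by auto
  have "norm (f p) \<le> B" for p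
    using B R[of p] by (cases "norm p \<le> R") auto
  with B(1) show thesis by (rule that)
qed

lemma norm_fst_snd_le: "\<bar>fst (v::plane)\<bar> \<le> norm v" "\<bar>snd v\<bar> \<le> norm v"
  by (metis norm_fst_le real_norm_def prod.collapse) (metis norm_snd_le real_norm_def prod.collapse)

lemma test_fun_lipschitz:
  assumes "test_fun f" obtains L where "L > 0" "\<And>p q. norm (f p - f q) \<le> L * norm (p - q)"
proof -
  obtain B1 where B1: "B1 > 0" "\<And>p. norm (dir_deriv (1, 0) f p) \<le> B1"
    using test_fun_bounded[OF test_fun_dir_deriv[OF assms]] by metis
  obtain B2 where B2: "B2 > 0" "\<And>p. norm (dir_deriv (0, 1) f p) \<le> B2"
    using test_fun_bounded[OF test_fun_dir_deriv[OF assms]] by metis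
  have "norm (f p - f q) \<le> (B1 + B2) * norm (p - q)" for p q
  proof (rule differentiable_bound[of UNIV f "\<lambda>p v. dir_deriv v f p"])
    show "onorm (\<lambda>v. dir_deriv v f p) \<le> B1 + B2" for p
    proof (rule onorm_le)
      fix v :: plane
      have "norm (dir_deriv v f p) \<le> \<bar>fst v\<bar> * norm (dir_deriv (1, 0) f p) + \<bar>snd v\<bar> * norm (dir_deriv (0, 1) f p)"
        unfolding dir_deriv_split[OF test_fun_smooth[OF assms], of v]
        by (rule order_trans[OF norm_triangle_ineq]) (simp add: norm_mult)
      also have "\<dots> \<le> norm v * B1 + norm v * B2"
        using B1 B2 by (intro add_mono mult_mono norm_fst_snd_le) auto
      finally show "norm (dir_deriv v f p) \<le> (B1 + B2) * norm v" by (simp add: algebra_simps)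
    qed
  qed (auto intro: has_derivative_at_withinI smooth_has_derivative test_fun_smooth assms)
  then show thesis using that[of "B1 + B2"] B1(1) B2(1) by auto
qed

text \<open>The remainder is bounded uniformly in the base point because the first derivatives of a test
  function are globally Lipschitz. The uniformity is what permits differentiation under the integral
  sign.\<close>

lemma test_fun_taylor:
  assumes "test_fun f"
  obtains M where "M > 0"
    "\<And>p h. norm (f (p + h) - f p - dir_deriv h f p) \<le> M * (norm h)\<^sup>2"
proof -
  obtain L1 where L1: "L1 > 0" "\<And>p q. norm (dir_deriv (1, 0) f p - dir_deriv (1, 0) f q) \<le> L1 * norm (p - q)"
    using test_fun_lipschitz[OF test_fun_dir_deriv[OF assms]] by metis
  obtain L2 where L2: "L2 > 0" "\<And>p q. norm (dir_deriv (0, 1) f p - dir_deriv (0, 1) f q) \<le> L2 * norm (p - q)"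
    using test_fun_lipschitz[OF test_fun_dir_deriv[OF assms]] by metis
  have s: "smooth f" using assms test_fun_smooth by blast
  have "norm (f (p + h) - f p - dir_deriv h f p) \<le> (L1 + L2) * (norm h)\<^sup>2" for p h
  proof -
    have "norm ((f (p + h) - dir_deriv (p + h) f p) - (f p - dir_deriv p f p)) \<le> ((L1 + L2) * norm h) * norm (p + h - p)"
    proof (rule differentiable_bound[of "cball p (norm h)" "\<lambda>q. f q - dir_deriv q f p" "\<lambda>q v. dir_deriv v f q - dir_deriv v f p"])
      have bl: "bounded_linear (\<lambda>v. dir_deriv v f p)"
        using smooth_has_derivative[OF s] has_derivative_bounded_linear by blast
      show "((\<lambda>q. f q - dir_deriv q f p) has_derivative (\<lambda>v. dir_deriv v f x - dir_deriv v f p))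
          (at x within cball p (norm h))" for x
        by (intro has_derivative_diff has_derivative_at_withinI[OF smooth_has_derivative[OF s]]
            bounded_linear_imp_has_derivative bl)
      fix x assume "x \<in> cball p (norm h)"
      then have x: "norm (x - p) \<le> norm h" by (simp add: dist_norm norm_minus_commute)
      show "onorm (\<lambda>v. dir_deriv v f x - dir_deriv v f p) \<le> (L1 + L2) * norm h"
      proof (rule onorm_le)
        fix v :: plane
        have "norm (dir_deriv v f x - dir_deriv v f p)
            = norm (of_real (fst v) * (dir_deriv (1, 0) f x - dir_deriv (1, 0) f p)
              + of_real (snd v) * (dir_deriv (0, 1) f x - dir_deriv (0, 1) f p))"
          unfolding dir_deriv_split[OF s, of v] by (simp add: algebra_simps)
        also have "\<dots> \<le> \<bar>fst v\<bar> * norm (dir_deriv (1, 0) f x - dir_deriv (1, 0) f p)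
            + \<bar>snd v\<bar> * norm (dir_deriv (0, 1) f x - dir_deriv (0, 1) f p)"
          by (rule order_trans[OF norm_triangle_ineq]) (simp add: norm_mult)
        also have "\<dots> \<le> norm v * (L1 * norm (x - p)) + norm v * (L2 * norm (x - p))"
          using L1 L2 by (intro add_mono mult_mono norm_fst_snd_le) auto
        also have "\<dots> \<le> norm v * (L1 * norm h) + norm v * (L2 * norm h)"
          using L1 L2 x by (intro add_mono mult_left_mono) auto
        finally show "norm (dir_deriv v f x - dir_deriv v f p) \<le> (L1 + L2) * norm h * norm v"
          by (simp add: algebra_simps)
      qed
    qed (auto simp: dist_norm)
    moreover have "dir_deriv (p + h) f p = dir_deriv p f p + dir_deriv h f p"
      by (rule linear_add[OF has_derivative_linear[OF smooth_has_derivative[OF s]]])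
    ultimately show ?thesis by (simp add: power2_eq_square algebra_simps)
  qed
  then show thesis using that[of "L1 + L2"] L1(1) L2(1) by auto
qed

section \<open>Square integrable functions with compact support\<close>

lemma lborel_distr_isometry:
  "\<bar>c\<bar> = 1 \<Longrightarrow> distr lborel borel (\<lambda>x::plane. a + c *\<^sub>R x) = lborel"
  using lborel_affine[of c a] by (cases "c = 0") (simp_all add: density_1)

lemma nn_integral_isometry:
  fixes f :: "plane \<Rightarrow> ennreal"
  assumes "f \<in> borel_measurable borel" "\<bar>c\<bar> = 1"
  shows "(\<integral>\<^sup>+q. f (a + c *\<^sub>R q) \<partial>lborel) = (\<integral>\<^sup>+q. f q \<partial>lborel)"
proof -
  have "(\<integral>\<^sup>+q. f q \<partial>lborel) = (\<integral>\<^sup>+q. f q \<partial>(distr lborel borel (\<lambda>x. a + c *\<^sub>R x)))"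
    using assms(2) by (simp add: lborel_distr_isometry)
  also have "\<dots> = (\<integral>\<^sup>+q. f (a + c *\<^sub>R q) \<partial>lborel)"
    by (rule nn_integral_distr) (use assms in auto)
  finally show ?thesis by simp
qed

lemma integral_isometry:
  fixes f :: "plane \<Rightarrow> complex"
  assumes "f \<in> borel_measurable borel" "\<bar>c\<bar> = 1"
  shows "(\<integral>q. f (a + c *\<^sub>R q) \<partial>lborel) = (\<integral>q. f q \<partial>lborel)"
proof -
  have "(\<integral>q. f q \<partial>lborel) = (\<integral>q. f q \<partial>(distr lborel borel (\<lambda>x. a + c *\<^sub>R x)))"
    using assms(2) by (simp add: lborel_distr_isometry)
  also have "\<dots> = (\<integral>q. f (a + c *\<^sub>R q) \<partial>lborel)"
    by (rule integral_distr) (use assms in auto)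
  finally show ?thesis by simp
qed

lemma integrable_isometry:
  fixes f :: "plane \<Rightarrow> complex"
  assumes "integrable lborel f" "\<bar>c\<bar> = 1"
  shows "integrable lborel (\<lambda>q. f (a + c *\<^sub>R q))"
proof -
  have "integrable (distr lborel borel (\<lambda>x. a + c *\<^sub>R x)) f"
    using assms by (simp add: lborel_distr_isometry)
  then show ?thesis
    by (subst (asm) integrable_distr_eq) (use assms in auto)
qed

lemma AE_isometry:
  assumes "AE q::plane in lborel. P q" "\<bar>c\<bar> = 1"
  shows "AE q in lborel. P (a + c *\<^sub>R q)"
proof -
  have "AE q in distr lborel borel (\<lambda>x. a + c *\<^sub>R x). P q"
    using assms(1) unfolding lborel_distr_isometry[OF assms(2)] .
  then show ?thesis by (intro AE_distrD[of "\<lambda>x. a + c *\<^sub>R x" lborel borel P]) auto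
qed

lemmas nn_integral_shift = nn_integral_isometry[of _ 1, simplified]
lemmas integral_shift = integral_isometry[of _ 1, simplified]
lemmas integral_reflect = integral_isometry[of _ "-1", simplified]

definition L2sq :: "cfun \<Rightarrow> ennreal" where
  "L2sq u = (\<integral>\<^sup>+p. ennreal ((norm (u p))\<^sup>2) \<partial>lborel)"

definition L2_compact :: "cfun set" where
  "L2_compact = {u \<in> borel_measurable borel. L2sq u < \<infinity> \<and> (\<exists>R. \<forall>p. norm p > R \<longrightarrow> u p = 0)}"

lemma norm_add_sq_le: "(norm (a + b :: complex))\<^sup>2 \<le> 2 * (norm a)\<^sup>2 + 2 * (norm b)\<^sup>2"
proof -
  have "(norm (a + b))\<^sup>2 \<le> (norm a + norm b)\<^sup>2" by (intro power_mono norm_triangle_ineq) auto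
  also have "\<dots> \<le> 2 * (norm a)\<^sup>2 + 2 * (norm b)\<^sup>2"
    using sum_squares_bound[of "norm a" "norm b"] by (simp add: power2_sum)
  finally show ?thesis .
qed

lemma L2sq_add_le:
  assumes [measurable]: "u \<in> borel_measurable borel" "v \<in> borel_measurable borel"
  shows "L2sq (\<lambda>p. u p + v p) \<le> 2 * L2sq u + 2 * L2sq v"
proof -
  have "L2sq (\<lambda>p. u p + v p) \<le> (\<integral>\<^sup>+p. 2 * ennreal ((norm (u p))\<^sup>2) + 2 * ennreal ((norm (v p))\<^sup>2) \<partial>lborel)"
    unfolding L2sq_def
    by (intro nn_integral_mono)
      (simp add: norm_add_sq_le ennreal_mult[symmetric] ennreal_plus[symmetric] flip: ennreal_numeral del: ennreal_plus)
  also have "\<dots> = 2 * L2sq u + 2 * L2sq v"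
    unfolding L2sq_def by (subst nn_integral_add) (simp_all add: nn_integral_cmult)
  finally show ?thesis .
qed

lemma L2sq_shift:
  assumes [measurable]: "u \<in> borel_measurable borel"
  shows "L2sq (\<lambda>p. u (h + p)) = L2sq u"
  unfolding L2sq_def using nn_integral_shift[of "\<lambda>p. ennreal ((norm (u p))\<^sup>2)" h] by simp

lemma L2sq_uminus [simp]: "L2sq (\<lambda>p. - u p) = L2sq u"
  by (simp add: L2sq_def)

lemma L2sq_bounded_mult:
  assumes [measurable]: "u \<in> borel_measurable borel" and "\<And>p. norm (f p) \<le> B"
  shows "L2sq (\<lambda>p. f p * u p) \<le> ennreal (B\<^sup>2) * L2sq u"
proof -
  have "L2sq (\<lambda>p. f p * u p) \<le> (\<integral>\<^sup>+p. ennreal (B\<^sup>2) * ennreal ((norm (u p))\<^sup>2) \<partial>lborel)"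
    unfolding L2sq_def ennreal_mult[OF zero_le_power2 zero_le_power2, symmetric]
  proof (intro nn_integral_mono ennreal_leI)
    fix p
    have "(norm (f p))\<^sup>2 \<le> B\<^sup>2" by (intro power_mono assms) auto
    then show "(norm (f p * u p))\<^sup>2 \<le> B\<^sup>2 * (norm (u p))\<^sup>2"
      by (simp add: norm_mult power_mult_distrib mult_right_mono)
  qed
  also have "\<dots> = ennreal (B\<^sup>2) * L2sq u" unfolding L2sq_def by (simp add: nn_integral_cmult)
  finally show ?thesis .
qed

lemma L2_compact_measurable [measurable_dest]: "u \<in> L2_compact \<Longrightarrow> u \<in> borel_measurable borel"
  by (simp add: L2_compact_def)

lemma L2_compact_L2sq: "u \<in> L2_compact \<Longrightarrow> L2sq u < \<infinity>"
  by (simp add: L2_compact_def)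

lemma emeasure_cball_plane_finite: "emeasure lborel (cball (0::plane) R) < \<infinity>"
  by (rule emeasure_lborel_cball_finite)

lemma cball_plane_borel [measurable]: "cball (0::plane) R \<in> sets borel"
  by (intro borel_closed closed_cball)

text \<open>On a bounded set \<open>\<bar>u\<bar> \<le> 1 + \<bar>u\<bar>\<^sup>2\<close>.\<close>

lemma L2_compact_integrable:
  assumes u: "u \<in> L2_compact" shows "integrable lborel u"
proof -
  have [measurable]: "u \<in> borel_measurable borel" using u by measurable
  obtain R where R: "\<And>p. norm p > R \<Longrightarrow> u p = 0" using u by (auto simp: L2_compact_def)
  have "(\<integral>\<^sup>+p. ennreal (norm (u p)) \<partial>lborel) \<le>
      (\<integral>\<^sup>+p. indicator (cball 0 R) p + ennreal ((norm (u p))\<^sup>2) \<partial>lborel)"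
  proof (rule nn_integral_mono)
    fix p
    show "ennreal (norm (u p)) \<le> indicator (cball 0 R) p + ennreal ((norm (u p))\<^sup>2)"
    proof (cases "norm p > R")
      case True then show ?thesis using R by simp
    next
      case False
      have "2 * norm (u p) \<le> 1 + (norm (u p))\<^sup>2"
        using sum_squares_bound[of 1 "norm (u p)"] by simp
      then have "norm (u p) \<le> 1 + (norm (u p))\<^sup>2"
        using norm_ge_zero[of "u p"] by linarith
      then have "ennreal (norm (u p)) \<le> ennreal (1 + (norm (u p))\<^sup>2)" by (rule ennreal_leI)
      then show ?thesis using False by (simp add: indicator_def)
    qed
  qed
  also have "\<dots> = emeasure lborel (cball (0::plane) R) + L2sq u"
    unfolding L2sq_def by (subst nn_integral_add) simp_all
  also have "\<dots> < \<infinity>" using L2_compact_L2sq[OF u] emeasure_cball_plane_finite[of R]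
    by (simp add: ennreal_add_eq_top top.not_eq_extremum)
  finally show ?thesis by (intro integrableI_bounded) auto
qed

lemma L2_compact_add:
  assumes "u \<in> L2_compact" "v \<in> L2_compact" shows "(\<lambda>p. u p + v p) \<in> L2_compact"
proof -
  obtain R S where "\<And>p. norm p > R \<Longrightarrow> u p = 0" "\<And>p. norm p > S \<Longrightarrow> v p = 0"
    using assms by (auto simp: L2_compact_def)
  then have "\<forall>p. norm p > max R S \<longrightarrow> u p + v p = 0" by simp
  moreover have "L2sq (\<lambda>p. u p + v p) < \<infinity>"
    by (rule le_less_trans[OF L2sq_add_le])
      (use assms in \<open>auto simp: L2_compact_def ennreal_mult_eq_top_iff ennreal_add_eq_top top.not_eq_extremum[symmetric]\<close>)
  moreover have "(\<lambda>p. u p + v p) \<in> borel_measurable borel" using assms by measurable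
  ultimately show ?thesis unfolding L2_compact_def by blast
qed

lemma L2_compact_bounded_mult:
  assumes "u \<in> L2_compact" and [measurable]: "f \<in> borel_measurable borel" and "\<And>p. norm (f p) \<le> B"
  shows "(\<lambda>p. f p * u p) \<in> L2_compact"
proof -
  have [measurable]: "u \<in> borel_measurable borel" using assms(1) by measurable
  have "L2sq (\<lambda>p. f p * u p) < \<infinity>"
    by (rule le_less_trans[OF L2sq_bounded_mult[OF _ assms(3)]])
      (use L2_compact_L2sq[OF assms(1)] in \<open>auto simp: ennreal_mult_less_top\<close>)
  then show ?thesis using assms(1) unfolding L2_compact_def by auto
qed

lemma L2_compact_cmult: "u \<in> L2_compact \<Longrightarrow> (\<lambda>p. c * u p) \<in> L2_compact"
  by (rule L2_compact_bounded_mult[where B = "norm c"]) auto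

lemma L2_compact_uminus: "u \<in> L2_compact \<Longrightarrow> (\<lambda>p. - u p) \<in> L2_compact"
  using L2_compact_cmult[of u "-1"] by simp

lemma L2_compact_diff: "u \<in> L2_compact \<Longrightarrow> v \<in> L2_compact \<Longrightarrow> (\<lambda>p. u p - v p) \<in> L2_compact"
  using L2_compact_add[OF _ L2_compact_uminus, of u v] by simp

lemma L2_compact_shift:
  assumes "u \<in> L2_compact" shows "(\<lambda>p. u (h + p)) \<in> L2_compact"
proof -
  have [measurable]: "u \<in> borel_measurable borel" using assms by measurable
  obtain R where R: "\<And>p. norm p > R \<Longrightarrow> u p = 0" using assms by (auto simp: L2_compact_def)
  have "u (h + p) = 0" if "norm p > R + norm h" for p
    using that norm_triangle_ineq2[of p "-h"] by (intro R) (simp add: add.commute)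
  then have "\<exists>R. \<forall>p. R < norm p \<longrightarrow> u (h + p) = 0" by blast
  then show ?thesis using assms L2sq_shift[of u h] unfolding L2_compact_def by auto
qed

lemma test_fun_measurable: "test_fun f \<Longrightarrow> f \<in> borel_measurable borel"
  by (intro borel_measurable_continuous_onI smooth_continuous_on test_fun_smooth)

lemma test_fun_L2_compact:
  assumes "test_fun f" shows "f \<in> L2_compact"
proof -
  obtain R where R: "\<And>p. norm p > R \<Longrightarrow> f p = 0" using assms unfolding test_fun_iff by blast
  obtain B where B: "\<And>p. norm (f p) \<le> B" using assms test_fun_bounded by metis
  have "L2sq (indicator (cball 0 R)) = emeasure lborel (cball (0::plane) R)"
    unfolding L2sq_def
    by (subst nn_integral_indicator[symmetric], simp) (rule nn_integral_cong, simp add: indicator_def)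
  then have "indicator (cball 0 R) \<in> L2_compact"
    using emeasure_cball_plane_finite[of R] unfolding L2_compact_def
    by (intro CollectI conjI exI[of _ R]) auto
  from L2_compact_bounded_mult[OF this test_fun_measurable[OF assms] B]
  have "(\<lambda>p. f p * indicator (cball 0 R) p) \<in> L2_compact" .
  also have "(\<lambda>p. f p * indicator (cball 0 R) p) = f"
    using R by (auto simp: indicator_def fun_eq_iff)
  finally show ?thesis .
qed

lemma test_fun_integrable: "test_fun f \<Longrightarrow> integrable lborel f"
  by (intro L2_compact_integrable test_fun_L2_compact)

lemma integrable_mult_test_fun:
  assumes u: "integrable lborel u" and f: "test_fun f"
  shows "integrable lborel (\<lambda>q. u q * f (p - q))"
proof -
  obtain B where B: "\<And>p. norm (f p) \<le> B" using f test_fun_bounded by metis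
  have [measurable]: "f \<in> borel_measurable borel" using f by (rule test_fun_measurable)
  have [measurable]: "u \<in> borel_measurable borel" using u by auto
  show ?thesis
  proof (rule Bochner_Integration.integrable_bound[of _ "\<lambda>q. B * norm (u q)"])
    show "AE q in lborel. norm (u q * f (p - q)) \<le> norm (B * norm (u q))"
    proof (rule AE_I2)
      fix q
      have "B \<ge> 0" using order_trans[OF norm_ge_zero B] .
      then show "norm (u q * f (p - q)) \<le> norm (B * norm (u q))"
        using mult_left_mono[OF B[of "p - q"], of "norm (u q)"] by (simp add: norm_mult mult.commute)
    qed
  qed (use u in auto)
qed

section \<open>Convolution with test functions\<close>

definition conv :: "cfun \<Rightarrow> cfun \<Rightarrow> cfun" where
  "conv u f p = (\<integral>q. u q * f (p - q) \<partial>lborel)"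

lemma conv_flip:
  assumes [measurable]: "u \<in> borel_measurable borel" "f \<in> borel_measurable borel"
  shows "conv u f p = (\<integral>q. u (p - q) * f q \<partial>lborel)"
  unfolding conv_def using integral_reflect[of "\<lambda>q. u q * f (p - q)" p] by (simp add: algebra_simps)

lemma conv_measurable [measurable]:
  assumes [measurable]: "u \<in> borel_measurable borel" "f \<in> borel_measurable borel"
  shows "conv u f \<in> borel_measurable borel"
  unfolding conv_def[abs_def] by measurable

text \<open>The uniform Taylor estimate for \<open>f\<close> is integrated against \<open>\<bar>u\<bar>\<close>.\<close>

lemma conv_has_derivative:
  assumes u: "integrable lborel u" and f: "test_fun f"
  shows "(conv u f has_derivative (\<lambda>v. conv u (dir_deriv v f) p)) (at p)"
proof -
  have df: "test_fun (dir_deriv v f)" for v by (rule test_fun_dir_deriv[OF f])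
  note int = integrable_mult_test_fun[OF u f] integrable_mult_test_fun[OF u df]
  have split: "conv u (dir_deriv v f) p =
      of_real (fst v) * conv u (dir_deriv (1, 0) f) p + of_real (snd v) * conv u (dir_deriv (0, 1) f) p" for v
  proof -
    have "conv u (dir_deriv v f) p = (\<integral>q. of_real (fst v) * (u q * dir_deriv (1, 0) f (p - q))
        + of_real (snd v) * (u q * dir_deriv (0, 1) f (p - q)) \<partial>lborel)"
      unfolding conv_def dir_deriv_split[OF test_fun_smooth[OF f], of v] by (simp add: algebra_simps)
    also have "\<dots> = of_real (fst v) * conv u (dir_deriv (1, 0) f) p + of_real (snd v) * conv u (dir_deriv (0, 1) f) p"
      unfolding conv_def using int by (subst Bochner_Integration.integral_add) auto
    finally show ?thesis .
  qed
  obtain M where M: "M > 0" "\<And>p h. norm (f (p + h) - f p - dir_deriv h f p) \<le> M * (norm h)\<^sup>2"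
    using test_fun_taylor[OF f] by metis
  define N where "N = (\<integral>q. norm (u q) \<partial>lborel)"
  have N: "N \<ge> 0" unfolding N_def by simp
  have est: "norm (conv u f (p + h) - conv u f p - conv u (dir_deriv h f) p) \<le> M * N * (norm h)\<^sup>2" for h
  proof -
    have "conv u f (p + h) - conv u f p - conv u (dir_deriv h f) p =
        (\<integral>q. u q * f (p + h - q) - u q * f (p - q) - u q * dir_deriv h f (p - q) \<partial>lborel)"
      unfolding conv_def using int by simp
    also have "norm \<dots> \<le> (\<integral>q. norm (u q) * (M * (norm h)\<^sup>2) \<partial>lborel)"
    proof (rule Bochner_Integration.integral_norm_bound_integral)
      fix q
      have "u q * f (p + h - q) - u q * f (p - q) - u q * dir_deriv h f (p - q) =
          u q * (f ((p - q) + h) - f (p - q) - dir_deriv h f (p - q))" by (simp add: algebra_simps)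
      then show "norm (u q * f (p + h - q) - u q * f (p - q) - u q * dir_deriv h f (p - q)) \<le> norm (u q) * (M * (norm h)\<^sup>2)"
        using M(2)[of "p - q" h] by (simp add: norm_mult mult_left_mono)
    qed (use int u in auto)
    finally show ?thesis unfolding N_def by (simp add: mult_ac)
  qed
  show ?thesis
    unfolding has_derivative_at
  proof
    show "bounded_linear (\<lambda>v. conv u (dir_deriv v f) p)"
      by (subst split) (intro bounded_linear_add bounded_linear_mult_const bounded_linear_of_real
          bounded_linear_compose[OF bounded_linear_of_real] bounded_linear_fst bounded_linear_snd)
    show "(\<lambda>h. norm (conv u f (p + h) - conv u f p - conv u (dir_deriv h f) p) / norm h) \<midarrow>0\<rightarrow> 0"
    proof (rule tendsto_sandwich[of "\<lambda>_. 0" _ _ "\<lambda>h. M * N * norm h"])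
      show "\<forall>\<^sub>F h in at 0. norm (conv u f (p + h) - conv u f p - conv u (dir_deriv h f) p) / norm h \<le> M * N * norm h"
        unfolding eventually_at_filter
        by (rule eventuallyI) (use est in \<open>simp add: divide_le_eq power2_eq_square mult_ac\<close>)
    qed (auto intro!: tendsto_eq_intros)
  qed
qed

lemma conv_dir_deriv:
  assumes "integrable lborel u" "test_fun f"
  shows "dir_deriv v (conv u f) = conv u (dir_deriv v f)"
  by (rule ext, rule dir_deriv_eqI[OF conv_has_derivative[OF assms]])

lemma conv_smooth:
  assumes u: "integrable lborel u" and f: "test_fun f"
  shows "smooth (conv u f)"
proof (rule smooth_coinduct[of "\<lambda>g. \<exists>f. test_fun f \<and> g = conv u f"])
  show "g differentiable at p" if "\<exists>f. test_fun f \<and> g = conv u f" for g p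
    using that conv_has_derivative[OF u] differentiableI by blast
  show "\<exists>f. test_fun f \<and> dir_deriv v g = conv u f" if "\<exists>f. test_fun f \<and> g = conv u f" for g v
    using that conv_dir_deriv[OF u] test_fun_dir_deriv by blast
qed (use f in blast)

lemma conv_support:
  assumes "\<And>p. norm p > R \<Longrightarrow> u p = 0" "\<And>p. norm p > S \<Longrightarrow> f p = 0" "norm p > R + S"
  shows "conv u f p = 0"
proof -
  have "u q * f (p - q) = 0" for q
  proof (cases "norm q > R")
    case False
    then have "norm (p - q) > S" using norm_triangle_ineq[of "p - q" q] assms(3) by simp
    then show ?thesis using assms(2) by simp
  qed (use assms(1) in simp)
  then have "(\<lambda>q. u q * f (p - q)) = (\<lambda>q. 0)" by blast
  then show ?thesis unfolding conv_def by simp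
qed

lemma conv_test_fun:
  assumes "integrable lborel u" "\<And>p. norm p > R \<Longrightarrow> u p = 0" "test_fun f"
  shows "test_fun (conv u f)"
proof -
  obtain S where "\<And>p. norm p > S \<Longrightarrow> f p = 0" using assms(3) unfolding test_fun_iff by blast
  then have "\<forall>p. norm p > R + S \<longrightarrow> conv u f p = 0"
    using conv_support[of R u S f] assms(2) by blast
  then show ?thesis unfolding test_fun_iff using conv_smooth[OF assms(1,3)] by blast
qed

section \<open>Mollification\<close>

definition bump_mass :: "nat \<Rightarrow> real" where
  "bump_mass k = (\<integral>p. flat_exp 0 ((1 / Suc k)\<^sup>2 - p \<bullet> p) \<partial>(lborel :: plane measure))"

definition moll_re :: "nat \<Rightarrow> plane \<Rightarrow> real" where
  "moll_re k p = flat_exp 0 ((1 / Suc k)\<^sup>2 - p \<bullet> p) / bump_mass k"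

definition moll :: "nat \<Rightarrow> cfun" where
  "moll k p = of_real (moll_re k p)"

lemma bump_support: "\<epsilon> \<ge> 0 \<Longrightarrow> norm p > \<epsilon> \<Longrightarrow> bump \<epsilon> j p = 0"
  using power_strict_mono[of \<epsilon> "norm p" 2] by (simp add: bump_def flat_exp_def power2_norm_eq_inner)

lemma test_fun_bump: "\<epsilon> \<ge> 0 \<Longrightarrow> test_fun (bump \<epsilon> j)"
  unfolding test_fun_iff using smooth_bump bump_support by blast

lemma flat_exp_nonneg: "flat_exp k t \<ge> 0" by (simp add: flat_exp_def)

lemma bump_Re: "flat_exp j (\<epsilon>\<^sup>2 - p \<bullet> p) = Re (bump \<epsilon> j p)" by (simp add: bump_def)

text \<open>A bump of zero mass would vanish almost everywhere, although it is positive on an open ball.\<close>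

lemma bump_mass_pos: "bump_mass k > 0"
proof -
  let ?f = "\<lambda>p::plane. flat_exp 0 ((1 / Suc k)\<^sup>2 - p \<bullet> p)"
  have tf: "test_fun (bump (1 / Suc k) 0)" by (rule test_fun_bump) simp
  have int: "integrable lborel ?f"
    unfolding bump_Re by (intro integrable_Re test_fun_integrable tf)
  have c: "continuous_on UNIV ?f"
    unfolding bump_Re by (intro continuous_intros smooth_continuous_on test_fun_smooth tf)
  have "bump_mass k \<noteq> 0"
  proof
    assume "bump_mass k = 0"
    then have "AE p in lborel. ?f p = 0"
      unfolding bump_mass_def
      by (subst (asm) integral_nonneg_eq_0_iff_AE[OF int]) (auto simp: flat_exp_nonneg)
    then have "AE p in lborel. p \<notin> ball (0::plane) (1 / Suc k)"
    proof eventually_elim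
      case (elim p)
      show ?case
      proof
      assume "p \<in> ball 0 (1 / Suc k)"
      then have "norm p < 1 / Suc k" by simp
      then have "p \<bullet> p < (1 / Suc k)\<^sup>2"
        using power_strict_mono[of "norm p" "1 / Suc k" 2] by (simp add: power2_norm_eq_inner)
      then show False using elim by (simp add: flat_exp_def)
      qed
    qed
    then have "ball (0::plane) (1 / Suc k) \<in> null_sets lborel"
      by (subst AE_iff_null_sets) (auto intro: borel_open)
    then have "negligible (ball (0::plane) (1 / Suc k))"
      by (simp add: negligible_iff_null_sets null_sets_completionI)
    then show False
      using open_not_negligible[OF open_ball, of "0::plane" "1 / Suc k"] by auto
  qed
  moreover have "bump_mass k \<ge> 0" unfolding bump_mass_def by (simp add: flat_exp_nonneg)
  ultimately show ?thesis by simp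
qed

lemma moll_eq: "moll k = (\<lambda>p. bump (1 / Suc k) 0 p * of_real (1 / bump_mass k))"
  by (simp add: moll_def[abs_def] moll_re_def bump_def)

lemma moll_test_fun: "test_fun (moll k)"
  unfolding moll_eq by (intro test_fun_mult test_fun_bump smooth_const) simp

lemma moll_re_nonneg: "moll_re k p \<ge> 0"
  using bump_mass_pos[of k] by (simp add: moll_re_def flat_exp_nonneg)

lemma moll_re_support: "norm p > 1 / Suc k \<Longrightarrow> moll_re k p = 0"
  using bump_support[of "1 / Suc k" p 0] unfolding moll_re_def bump_def by simp

lemma moll_re_measurable [measurable]: "moll_re k \<in> borel_measurable borel"
proof -
  have "moll_re k = (\<lambda>p. Re (moll k p))" by (simp add: moll_def)
  then show ?thesis using test_fun_measurable[OF moll_test_fun, of k] by simp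
qed

lemma moll_measurable [measurable]: "moll k \<in> borel_measurable borel"
  by (rule test_fun_measurable[OF moll_test_fun])

lemma moll_re_integrable: "integrable lborel (moll_re k)"
  using integrable_Re[OF test_fun_integrable[OF moll_test_fun[of k]]] by (simp add: moll_def)

lemma moll_re_integral: "(\<integral>q. moll_re k q \<partial>lborel) = 1"
  unfolding moll_re_def using bump_mass_pos[of k] by (simp add: bump_mass_def)

lemma moll_mass: "(\<integral>\<^sup>+q. ennreal (moll_re k q) \<partial>lborel) = 1"
  by (subst nn_integral_eq_integral[OF moll_re_integrable]) (auto simp: moll_re_nonneg moll_re_integral)

lemma bump_dir_deriv:
  "dir_deriv v (bump \<epsilon> k) = (\<lambda>p. (-2) * of_real (p \<bullet> v) *
      (bump \<epsilon> (k + 2) p + (- of_nat k) * bump \<epsilon> (k + 1) p))"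
  by (rule ext) (rule dir_deriv_eqI[OF bump_deriv])

text \<open>The radial form of the mollifier makes its second derivatives visibly symmetric. Mixed partial
  derivatives of every mollification then commute as well, which the energy identity requires.\<close>

lemma moll_mixed: "dir_deriv v (dir_deriv w (moll k)) = dir_deriv w (dir_deriv v (moll k))"
proof -
  define c where "c = complex_of_real (1 / bump_mass k)"
  let ?b = "\<lambda>j. bump (1 / Suc k) j"
  have m: "moll k = (\<lambda>p. ?b 0 p * c)" by (simp add: moll_eq c_def)
  have 1: "dir_deriv w (moll k) = (\<lambda>p. c * (-2) * (of_real (p \<bullet> w) * ?b 2 p))" for w
    unfolding m
    by (rule ext, subst dir_deriv_mult) (auto simp: smooth_bump smooth_const bump_dir_deriv dir_deriv_eqI[OF has_derivative_const] numeral_2_eq_2)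
  have 2: "dir_deriv v (\<lambda>p. c * (-2) * (of_real (p \<bullet> w) * ?b 2 p)) p =
      c * (-2) * (of_real (p \<bullet> w) * ((-2) * of_real (p \<bullet> v) * (?b 4 p + (- 2) * ?b 3 p)) + of_real (v \<bullet> w) * ?b 2 p)" for v w p
  proof -
    have "((\<lambda>p. of_real (p \<bullet> w) :: complex) has_derivative (\<lambda>v. of_real (v \<bullet> w))) (at p)"
      by (auto intro!: derivative_eq_intros)
    from has_derivative_mult_right[OF has_derivative_mult[OF this bump_deriv[of "1 / Suc k" 2 p]], of "c * (-2)"]
    have "((\<lambda>p. c * (-2) * (of_real (p \<bullet> w) * ?b 2 p)) has_derivative (\<lambda>v. c * (-2) * (of_real (p \<bullet> w) * ((-2) * of_real (p \<bullet> v) * (?b 4 p + (- 2) * ?b 3 p)) + of_real (v \<bullet> w) * ?b 2 p))) (at p)"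
      by (simp add: numeral_eq_Suc)
    then show ?thesis by (rule dir_deriv_eqI)
  qed
  show ?thesis
    unfolding 1 by (rule ext, unfold 2) (simp add: inner_commute[of v w] algebra_simps)
qed

lemma conv_moll_integrable:
  assumes "integrable lborel u"
  shows "integrable lborel (\<lambda>q. u (p - q) * moll k q)"
  using integrable_isometry[OF integrable_mult_test_fun[OF assms moll_test_fun, where p = p and k1 = k], of "-1" p]
  by simp

text \<open>Jensen's inequality for the probability density \<open>moll_re k\<close>, obtained from Cauchy--Schwarz by
  splitting the density into two square roots.\<close>

lemma conv_moll_sq_le:
  assumes u: "integrable lborel u"
  shows "ennreal ((norm (conv u (moll k) p))\<^sup>2) \<le>
    (\<integral>\<^sup>+q. ennreal ((norm (u (p - q)))\<^sup>2) * ennreal (moll_re k q) \<partial>lborel)"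
proof -
  have [measurable]: "u \<in> borel_measurable borel" using u by auto
  let ?s = "\<lambda>q. ennreal (sqrt (moll_re k q))"
  have "ennreal (norm (conv u (moll k) p)) \<le> (\<integral>\<^sup>+q. ennreal (norm (u (p - q) * moll k q)) \<partial>lborel)"
    by (subst conv_flip) (auto intro!: integral_norm_bound_ennreal conv_moll_integrable u)
  also have "\<dots> = (\<integral>\<^sup>+q. (ennreal (norm (u (p - q))) * ?s q) * ?s q \<partial>lborel)"
    by (intro nn_integral_cong)
      (simp add: moll_def norm_mult moll_re_nonneg ennreal_mult[symmetric] mult.assoc)
  finally have "(ennreal (norm (conv u (moll k) p)))\<^sup>2 \<le> \<dots>\<^sup>2"
    by (intro power_mono) auto
  also have "\<dots> \<le> (\<integral>\<^sup>+q. (ennreal (norm (u (p - q))) * ?s q)\<^sup>2 \<partial>lborel) * (\<integral>\<^sup>+q. (?s q)\<^sup>2 \<partial>lborel)"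
    by (rule Cauchy_Schwarz_nn_integral) measurable
  also have "\<dots> = (\<integral>\<^sup>+q. ennreal ((norm (u (p - q)))\<^sup>2) * ennreal (moll_re k q) \<partial>lborel)"
    by (simp add: power_mult_distrib ennreal_power moll_re_nonneg moll_mass)
  finally show ?thesis by (simp add: ennreal_power)
qed

text \<open>Averaging does not increase the norm: integrate the pointwise bound, exchange the integrals
  and use that translations preserve the measure.\<close>

lemma L2sq_conv_moll_le:
  assumes u: "integrable lborel u" shows "L2sq (conv u (moll k)) \<le> L2sq u"
proof -
  have [measurable]: "u \<in> borel_measurable borel" using u by auto
  have "L2sq (conv u (moll k)) \<le>
      (\<integral>\<^sup>+p. \<integral>\<^sup>+q. ennreal ((norm (u (p - q)))\<^sup>2) * ennreal (moll_re k q) \<partial>lborel \<partial>lborel)"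
    unfolding L2sq_def by (intro nn_integral_mono conv_moll_sq_le u)
  also have "\<dots> = (\<integral>\<^sup>+q. \<integral>\<^sup>+p. ennreal ((norm (u (p - q)))\<^sup>2) * ennreal (moll_re k q) \<partial>lborel \<partial>lborel)"
    by (rule lborel_pair.Fubini') measurable
  also have "\<dots> = (\<integral>\<^sup>+q. L2sq u * ennreal (moll_re k q) \<partial>lborel)"
    using L2sq_shift[of u "- q" for q]
    by (intro nn_integral_cong) (simp add: nn_integral_multc L2sq_def)
  also have "\<dots> = L2sq u" by (simp add: nn_integral_cmult moll_mass)
  finally show ?thesis .
qed

section \<open>Mollifications converge almost everywhere\<close>

definition L1norm :: "cfun \<Rightarrow> ennreal" where
  "L1norm u = (\<integral>\<^sup>+p. ennreal (norm (u p)) \<partial>lborel)"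

lemma L1norm_add_le:
  assumes [measurable]: "u \<in> borel_measurable borel" "v \<in> borel_measurable borel"
  shows "L1norm (\<lambda>p. u p + v p) \<le> L1norm u + L1norm v"
proof -
  have "L1norm (\<lambda>p. u p + v p) \<le> (\<integral>\<^sup>+p. ennreal (norm (u p)) + ennreal (norm (v p)) \<partial>lborel)"
    unfolding L1norm_def
    by (intro nn_integral_mono) (simp add: norm_triangle_ineq ennreal_plus[symmetric] del: ennreal_plus)
  also have "\<dots> = L1norm u + L1norm v" unfolding L1norm_def by (subst nn_integral_add) simp_all
  finally show ?thesis .
qed

lemma L1norm_shift:
  assumes [measurable]: "u \<in> borel_measurable borel"
  shows "L1norm (\<lambda>p. u (h + p)) = L1norm u"
  unfolding L1norm_def using nn_integral_shift[of "\<lambda>p. ennreal (norm (u p))" h] by simp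

lemma L1norm_eq_integral: "integrable lborel u \<Longrightarrow> L1norm u = ennreal (\<integral>p. norm (u p) \<partial>lborel)"
  unfolding L1norm_def by (intro nn_integral_eq_integral) auto

definition cutoff :: "nat \<Rightarrow> plane \<Rightarrow> real" where
  "cutoff m p = max 0 (min 1 (real m + 1 - norm p))"

text \<open>The radial retraction onto the disc of radius \<open>m + 1\<close>, written without a case distinction so that
  its continuity is evident.\<close>

definition clamp_norm :: "nat \<Rightarrow> complex \<Rightarrow> complex" where
  "clamp_norm m z = z / of_real (max 1 (norm z / (real m + 1)))"

lemma clamp_norm_le: "norm (clamp_norm m z) \<le> norm z" "norm (clamp_norm m z) \<le> real m + 1"
proof -
  have 1: "max 1 (norm z / (real m + 1)) \<ge> 1" "max 1 (norm z / (real m + 1)) \<ge> norm z / (real m + 1)" by auto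
  have n: "norm (clamp_norm m z) = norm z / max 1 (norm z / (real m + 1))"
    unfolding clamp_norm_def by (simp add: norm_divide)
  show "norm (clamp_norm m z) \<le> norm z"
    unfolding n using 1 by (simp add: divide_le_eq mult_le_cancel_left1)
  show "norm (clamp_norm m z) \<le> real m + 1"
  proof -
    have "norm z / max 1 (norm z / (real m + 1)) \<le> real m + 1"
    proof -
      have "norm z \<le> max 1 (norm z / (real m + 1)) * (real m + 1)"
        using 1(2) by (subst (asm) pos_divide_le_eq) auto
      then show ?thesis using 1(1) by (subst pos_divide_le_eq) (auto simp: mult.commute)
    qed
    then show ?thesis by (simp add: n)
  qed
qed

lemma cutoff_bounds: "0 \<le> cutoff m p" "cutoff m p \<le> 1" by (auto simp: cutoff_def)

lemma cont_cutoff: "continuous_on A (cutoff m)"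
  unfolding cutoff_def[abs_def] by (intro continuous_intros)

lemma cont_clamp: "continuous_on A (clamp_norm m)"
  unfolding clamp_norm_def[abs_def] by (intro continuous_intros) (auto simp: max_def)

text \<open>A measurable function is an almost everywhere limit of continuous functions, on which nothing
  is known. Clamping the values and multiplying by a cutoff makes these limits dominated. The
  truncation is therefore fixed first, at the cost \<open>e / 2\<close>, and applied to \<open>u\<close> and to its approximants
  alike.\<close>

lemma L1_approx_continuous:
  assumes u: "integrable lborel u" and e: "e > 0"
  obtains g R where "continuous_on UNIV g" "\<And>p. norm p > R \<Longrightarrow> g p = 0"
    "L1norm (\<lambda>p. u p - g p) < ennreal e" "integrable lborel g"
proof -
  have [measurable]: "u \<in> borel_measurable borel" using u by auto
  have [measurable]: "cutoff m \<in> borel_measurable borel" "clamp_norm m \<in> borel_measurable borel" for m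
    by (auto intro!: borel_measurable_continuous_onI cont_cutoff cont_clamp)
  let ?T = "\<lambda>m (v::cfun) p. of_real (cutoff m p) * clamp_norm m (v p)"
  have T1: "norm (?T m v p) \<le> norm (v p)" for m v p
  proof -
    have "norm (?T m v p) = cutoff m p * norm (clamp_norm m (v p))"
      using cutoff_bounds[of m p] by (simp add: norm_mult)
    also have "\<dots> \<le> 1 * norm (v p)" by (intro mult_mono cutoff_bounds clamp_norm_le) auto
    finally show ?thesis by simp
  qed
  have "(\<lambda>m. \<integral>p. norm (u p - ?T m u p) \<partial>lborel) \<longlonglongrightarrow> (\<integral>p. 0 \<partial>(lborel::plane measure))"
  proof (rule integral_dominated_convergence[where w = "\<lambda>p. 2 * norm (u p)"])
    show "AE p in lborel. (\<lambda>m. norm (u p - ?T m u p)) \<longlonglongrightarrow> 0"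
    proof (rule AE_I2, rule Lim_transform_eventually[OF tendsto_const])
      fix p
      have "\<forall>\<^sub>F m in sequentially. real m \<ge> norm p + norm (u p)"
        using filterlim_real_sequentially by (simp add: filterlim_at_top)
      then show "\<forall>\<^sub>F m in sequentially. 0 = norm (u p - ?T m u p)"
      proof eventually_elim
        case (elim m)
        have "cutoff m p = 1" using elim norm_ge_zero[of "u p"] unfolding cutoff_def by linarith
        moreover have "norm (u p) / (real m + 1) \<le> 1" using elim norm_ge_zero[of p] by (simp add: divide_le_eq del: norm_ge_zero)
        then have "clamp_norm m (u p) = u p" unfolding clamp_norm_def by (simp add: max_def)
        ultimately show ?case by simp
      qed
    qed
    show "AE p in lborel. norm (norm (u p - ?T m u p)) \<le> 2 * norm (u p)" for m
    proof (rule AE_I2)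
      fix p
      show "norm (norm (u p - ?T m u p)) \<le> 2 * norm (u p)"
        using norm_triangle_ineq4[of "u p" "?T m u p"] T1[of m p u] by simp
    qed
  qed (use u in auto)
  then have "\<forall>\<^sub>F m in sequentially. (\<integral>p. norm (u p - ?T m u p) \<partial>lborel) < e / 2"
    using order_tendstoD(2)[of _ "0::real" sequentially "e / 2"] e by simp
  then obtain m where m: "(\<integral>p. norm (u p - ?T m u p) \<partial>lborel) < e / 2"
    by (meson eventually_sequentially order_refl)
  have "u measurable_on UNIV"
    by (intro lebesgue_measurable_imp_measurable_on measurable_completion) auto
  then obtain N g where N: "negligible N" and g: "\<And>n. continuous_on UNIV (g n)"
    and gl: "\<And>x. x \<notin> N \<Longrightarrow> (\<lambda>n. g n x) \<longlonglongrightarrow> u x"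
    unfolding measurable_on_def by auto
  have [measurable]: "g n \<in> borel_measurable borel" for n by (intro borel_measurable_continuous_onI g)
  have AEN: "AE p in lborel. p \<notin> N"
    using N by (metis AE_completion_iff AE_not_in negligible_iff_null_sets)
  have supp: "?T m v p = 0" if "norm p > real m + 1" for v p
    using that by (simp add: cutoff_def)
  have bd: "norm (?T m v p) \<le> (real m + 1) * indicator (cball 0 (real m + 1)) p" for v p
  proof (cases "norm p > real m + 1")
    case False
    have "norm (?T m v p) = cutoff m p * norm (clamp_norm m (v p))"
      using cutoff_bounds[of m p] by (simp add: norm_mult)
    also have "\<dots> \<le> 1 * (real m + 1)" by (intro mult_mono cutoff_bounds clamp_norm_le) auto
    finally show ?thesis using False by simp
  qed (simp add: supp)
  have int_ind: "integrable lborel (\<lambda>p::plane. (real m + 1) * indicator (cball 0 (real m + 1)) p :: real)"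
    using emeasure_cball_plane_finite[of "real m + 1"] by simp
  have intT: "integrable lborel (?T m v)" if [measurable]: "v \<in> borel_measurable borel" for v
    by (rule Bochner_Integration.integrable_bound[OF int_ind]) (use bd[where v = v] in auto)
  have "(\<lambda>n. \<integral>p. norm (?T m u p - ?T m (g n) p) \<partial>lborel) \<longlonglongrightarrow> (\<integral>p. 0 \<partial>(lborel::plane measure))"
  proof (rule integral_dominated_convergence[where w = "\<lambda>p. 2 * ((real m + 1) * indicator (cball 0 (real m + 1)) p)"])
    show "AE p in lborel. (\<lambda>n. norm (?T m u p - ?T m (g n) p)) \<longlonglongrightarrow> 0"
      using AEN
    proof eventually_elim
      case (elim p)
      have "(\<lambda>n. clamp_norm m (g n p)) \<longlonglongrightarrow> clamp_norm m (u p)"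
        by (rule continuous_on_tendsto_compose[OF cont_clamp[of UNIV] gl[OF elim]]) auto
      then have "(\<lambda>n. norm (?T m u p - ?T m (g n) p)) \<longlonglongrightarrow> norm (?T m u p - ?T m u p)"
        by (intro tendsto_intros)
      then show ?case by simp
    qed
    show "AE p in lborel. norm (norm (?T m u p - ?T m (g n) p)) \<le> 2 * ((real m + 1) * indicator (cball 0 (real m + 1)) p)" for n
    proof (rule AE_I2)
      fix p
      show "norm (norm (?T m u p - ?T m (g n) p)) \<le> 2 * ((real m + 1) * indicator (cball 0 (real m + 1)) p)"
        using norm_triangle_ineq4[of "?T m u p" "?T m (g n) p"] bd[of p u] bd[of p "g n"] by simp
    qed
  qed (use int_ind in auto)
  then have "\<forall>\<^sub>F n in sequentially. (\<integral>p. norm (?T m u p - ?T m (g n) p) \<partial>lborel) < e / 2"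
    using order_tendstoD(2)[of _ "0::real" sequentially "e / 2"] e by simp
  then obtain n where n: "(\<integral>p. norm (?T m u p - ?T m (g n) p) \<partial>lborel) < e / 2"
    by (meson eventually_sequentially order_refl)
  show thesis
  proof (rule that[of "?T m (g n)" "real m + 1"])
    show "continuous_on UNIV (?T m (g n))"
      by (intro continuous_intros cont_cutoff continuous_on_compose2[OF cont_clamp[of UNIV] g]) auto
    show "?T m (g n) p = 0" if "norm p > real m + 1" for p using supp that .
    show "integrable lborel (?T m (g n))" by (rule intT) simp
    have "L1norm (\<lambda>p. (u p - ?T m u p) + (?T m u p - ?T m (g n) p)) \<le>
        L1norm (\<lambda>p. u p - ?T m u p) + L1norm (\<lambda>p. ?T m u p - ?T m (g n) p)"
      by (rule L1norm_add_le) measurable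
    also have "\<dots> = ennreal ((\<integral>p. norm (u p - ?T m u p) \<partial>lborel) + (\<integral>p. norm (?T m u p - ?T m (g n) p) \<partial>lborel))"
      by (subst (1 2) L1norm_eq_integral) (auto intro!: Bochner_Integration.integrable_diff intT u simp: ennreal_plus)
    also have "\<dots> < ennreal e" using m n e by (intro ennreal_lessI) auto
    finally show "L1norm (\<lambda>p. u p - ?T m (g n) p) < ennreal e" by simp
  qed
qed

text \<open>Clear for continuous functions with compact support, by uniform continuity; the general case
  follows by approximation, since translations are isometries.\<close>

lemma L1_translation_continuous:
  assumes u: "integrable lborel u" and e: "e > 0"
  obtains d where "d > 0" "\<And>h. norm h < d \<Longrightarrow> L1norm (\<lambda>p. u (h + p) - u p) \<le> ennreal e"
proof -
  have [measurable]: "u \<in> borel_measurable borel" using u by auto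
  from L1_approx_continuous[OF u, of "e / 3"] e obtain g R where
    gc: "continuous_on UNIV g" and gs: "\<And>p. norm p > R \<Longrightarrow> g p = 0"
    and ug: "L1norm (\<lambda>p. u p - g p) < ennreal (e / 3)" and gi: "integrable lborel g"
    by (metis divide_pos_pos zero_less_numeral)
  have [measurable]: "g \<in> borel_measurable borel" using gi by auto
  define A where "A = measure lborel (cball (0::plane) (R + 1))"
  have A: "A \<ge> 0" "emeasure lborel (cball (0::plane) (R + 1)) = ennreal A"
    unfolding A_def using emeasure_cball_plane_finite[of "R + 1"] by (auto simp: emeasure_eq_ennreal_measure)
  define e' where "e' = e / (3 * (A + 1))"
  have e': "e' > 0" using e A by (simp add: e'_def)
  have "uniformly_continuous_on (cball 0 (R + 2)) g"
    by (intro compact_uniformly_continuous continuous_on_subset[OF gc]) auto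
  then obtain d where d: "d > 0" "\<And>x y. x \<in> cball 0 (R + 2) \<Longrightarrow> y \<in> cball 0 (R + 2) \<Longrightarrow> dist y x < d \<Longrightarrow> dist (g y) (g x) < e'"
    using e' unfolding uniformly_continuous_on_def by metis
  have tg: "L1norm (\<lambda>p. g (h + p) - g p) \<le> ennreal (e / 3)" if h: "norm h < min d 1" for h
  proof -
    have "norm (g (h + p) - g p) \<le> e' * indicator (cball 0 (R + 1)) p" for p
    proof (cases "norm p \<le> R + 1")
      case True
      have "norm (h + p) \<le> R + 2" using True h norm_triangle_ineq[of h p] by simp
      then have "dist (g (h + p)) (g p) < e'" using True h 
        by (intro d) (simp_all add: mem_cball_0 dist_norm[of "h + p" p])
      then show ?thesis using True by (simp add: dist_norm)
    next
      case False
      have "norm (h + p) > R" using False h norm_triangle_ineq2[of p "-h"] by (simp add: add.commute)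
      then show ?thesis using False gs by simp
    qed
    then have b: "ennreal (norm (g (h + p) - g p)) \<le> ennreal e' * indicator (cball 0 (R + 1)) p" for p
      by (cases "p \<in> cball 0 (R + 1)") (metis ennreal_leI indicator_simps(1) mult.right_neutral, metis ennreal_leI indicator_simps(2) mult_zero_right ennreal_0)
    have "L1norm (\<lambda>p. g (h + p) - g p) \<le> (\<integral>\<^sup>+p. ennreal e' * indicator (cball (0::plane) (R + 1)) p \<partial>lborel)"
      unfolding L1norm_def by (intro nn_integral_mono b)
    also have "\<dots> = ennreal (e' * A)" using A e' by (simp add: nn_integral_cmult_indicator ennreal_mult)
    also have "\<dots> \<le> ennreal (e / 3)" using A e by (intro ennreal_leI) (simp add: e'_def field_simps)
    finally show ?thesis .
  qed
  show thesis
  proof (rule that[of "min d 1"])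
    fix h :: plane assume h: "norm h < min d 1"
    have "L1norm (\<lambda>p. u (h + p) - u p) = L1norm (\<lambda>p. (u (h + p) - g (h + p)) + ((g (h + p) - g p) + - (u p - g p)))"
      by (simp add: algebra_simps)
    also have "\<dots> \<le> L1norm (\<lambda>p. u (h + p) - g (h + p)) + L1norm (\<lambda>p. (g (h + p) - g p) + - (u p - g p))"
      by (rule L1norm_add_le) measurable
    also have "\<dots> \<le> L1norm (\<lambda>p. u (h + p) - g (h + p)) + (L1norm (\<lambda>p. g (h + p) - g p) + L1norm (\<lambda>p. - (u p - g p)))"
      by (intro add_mono order_refl L1norm_add_le) measurable
    also have "L1norm (\<lambda>p. u (h + p) - g (h + p)) = L1norm (\<lambda>p. u p - g p)"
      using L1norm_shift[of "\<lambda>p. u p - g p" h] by simp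
    also have "L1norm (\<lambda>p. - (u p - g p)) = L1norm (\<lambda>p. u p - g p)" unfolding L1norm_def by (simp add: norm_minus_commute)
    also have "L1norm (\<lambda>p. u p - g p) + (L1norm (\<lambda>p. g (h + p) - g p) + L1norm (\<lambda>p. u p - g p)) \<le>
        ennreal (e / 3) + (ennreal (e / 3) + ennreal (e / 3))"
      using ug tg[OF h] by (intro add_mono) auto
    also have "\<dots> = ennreal e" using e by (simp add: ennreal_plus[symmetric] del: ennreal_plus)
    finally show "L1norm (\<lambda>p. u (h + p) - u p) \<le> ennreal e" .
  qed (use d in auto)
qed

text \<open>The difference \<open>conv u (moll k) - u\<close> is an average of differences of translates.\<close>

lemma conv_moll_L1_diff_le:
  assumes u: "integrable lborel u"
  shows "L1norm (\<lambda>p. conv u (moll k) p - u p) \<le> (\<integral>\<^sup>+q. L1norm (\<lambda>p. u (- q + p) - u p) * ennreal (moll_re k q) \<partial>lborel)"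
proof -
  have [measurable]: "u \<in> borel_measurable borel" using u by auto
  have i1: "(\<integral>q. moll k q \<partial>lborel) = 1"
    using moll_re_integral[of k] by (simp add: moll_def)
  have "ennreal (norm (conv u (moll k) p - u p)) \<le>
      (\<integral>\<^sup>+q. ennreal (norm (u (- q + p) - u p)) * ennreal (moll_re k q) \<partial>lborel)" for p
  proof -
    have int: "integrable lborel (\<lambda>q. u (p - q) * moll k q)" "integrable lborel (\<lambda>q. u p * moll k q)"
      by (auto intro: conv_moll_integrable u test_fun_integrable moll_test_fun)
    have "conv u (moll k) p - u p = (\<integral>q. u (p - q) * moll k q - u p * moll k q \<partial>lborel)"
      using int i1 by (simp add: conv_flip)
    also have "ennreal (norm \<dots>) \<le> (\<integral>\<^sup>+q. ennreal (norm (u (p - q) * moll k q - u p * moll k q)) \<partial>lborel)"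
      using int by (intro integral_norm_bound_ennreal) auto
    also have "\<dots> = (\<integral>\<^sup>+q. ennreal (norm (u (- q + p) - u p)) * ennreal (moll_re k q) \<partial>lborel)"
      by (intro nn_integral_cong)
        (simp add: left_diff_distrib[symmetric] norm_mult moll_def moll_re_nonneg ennreal_mult)
    finally show ?thesis .
  qed
  then have "L1norm (\<lambda>p. conv u (moll k) p - u p) \<le>
      (\<integral>\<^sup>+p. \<integral>\<^sup>+q. ennreal (norm (u (- q + p) - u p)) * ennreal (moll_re k q) \<partial>lborel \<partial>lborel)"
    unfolding L1norm_def by (intro nn_integral_mono)
  also have "\<dots> = (\<integral>\<^sup>+q. \<integral>\<^sup>+p. ennreal (norm (u (- q + p) - u p)) * ennreal (moll_re k q) \<partial>lborel \<partial>lborel)"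
    by (rule lborel_pair.Fubini') measurable
  also have "\<dots> = (\<integral>\<^sup>+q. L1norm (\<lambda>p. u (- q + p) - u p) * ennreal (moll_re k q) \<partial>lborel)"
    unfolding L1norm_def by (intro nn_integral_cong nn_integral_multc) measurable
  finally show ?thesis .
qed

text \<open>Convergence in the mean follows from the continuity of translations, because the averages run
  over translations by at most \<open>1 / Suc k\<close>. Almost everywhere convergence of a subsequence is all
  that the later limit passages by Fatou's lemma use.\<close>

lemma conv_moll_AE_subseq:
  assumes u: "integrable lborel u"
  obtains r :: "nat \<Rightarrow> nat" where "strict_mono r" "AE p in lborel. (\<lambda>n. conv u (moll (r n)) p) \<longlonglongrightarrow> u p"
proof -
  have [measurable]: "u \<in> borel_measurable borel" using u by auto
  let ?d = "\<lambda>k p. conv u (moll k) p - u p"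
  have mono: "L1norm (?d k) \<le> B" if "\<And>q. norm q \<le> 1 / Suc k \<Longrightarrow> L1norm (\<lambda>p. u (- q + p) - u p) \<le> B" for k B
  proof -
    have "L1norm (?d k) \<le> (\<integral>\<^sup>+q. B * ennreal (moll_re k q) \<partial>lborel)"
    proof (rule order_trans[OF conv_moll_L1_diff_le[OF u] nn_integral_mono])
      fix q
      show "L1norm (\<lambda>p. u (- q + p) - u p) * ennreal (moll_re k q) \<le> B * ennreal (moll_re k q)"
        using that[of q] moll_re_support[of k q]
        by (cases "norm q \<le> 1 / Suc k") (auto intro: mult_right_mono)
    qed
    also have "\<dots> = B" by (simp add: nn_integral_cmult moll_mass)
    finally show ?thesis .
  qed
  have int: "integrable lborel (?d k)" for k
  proof -
    have "L1norm (?d k) \<le> L1norm u + L1norm u"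
    proof (rule mono)
      fix q
      have "L1norm (\<lambda>p. u (- q + p) + - u p) \<le> L1norm (\<lambda>p. u (- q + p)) + L1norm (\<lambda>p. - u p)"
        by (rule L1norm_add_le) measurable
      then show "L1norm (\<lambda>p. u (- q + p) - u p) \<le> L1norm u + L1norm u"
        using L1norm_shift[of u "- q"] by (simp add: L1norm_def)
    qed
    also have "\<dots> < \<infinity>" by (simp add: L1norm_eq_integral u ennreal_plus[symmetric] del: ennreal_plus)
    finally show ?thesis unfolding L1norm_def by (intro integrableI_bounded) auto
  qed
  have "(\<lambda>k. \<integral>p. norm (?d k p) \<partial>lborel) \<longlonglongrightarrow> 0"
  proof (rule LIMSEQ_I)
    fix e :: real assume e: "0 < e"
    from L1_translation_continuous[OF u, of "e / 2"] e obtain d where d: "d > 0"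
      "\<And>h. norm h < d \<Longrightarrow> L1norm (\<lambda>p. u (h + p) - u p) \<le> ennreal (e / 2)" by auto
    obtain N where N: "1 / Suc N < d" using d(1) nat_approx_posE by blast
    have "norm (\<integral>p. norm (?d k p) \<partial>lborel) < e" if "k \<ge> N" for k
    proof -
      have "1 / Suc k \<le> 1 / Suc N" using that by (simp add: frac_le)
      then have "L1norm (?d k) \<le> ennreal (e / 2)" using N by (intro mono d) auto
      then show ?thesis using e by (simp add: L1norm_eq_integral int)
    qed
    then show "\<exists>no. \<forall>k\<ge>no. norm ((\<integral>p. norm (?d k p) \<partial>lborel) - 0) < e" by auto
  qed
  from tendsto_L1_AE_subseq[OF int this] obtain r :: "nat \<Rightarrow> nat" where
    r: "strict_mono r" and AE: "AE p in lborel. (\<lambda>n. ?d (r n) p) \<longlonglongrightarrow> 0" by auto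
  from AE have "AE p in lborel. (\<lambda>n. conv u (moll (r n)) p) \<longlonglongrightarrow> u p"
    by eventually_elim (simp add: LIM_zero_iff)
  with r show thesis by (rule that)
qed

section \<open>The energy identity\<close>

abbreviation Dx :: "cfun \<Rightarrow> cfun" where "Dx \<equiv> dir_deriv (1, 0)"
abbreviation Dy :: "cfun \<Rightarrow> cfun" where "Dy \<equiv> dir_deriv (0, 1)"

text \<open>Convolve \<open>f\<close> with the indicator of a ball containing its support with a margin: the result is
  constant near the origin, so its derivative there, which is the integral of \<open>dir_deriv v f\<close>,
  vanishes.\<close>

lemma integral_dir_deriv_test_fun:
  assumes f: "test_fun f" shows "(\<integral>q. dir_deriv v f q \<partial>lborel) = 0"
proof -
  obtain R where R: "R > 0" "\<And>p. norm p > R \<Longrightarrow> f p = 0" "\<And>p v. norm p > R \<Longrightarrow> dir_deriv v f p = 0"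
    using test_fun_support[OF f] by metis
  have fm [measurable]: "f \<in> borel_measurable borel" "dir_deriv v f \<in> borel_measurable borel"
    by (auto intro: test_fun_measurable test_fun_dir_deriv f)
  define u :: cfun where "u p = of_real (indicator (cball 0 (R + 1)) p)" for p
  have u: "integrable lborel u"
    unfolding u_def using emeasure_cball_plane_finite[of "R + 1"]
    by (intro integrable_of_real integrable_real_indicator) auto
  have *: "conv u g p = (\<integral>q. g q \<partial>lborel)"
    if "norm p < 1" and g: "\<And>q. norm q > R \<Longrightarrow> g q = 0" and [measurable]: "g \<in> borel_measurable borel" for g p
  proof -
    have "u q * g (p - q) = g (p - q)" for q
    proof (cases "norm q \<le> R + 1")
      case False
      then have "norm (p - q) > R" using that(1) norm_triangle_ineq2[of q p] by (simp add: norm_minus_commute)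
      then show ?thesis by (simp add: g)
    qed (simp add: u_def)
    then have "(\<lambda>q. u q * g (p - q)) = (\<lambda>q. g (p - q))" by blast
    then show ?thesis unfolding conv_def using integral_reflect[of g p] by simp
  qed
  have "(conv u f has_derivative (\<lambda>v. 0)) (at 0)"
    by (rule has_derivative_transform_within_open[OF has_derivative_const[of "\<integral>q. f q \<partial>lborel"], where s = "ball 0 1"])
      (auto simp: * R)
  from dir_deriv_eqI[OF this, of v] have "conv u (dir_deriv v f) 0 = 0"
    by (simp add: conv_dir_deriv u f)
  then show ?thesis by (subst (asm) *) (auto simp: R)
qed

lemma test_fun_sq_integrable:
  assumes "test_fun f" shows "integrable lborel (\<lambda>p. (norm (f p))\<^sup>2)"
proof -
  have "integrable lborel (\<lambda>p. Re (f p * cnj (f p)))"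
    by (intro integrable_Re test_fun_integrable test_fun_mult smooth_cnj test_fun_smooth assms)
  then show ?thesis by (simp add: complex_mult_cnj cmod_power2)
qed

lemma L2sq_test_fun: "test_fun f \<Longrightarrow> L2sq f = ennreal (\<integral>p. (norm (f p))\<^sup>2 \<partial>lborel)"
  unfolding L2sq_def by (intro nn_integral_eq_integral test_fun_sq_integrable) auto

text \<open>Expanding the squares on the right leaves the cross term
  \<open>2 Re (Dx a * cnj (Dy b) - Dy a * cnj (Dx b))\<close>. As the mixed derivatives of \<open>b\<close> agree, this is the
  real part of a divergence and integrates to zero. Hence divergence and curl of a compactly supported
  field control its whole gradient, with constant one.\<close>

lemma energy_identity:
  assumes a: "test_fun a" and b: "test_fun b" and mixed: "Dx (Dy b) = Dy (Dx b)"
  shows "L2sq (Dx a) + L2sq (Dy a) + L2sq (Dx b) + L2sq (Dy b) =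
    L2sq (\<lambda>p. Dx a p + Dy b p) + L2sq (\<lambda>p. Dx b p - Dy a p)"
proof -
  note t = test_fun_dir_deriv[OF a] test_fun_dir_deriv[OF b]
  have sb: "smooth (\<lambda>p. cnj (Dx b p))" "smooth (\<lambda>p. cnj (Dy b p))"
    by (intro smooth_cnj smooth_dir_deriv test_fun_smooth[OF b])+
  have t1: "test_fun (\<lambda>p. a p * cnj (Dx b p))" "test_fun (\<lambda>p. a p * cnj (Dy b p))"
    by (intro test_fun_mult a sb)+
  let ?F = "\<lambda>p. Dx a p * cnj (Dy b p) - Dy a p * cnj (Dx b p)"
  have F: "?F p = Dx (\<lambda>p. a p * cnj (Dy b p)) p - Dy (\<lambda>p. a p * cnj (Dx b p)) p" for p
    using mixed
    by (simp add: dir_deriv_mult test_fun_smooth a sb dir_deriv_cnj smooth_dir_deriv b fun_eq_iff)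
  have intF: "integrable lborel ?F" and F0: "(\<integral>p. ?F p \<partial>lborel) = 0"
    unfolding F using t1 by (simp_all add: integral_dir_deriv_test_fun test_fun_integrable test_fun_dir_deriv)
  have tm: "test_fun (\<lambda>p. Dx a p + Dy b p)" "test_fun (\<lambda>p. Dx b p - Dy a p)"
  proof -
    have "test_fun (\<lambda>p. Dy a p * (-1))" by (intro test_fun_mult t smooth_const)
    from test_fun_add[OF t(2) this] show "test_fun (\<lambda>p. Dx b p - Dy a p)" by simp
    show "test_fun (\<lambda>p. Dx a p + Dy b p)" by (intro test_fun_add t)
  qed
  \<comment> \<open>\<open>?F\<close> is a divergence, and its real part is the cross term.\<close>
  have pw: "(norm (Dx a p))\<^sup>2 + (norm (Dy a p))\<^sup>2 + (norm (Dx b p))\<^sup>2 + (norm (Dy b p))\<^sup>2 + 2 * Re (?F p) =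
      (norm (Dx a p + Dy b p))\<^sup>2 + (norm (Dx b p - Dy a p))\<^sup>2" for p
    unfolding cmod_power2 by (simp add: power2_eq_square algebra_simps)
  have "(\<integral>p. (norm (Dx a p))\<^sup>2 + (norm (Dy a p))\<^sup>2 + (norm (Dx b p))\<^sup>2 + (norm (Dy b p))\<^sup>2 + 2 * Re (?F p) \<partial>lborel) =
      (\<integral>p. (norm (Dx a p + Dy b p))\<^sup>2 + (norm (Dx b p - Dy a p))\<^sup>2 \<partial>lborel)"
    unfolding pw ..
  moreover have "(\<integral>p. 2 * Re (?F p) \<partial>lborel) = 0"
    unfolding integral_mult_right_zero integral_Re[OF intF] F0 by simp
  ultimately have "(\<integral>p. (norm (Dx a p))\<^sup>2 \<partial>lborel) + (\<integral>p. (norm (Dy a p))\<^sup>2 \<partial>lborel) + (\<integral>p. (norm (Dx b p))\<^sup>2 \<partial>lborel)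
       + (\<integral>p. (norm (Dy b p))\<^sup>2 \<partial>lborel) =
      (\<integral>p. (norm (Dx a p + Dy b p))\<^sup>2 \<partial>lborel) + (\<integral>p. (norm (Dx b p - Dy a p))\<^sup>2 \<partial>lborel)"
    using t[THEN test_fun_sq_integrable] tm[THEN test_fun_sq_integrable] integrable_Re[OF intF]
    by (simp del: minus_complex.sel times_complex.sel)
  then show ?thesis
    by (simp add: L2sq_test_fun t tm ennreal_plus[symmetric] integral_nonneg_AE del: ennreal_plus)
qed

section \<open>First-order systems in the weak sense\<close>

text \<open>The equation \<open>div (a, b) = D\<close> in the sense of distributions. It covers every first-order relation
  that occurs: \<open>weak_div b (- a) K\<close> says \<open>curl (a, b) = K\<close>, and a zero component leaves a single
  partial derivative.\<close>

definition weak_div :: "cfun \<Rightarrow> cfun \<Rightarrow> cfun \<Rightarrow> bool" where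
  "weak_div a b D \<longleftrightarrow> (\<forall>\<psi>. test_fun \<psi> \<longrightarrow>
     (\<integral>p. a p * Dx \<psi> p + b p * Dy \<psi> p \<partial>lborel) = - (\<integral>p. D p * \<psi> p \<partial>lborel))"

text \<open>The function \<open>q \<mapsto> f (p - q)\<close> is a legitimate test function, and reflecting it changes the sign of
  its derivatives.\<close>

lemma weak_div_conv:
  assumes w: "weak_div a b D" and a: "integrable lborel a" and b: "integrable lborel b" and f: "test_fun f"
  shows "Dx (conv a f) p + Dy (conv b f) p = conv D f p"
proof -
  have t: "test_fun (\<lambda>q. f (p - q))" using test_fun_affine[OF f, of "-1" p] by simp
  have d: "dir_deriv v (\<lambda>q. f (p - q)) q = - dir_deriv v f (p - q)" for v q
    using dir_deriv_affine[OF test_fun_smooth[OF f], of v p "-1" q] by simp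
  have int: "integrable lborel (\<lambda>q. a q * Dx f (p - q))" "integrable lborel (\<lambda>q. b q * Dy f (p - q))"
    by (intro integrable_mult_test_fun a b test_fun_dir_deriv f)+
  have "Dx (conv a f) p + Dy (conv b f) p = (\<integral>q. a q * Dx f (p - q) + b q * Dy f (p - q) \<partial>lborel)"
    using int by (simp add: conv_dir_deriv a b f conv_def)
  also have "\<dots> = - (\<integral>q. a q * Dx (\<lambda>q. f (p - q)) q + b q * Dy (\<lambda>q. f (p - q)) q \<partial>lborel)"
    unfolding d by (subst integral_minus[symmetric]) (simp add: algebra_simps)
  also have "\<dots> = conv D f p"
    using w t unfolding weak_div_def conv_def by simp
  finally show ?thesis .
qed

lemma conv_uminus: "conv (\<lambda>p. - a p) f = (\<lambda>p. - conv a f p)"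
  by (rule ext) (simp add: conv_def)

lemma conv_moll_test_fun: "u \<in> L2_compact \<Longrightarrow> test_fun (conv u (moll k))"
  by (rule L2_compact_def[THEN equalityD1, THEN subsetD, THEN CollectD, THEN conjunct2, THEN conjunct2, THEN exE])
    (auto intro: conv_test_fun L2_compact_integrable moll_test_fun)

text \<open>The energy identity for mollified fields, whose divergence and curl are the mollified data.
  The bound is uniform in \<open>k\<close>.\<close>

lemma energy_conv:
  assumes "a \<in> L2_compact" "b \<in> L2_compact" "D \<in> L2_compact" "K \<in> L2_compact"
    and wD: "weak_div a b D" and wK: "weak_div b (\<lambda>p. - a p) K"
  shows "L2sq (Dx (conv a (moll k))) + L2sq (Dy (conv a (moll k))) +
    L2sq (Dx (conv b (moll k))) + L2sq (Dy (conv b (moll k))) \<le> L2sq D + L2sq K"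
proof -
  note i = assms(1-4)[THEN L2_compact_integrable]
  note t = assms(1,2)[THEN conv_moll_test_fun, of k]
  have "Dx (Dy (conv b (moll k))) = Dy (Dx (conv b (moll k)))"
    by (simp add: conv_dir_deriv i moll_test_fun test_fun_dir_deriv moll_mixed)
  note energy_identity[OF t this]
  also have "(\<lambda>p. Dx (conv a (moll k)) p + Dy (conv b (moll k)) p) = conv D (moll k)"
    by (rule ext, rule weak_div_conv[OF wD i(1,2) moll_test_fun])
  also have "(\<lambda>p. Dx (conv b (moll k)) p - Dy (conv a (moll k)) p) = conv K (moll k)"
  proof
    fix p
    have "Dy (\<lambda>p. conv a (moll k) p * (-1)) p = - Dy (conv a (moll k)) p"
      by (subst dir_deriv_mult) (auto simp: test_fun_smooth t smooth_const dir_deriv_eqI[OF has_derivative_const])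
    with weak_div_conv[OF wK i(2) _ moll_test_fun, of k p] i(1)
    show "Dx (conv b (moll k)) p - Dy (conv a (moll k)) p = conv K (moll k) p"
      by (simp add: conv_uminus)
  qed
  also have "L2sq (conv D (moll k)) + L2sq (conv K (moll k)) \<le> L2sq D + L2sq K"
    by (intro add_mono L2sq_conv_moll_le i)
  finally show ?thesis .
qed

section \<open>Translations and strips\<close>

text \<open>The fundamental theorem of calculus and Cauchy--Schwarz on \<open>{0..s}\<close>.\<close>

lemma segment_sq_le:
  assumes f: "test_fun f" and s: "0 \<le> s" "s \<le> 1"
  shows "ennreal ((norm (f (p + s *\<^sub>R h) - f p))\<^sup>2) \<le>
    (\<integral>\<^sup>+t. indicator {0..1} t * ennreal ((norm (dir_deriv h f (p + t *\<^sub>R h)))\<^sup>2) \<partial>lborel)"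
proof -
  let ?g = "\<lambda>t. dir_deriv h f (p + t *\<^sub>R h)"
  have sm: "smooth (dir_deriv h f)" by (intro smooth_dir_deriv test_fun_smooth f)
  have gc: "continuous_on A ?g" for A
    by (intro continuous_on_compose2[OF smooth_continuous_on[OF sm, of UNIV]] continuous_intros) auto
  have [measurable]: "?g \<in> borel_measurable borel" by (intro borel_measurable_continuous_onI gc)
  have d: "((\<lambda>t. f (p + t *\<^sub>R h)) has_vector_derivative ?g t) (at t within A)" for t A
  proof -
    have "((\<lambda>t. p + t *\<^sub>R h) has_derivative (\<lambda>t. t *\<^sub>R h)) (at t within A)"
      by (auto intro!: derivative_eq_intros)
    from has_derivative_compose[OF this smooth_has_derivative[OF test_fun_smooth[OF f]]]
    have "((\<lambda>t. f (p + t *\<^sub>R h)) has_derivative (\<lambda>r. dir_deriv (r *\<^sub>R h) f (p + t *\<^sub>R h))) (at t within A)" .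
    moreover have "dir_deriv (r *\<^sub>R h) f q = r *\<^sub>R dir_deriv h f q" for r q
      by (rule linear_cmul[OF has_derivative_linear[OF smooth_has_derivative[OF test_fun_smooth[OF f]]]])
    ultimately show ?thesis by (simp add: has_vector_derivative_def)
  qed
  have *: "has_bochner_integral lborel (\<lambda>t. indicator {0..s} t *\<^sub>R ?g t) (f (p + s *\<^sub>R h) - f (p + 0 *\<^sub>R h))"
    by (rule has_bochner_integral_FTC_Icc[OF s(1) d gc])
  then have "ennreal (norm (f (p + s *\<^sub>R h) - f p)) \<le> (\<integral>\<^sup>+t. ennreal (norm (indicator {0..s} t *\<^sub>R ?g t)) \<partial>lborel)"
    using has_bochner_integral_norm_bound[OF *] by simp
  also have "\<dots> = (\<integral>\<^sup>+t. indicator {0..s} t * (indicator {0..s} t * ennreal (norm (?g t))) \<partial>lborel)"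
    by (intro nn_integral_cong) (auto split: split_indicator)
  finally have "(ennreal (norm (f (p + s *\<^sub>R h) - f p)))\<^sup>2 \<le> \<dots>\<^sup>2" by (intro power_mono) auto
  also have "\<dots> \<le> (\<integral>\<^sup>+t. (indicator {0..s} t)\<^sup>2 \<partial>(lborel::real measure)) * (\<integral>\<^sup>+t. (indicator {0..s} t * ennreal (norm (?g t)))\<^sup>2 \<partial>lborel)"
    by (rule Cauchy_Schwarz_nn_integral) measurable
  also have "(\<integral>\<^sup>+t. (indicator {0..s} t)\<^sup>2 \<partial>(lborel::real measure)) = (\<integral>\<^sup>+t. indicator {0..s} t \<partial>(lborel::real measure))"
    by (intro nn_integral_cong) (auto split: split_indicator)
  also have "\<dots> = ennreal s" using s by simp
  also have "ennreal s * (\<integral>\<^sup>+t. (indicator {0..s} t * ennreal (norm (?g t)))\<^sup>2 \<partial>lborel) \<le>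
      1 * (\<integral>\<^sup>+t. indicator {0..1} t * ennreal ((norm (?g t))\<^sup>2) \<partial>lborel)"
  proof (intro mult_mono nn_integral_mono)
    show "ennreal s \<le> 1" using s by simp
    fix t show "(indicator {0..s} t * ennreal (norm (?g t)))\<^sup>2 \<le> indicator {0..1} t * ennreal ((norm (?g t))\<^sup>2)"
      using s by (auto simp: ennreal_power split: split_indicator)
  qed auto
  finally show ?thesis by (simp add: ennreal_power)
qed

lemma L2sq_difference_test_fun:
  assumes f: "test_fun f"
  shows "L2sq (\<lambda>p. f (h + p) - f p) \<le> L2sq (dir_deriv h f)"
proof -
  have [measurable]: "dir_deriv h f \<in> borel_measurable borel"
    by (intro test_fun_measurable test_fun_dir_deriv f)
  have "L2sq (\<lambda>p. f (h + p) - f p) \<le>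
      (\<integral>\<^sup>+p. \<integral>\<^sup>+t. indicator {0..1} t * ennreal ((norm (dir_deriv h f (p + t *\<^sub>R h)))\<^sup>2) \<partial>lborel \<partial>lborel)"
    unfolding L2sq_def
    using segment_sq_le[OF f, of 1] by (intro nn_integral_mono) (simp add: add.commute)
  also have "\<dots> = (\<integral>\<^sup>+t. \<integral>\<^sup>+p. indicator {0..1} t * ennreal ((norm (dir_deriv h f (p + t *\<^sub>R h)))\<^sup>2) \<partial>lborel \<partial>lborel)"
    by (rule lborel_pair.Fubini') measurable
  also have "\<dots> = (\<integral>\<^sup>+t. indicator {0..1} t * L2sq (dir_deriv h f) \<partial>(lborel::real measure))"
    using L2sq_shift[of "dir_deriv h f" "t *\<^sub>R h" for t]
    by (intro nn_integral_cong) (simp add: nn_integral_cmult L2sq_def add.commute)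
  also have "\<dots> = L2sq (dir_deriv h f)" by (simp add: nn_integral_multc)
  finally show ?thesis .
qed

lemma L2sq_dir_deriv_le:
  assumes f: "test_fun f"
  shows "L2sq (dir_deriv h f) \<le> ennreal (2 * (norm h)\<^sup>2) * (L2sq (Dx f) + L2sq (Dy f))"
proof -
  have [measurable]: "Dx f \<in> borel_measurable borel" "Dy f \<in> borel_measurable borel"
    by (auto intro: test_fun_measurable test_fun_dir_deriv f)
  have "dir_deriv h f = (\<lambda>p. of_real (fst h) * Dx f p + of_real (snd h) * Dy f p)"
    by (rule ext) (rule dir_deriv_split[OF test_fun_smooth[OF f]])
  then have "L2sq (dir_deriv h f) \<le> 2 * L2sq (\<lambda>p. of_real (fst h) * Dx f p) + 2 * L2sq (\<lambda>p. of_real (snd h) * Dy f p)"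
    using L2sq_add_le[of "\<lambda>p. of_real (fst h) * Dx f p" "\<lambda>p. of_real (snd h) * Dy f p"] by simp
  also have "\<dots> \<le> 2 * (ennreal ((norm h)\<^sup>2) * L2sq (Dx f)) + 2 * (ennreal ((norm h)\<^sup>2) * L2sq (Dy f))"
    by (intro add_mono mult_left_mono L2sq_bounded_mult) (auto simp: norm_fst_snd_le)
  also have "\<dots> = ennreal (2 * (norm h)\<^sup>2) * (L2sq (Dx f) + L2sq (Dy f))"
    by (simp add: ennreal_mult algebra_simps)
  finally show ?thesis .
qed

text \<open>Near a line a function with square integrable gradient has mass proportional to the width.
  By the fundamental theorem of calculus \<open>\<bar>f p\<bar>\<^sup>2\<close> is bounded by twice an average of
  \<open>\<bar>f\<bar>\<^sup>2 + \<bar>dir_deriv e f\<bar>\<^sup>2\<close> over the unit segment that leaves \<open>p\<close> in the normal direction. After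
  exchanging the integrals, each point is counted only for those \<open>t\<close> for which it returns to the strip
  under translation by \<open>- t e\<close>, that is, on an interval of length \<open>2 d\<close>.\<close>

lemma strip_test_fun:
  assumes f: "test_fun f" and e: "norm e = 1" and d: "d \<ge> 0"
  shows "(\<integral>\<^sup>+p. indicator {p. \<bar>p \<bullet> e - c\<bar> \<le> d} p * ennreal ((norm (f p))\<^sup>2) \<partial>lborel) \<le>
    ennreal (4 * d) * (L2sq f + L2sq (dir_deriv e f))"
proof -
  let ?S = "{p::plane. \<bar>p \<bullet> e - c\<bar> \<le> d}"
  have Sb [measurable]: "?S \<in> sets borel" by (intro borel_closed closed_Collect_le continuous_intros)
  have [measurable]: "f \<in> borel_measurable borel" "dir_deriv e f \<in> borel_measurable borel"
    by (auto intro: test_fun_measurable test_fun_dir_deriv f)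
  define F where "F q = ennreal ((norm (f q))\<^sup>2) + ennreal ((norm (dir_deriv e f q))\<^sup>2)" for q
  have Fm [measurable]: "F \<in> borel_measurable borel" unfolding F_def by measurable
  have intF: "(\<integral>\<^sup>+q. F q \<partial>lborel) = L2sq f + L2sq (dir_deriv e f)"
    unfolding F_def L2sq_def by (subst nn_integral_add) auto
  have pw: "ennreal ((norm (f p))\<^sup>2) \<le> 2 * (\<integral>\<^sup>+t. indicator {0..1} t * F (p + t *\<^sub>R e) \<partial>lborel)" for p
  proof -
    define I where "I = (\<integral>\<^sup>+t. indicator {0..1} t * ennreal ((norm (dir_deriv e f (p + t *\<^sub>R e)))\<^sup>2) \<partial>lborel)"
    have 1: "ennreal ((norm (f p))\<^sup>2) \<le> 2 * ennreal ((norm (f (p + s *\<^sub>R e)))\<^sup>2) + 2 * I" if s: "s \<in> {0..1}" for s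
    proof -
      have "(norm (f p))\<^sup>2 \<le> 2 * (norm (f (p + s *\<^sub>R e)))\<^sup>2 + 2 * (norm (f (p + s *\<^sub>R e) - f p))\<^sup>2"
        using norm_add_sq_le[of "f (p + s *\<^sub>R e)" "f p - f (p + s *\<^sub>R e)"] by (simp add: norm_minus_commute)
      then have "ennreal ((norm (f p))\<^sup>2) \<le> ennreal (2 * (norm (f (p + s *\<^sub>R e)))\<^sup>2 + 2 * (norm (f (p + s *\<^sub>R e) - f p))\<^sup>2)"
        by (rule ennreal_leI)
      also have "\<dots> = 2 * ennreal ((norm (f (p + s *\<^sub>R e)))\<^sup>2) + 2 * ennreal ((norm (f (p + s *\<^sub>R e) - f p))\<^sup>2)"
        by (simp add: ennreal_mult)
      also have "\<dots> \<le> 2 * ennreal ((norm (f (p + s *\<^sub>R e)))\<^sup>2) + 2 * I"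
        unfolding I_def using s by (intro add_left_mono mult_left_mono segment_sq_le f) auto
      finally show ?thesis .
    qed
    have "ennreal ((norm (f p))\<^sup>2) = (\<integral>\<^sup>+s. indicator {0..1} s * ennreal ((norm (f p))\<^sup>2) \<partial>(lborel::real measure))"
      by (simp add: nn_integral_multc)
    also have "\<dots> \<le> (\<integral>\<^sup>+s. 2 * (indicator {0..1} s * ennreal ((norm (f (p + s *\<^sub>R e)))\<^sup>2)) + indicator {0..1} s * (2 * I) \<partial>lborel)"
      by (intro nn_integral_mono) (use 1 in \<open>auto split: split_indicator\<close>)
    also have "\<dots> = 2 * (\<integral>\<^sup>+s. indicator {0..1} s * ennreal ((norm (f (p + s *\<^sub>R e)))\<^sup>2) \<partial>lborel) + 2 * I"
      by (subst nn_integral_add) (auto simp: nn_integral_cmult nn_integral_multc)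
    also have "\<dots> = 2 * (\<integral>\<^sup>+t. indicator {0..1} t * F (p + t *\<^sub>R e) \<partial>lborel)"
    proof -
      have "(\<integral>\<^sup>+t. indicator {0..1} t * F (p + t *\<^sub>R e) \<partial>lborel) =
          (\<integral>\<^sup>+s. indicator {0..1} s * ennreal ((norm (f (p + s *\<^sub>R e)))\<^sup>2) \<partial>lborel) + I"
        unfolding I_def F_def distrib_left by (subst nn_integral_add) auto
      then show ?thesis by (simp add: distrib_left)
    qed
    finally show ?thesis .
  qed
  have "(\<integral>\<^sup>+p. indicator ?S p * ennreal ((norm (f p))\<^sup>2) \<partial>lborel) \<le>
      (\<integral>\<^sup>+p. indicator ?S p * (2 * (\<integral>\<^sup>+t. indicator {0..1} t * F (p + t *\<^sub>R e) \<partial>lborel)) \<partial>lborel)"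
    by (intro nn_integral_mono mult_left_mono pw) auto
  also have "\<dots> = (\<integral>\<^sup>+p. \<integral>\<^sup>+t. 2 * (indicator ?S p * (indicator {0..1} t * F (p + t *\<^sub>R e))) \<partial>lborel \<partial>lborel)"
    by (intro nn_integral_cong) (simp add: nn_integral_cmult[symmetric] mult_ac)
  also have "\<dots> = (\<integral>\<^sup>+t. \<integral>\<^sup>+p. 2 * (indicator ?S p * (indicator {0..1} t * F (p + t *\<^sub>R e))) \<partial>lborel \<partial>lborel)"
    by (rule lborel_pair.Fubini') measurable
  also have "\<dots> = (\<integral>\<^sup>+t. \<integral>\<^sup>+p. 2 * (indicator ?S (p - t *\<^sub>R e) * (indicator {0..1} t * F p)) \<partial>lborel \<partial>lborel)"
  proof (rule nn_integral_cong)
    fix t :: real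
    show "(\<integral>\<^sup>+p. 2 * (indicator ?S p * (indicator {0..1} t * F (p + t *\<^sub>R e))) \<partial>lborel) =
        (\<integral>\<^sup>+p. 2 * (indicator ?S (p - t *\<^sub>R e) * (indicator {0..1} t * F p)) \<partial>lborel)"
      using nn_integral_shift[of "\<lambda>p. 2 * (indicator ?S (p - t *\<^sub>R e) * (indicator {0..1} t * F p))" "t *\<^sub>R e"]
      by (simp add: add.commute)
  qed
  also have "\<dots> = (\<integral>\<^sup>+p. \<integral>\<^sup>+t. 2 * (indicator ?S (p - t *\<^sub>R e) * (indicator {0..1} t * F p)) \<partial>lborel \<partial>lborel)"
    by (rule lborel_pair.Fubini'[symmetric]) measurable
  also have "\<dots> \<le> (\<integral>\<^sup>+p. ennreal (4 * d) * F p \<partial>lborel)"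
  proof (rule nn_integral_mono)
    fix p
    have ee: "e \<bullet> e = 1" using e by (simp add: norm_eq_1)
    have "(\<integral>\<^sup>+t. 2 * (indicator ?S (p - t *\<^sub>R e) * (indicator {0..1} t * F p)) \<partial>lborel) \<le>
        (\<integral>\<^sup>+t. indicator {p \<bullet> e - c - d .. p \<bullet> e - c + d} t * (2 * F p) \<partial>lborel)"
    proof (rule nn_integral_mono)
      fix t :: real
      have "p - t *\<^sub>R e \<in> ?S \<longleftrightarrow> t \<in> {p \<bullet> e - c - d .. p \<bullet> e - c + d}"
        by (auto simp: inner_diff_left ee abs_le_iff)
      then show "2 * (indicator ?S (p - t *\<^sub>R e) * (indicator {0..1} t * F p)) \<le>
          indicator {p \<bullet> e - c - d .. p \<bullet> e - c + d} t * (2 * F p)"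
        by (auto split: split_indicator)
    qed
    also have "\<dots> = ennreal (2 * d) * (2 * F p)"
      using d by (simp add: nn_integral_multc)
    also have "\<dots> = ennreal (4 * d) * F p"
    proof -
      have "ennreal (4 * d) = ennreal (2 * d) * 2"
        using ennreal_mult[of "2 * d" 2] d by (simp add: mult.commute)
      then show ?thesis by (simp add: mult.assoc)
    qed
    finally show "(\<integral>\<^sup>+t. 2 * (indicator ?S (p - t *\<^sub>R e) * (indicator {0..1} t * F p)) \<partial>lborel) \<le> ennreal (4 * d) * F p" .
  qed
  also have "\<dots> = ennreal (4 * d) * (L2sq f + L2sq (dir_deriv e f))"
    by (simp add: nn_integral_cmult intF)
  finally show ?thesis .
qed

section \<open>Passage to the limit\<close>

lemma weighted_L2sq_Fatou:
  fixes v :: "nat \<Rightarrow> cfun" and w :: "plane \<Rightarrow> ennreal"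
  assumes [measurable]: "\<And>n. v n \<in> borel_measurable borel" "w \<in> borel_measurable borel"
    and AE: "AE p in lborel. (\<lambda>n. v n p) \<longlonglongrightarrow> u p"
    and w: "\<And>p. w p \<le> 1"
    and bound: "\<And>n. (\<integral>\<^sup>+p. w p * ennreal ((norm (v n p))\<^sup>2) \<partial>lborel) \<le> C"
  shows "(\<integral>\<^sup>+p. w p * ennreal ((norm (u p))\<^sup>2) \<partial>lborel) \<le> C"
proof -
  have "(\<integral>\<^sup>+p. w p * ennreal ((norm (u p))\<^sup>2) \<partial>lborel) =
      (\<integral>\<^sup>+p. liminf (\<lambda>n. w p * ennreal ((norm (v n p))\<^sup>2)) \<partial>lborel)"
  proof (rule nn_integral_cong_AE)
    show "AE p in lborel. w p * ennreal ((norm (u p))\<^sup>2) = liminf (\<lambda>n. w p * ennreal ((norm (v n p))\<^sup>2))"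
      using AE
    proof eventually_elim
      case (elim p)
      have "w p < \<infinity>" using w[of p] by (rule le_less_trans) simp
      then have "(\<lambda>n. w p * ennreal ((norm (v n p))\<^sup>2)) \<longlonglongrightarrow> w p * ennreal ((norm (u p))\<^sup>2)"
        using elim by (intro ennreal_tendsto_cmult tendsto_intros) simp_all
      then show ?case by (simp add: lim_imp_Liminf)
    qed
  qed
  also have "\<dots> \<le> liminf (\<lambda>n. \<integral>\<^sup>+p. w p * ennreal ((norm (v n p))\<^sup>2) \<partial>lborel)"
    by (rule nn_integral_liminf) measurable
  also have "\<dots> \<le> liminf (\<lambda>n. C)" by (intro Liminf_mono always_eventually allI bound)
  also have "\<dots> = C" by (simp add: Liminf_const)
  finally show ?thesis .
qed

lemma L2sq_difference_Fatou:
  assumes u: "integrable lborel u"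
    and bound: "\<And>k. L2sq (\<lambda>p. conv u (moll k) (h + p) - conv u (moll k) p) \<le> C"
  shows "L2sq (\<lambda>p. u (h + p) - u p) \<le> C"
proof -
  have [measurable]: "u \<in> borel_measurable borel" using u by auto
  obtain r :: "nat \<Rightarrow> nat" where r: "strict_mono r" "AE p in lborel. (\<lambda>n. conv u (moll (r n)) p) \<longlonglongrightarrow> u p"
    using conv_moll_AE_subseq[OF u] by blast
  have "AE p in lborel. (\<lambda>n. conv u (moll (r n)) (h + p)) \<longlonglongrightarrow> u (h + p)"
    using AE_isometry[OF r(2), of 1 h] by simp
  with r(2) have AE: "AE p in lborel. (\<lambda>n. conv u (moll (r n)) (h + p) - conv u (moll (r n)) p) \<longlonglongrightarrow> u (h + p) - u p"
    by eventually_elim (intro tendsto_diff)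
  show ?thesis
    using weighted_L2sq_Fatou[OF _ _ AE, of "\<lambda>_. 1" C] bound unfolding L2sq_def by simp
qed

text \<open>Membership in \<open>H\<^sup>1\<close> for compactly supported functions, expressed by a bound on the gradients of the
  mollifications. In this form translation and strip estimates pass to the limit by Fatou's lemma,
  without any appeal to weak compactness or completeness.\<close>

definition bounded_energy :: "cfun \<Rightarrow> bool" where
  "bounded_energy u \<longleftrightarrow> u \<in> L2_compact \<and>
     (\<exists>C<\<infinity>. \<forall>k. L2sq (Dx (conv u (moll k))) + L2sq (Dy (conv u (moll k))) \<le> C)"

lemma bounded_energy_difference:
  assumes "bounded_energy u"
  obtains C where "C \<ge> 0" "\<And>h. L2sq (\<lambda>p. u (h + p) - u p) \<le> ennreal (C * (norm h)\<^sup>2)"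
proof -
  obtain C where C: "C < \<infinity>" "\<And>k. L2sq (Dx (conv u (moll k))) + L2sq (Dy (conv u (moll k))) \<le> C"
    and u: "u \<in> L2_compact" using assms unfolding bounded_energy_def by blast
  have "L2sq (\<lambda>p. u (h + p) - u p) \<le> ennreal (2 * enn2real C * (norm h)\<^sup>2)" for h
  proof (rule L2sq_difference_Fatou[OF L2_compact_integrable[OF u]])
    fix k
    note t = conv_moll_test_fun[OF u, of k]
    have "L2sq (\<lambda>p. conv u (moll k) (h + p) - conv u (moll k) p) \<le> L2sq (dir_deriv h (conv u (moll k)))"
      by (rule L2sq_difference_test_fun[OF t])
    also have "\<dots> \<le> ennreal (2 * (norm h)\<^sup>2) * (L2sq (Dx (conv u (moll k))) + L2sq (Dy (conv u (moll k))))"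
      by (rule L2sq_dir_deriv_le[OF t])
    also have "\<dots> \<le> ennreal (2 * (norm h)\<^sup>2) * C" by (intro mult_left_mono C) auto
    also have "\<dots> = ennreal (2 * (norm h)\<^sup>2) * ennreal (enn2real C)" using C(1) by simp
    also have "\<dots> = ennreal (2 * enn2real C * (norm h)\<^sup>2)" by (simp add: ennreal_mult[symmetric] mult_ac)
    finally show "L2sq (\<lambda>p. conv u (moll k) (h + p) - conv u (moll k) p) \<le> ennreal (2 * enn2real C * (norm h)\<^sup>2)" .
  qed
  then show thesis by (intro that[of "2 * enn2real C"]) auto
qed

lemma bounded_energy_strip:
  assumes "bounded_energy u"
  obtains C where "C \<ge> 0" "\<And>e c d. norm e = 1 \<Longrightarrow> d \<ge> 0 \<Longrightarrow>
    (\<integral>\<^sup>+p. indicator {p. \<bar>p \<bullet> e - c\<bar> \<le> d} p * ennreal ((norm (u p))\<^sup>2) \<partial>lborel) \<le> ennreal (C * d)"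
proof -
  obtain C where C: "C < \<infinity>" "\<And>k. L2sq (Dx (conv u (moll k))) + L2sq (Dy (conv u (moll k))) \<le> C"
    and u: "u \<in> L2_compact" using assms unfolding bounded_energy_def by blast
  note ui = L2_compact_integrable[OF u]
  have [measurable]: "u \<in> borel_measurable borel" using u by measurable
  define B where "B = L2sq u + 2 * C"
  have B: "B < \<infinity>" unfolding B_def using C L2_compact_L2sq[OF u]
    by (simp add: ennreal_mult_eq_top_iff ennreal_add_eq_top top.not_eq_extremum[symmetric])
  obtain r :: "nat \<Rightarrow> nat" where r: "strict_mono r" "AE p in lborel. (\<lambda>n. conv u (moll (r n)) p) \<longlonglongrightarrow> u p"
    using conv_moll_AE_subseq[OF ui] by blast
  have "(\<integral>\<^sup>+p. indicator {p. \<bar>p \<bullet> e - c\<bar> \<le> d} p * ennreal ((norm (u p))\<^sup>2) \<partial>lborel) \<le> ennreal (4 * enn2real B * d)"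
    if e: "norm e = 1" and d: "d \<ge> 0" for e :: plane and c d :: real
  proof (rule weighted_L2sq_Fatou[OF _ _ r(2)])
    have "{p::plane. \<bar>p \<bullet> e - c\<bar> \<le> d} \<in> sets borel" by (intro borel_closed closed_Collect_le continuous_intros)
    then show "indicator {p::plane. \<bar>p \<bullet> e - c\<bar> \<le> d} \<in> borel_measurable borel" by measurable
    fix n
    note t = conv_moll_test_fun[OF u, of "r n"]
    have "(\<integral>\<^sup>+p. indicator {p. \<bar>p \<bullet> e - c\<bar> \<le> d} p * ennreal ((norm (conv u (moll (r n)) p))\<^sup>2) \<partial>lborel) \<le>
      ennreal (4 * d) * (L2sq (conv u (moll (r n))) + L2sq (dir_deriv e (conv u (moll (r n)))))"
      by (rule strip_test_fun[OF t e d])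
    also have "L2sq (dir_deriv e (conv u (moll (r n)))) \<le> ennreal 2 * C"
    proof (rule order_trans[OF L2sq_dir_deriv_le[OF t]])
      show "ennreal (2 * (norm e)\<^sup>2) * (L2sq (Dx (conv u (moll (r n)))) + L2sq (Dy (conv u (moll (r n))))) \<le> ennreal 2 * C"
        using mult_left_mono[OF C(2)[of "r n"], of "ennreal 2"] e by (simp del: ennreal_numeral)
    qed
    also have "L2sq (conv u (moll (r n))) \<le> L2sq u" by (rule L2sq_conv_moll_le[OF ui])
    also have "ennreal (4 * d) * (L2sq u + ennreal 2 * C) = ennreal (4 * d) * ennreal (enn2real B)"
      using B by (simp add: B_def)
    also have "\<dots> = ennreal (4 * enn2real B * d)" using d by (simp add: ennreal_mult[symmetric] mult_ac)
    finally show "(\<integral>\<^sup>+p. indicator {p. \<bar>p \<bullet> e - c\<bar> \<le> d} p * ennreal ((norm (conv u (moll (r n)) p))\<^sup>2) \<partial>lborel) \<le> ennreal (4 * enn2real B * d)"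
      by (simp add: add_left_mono mult_left_mono)
  qed (auto split: split_indicator)
  then show thesis by (intro that[of "4 * enn2real B"]) auto
qed

section \<open>Translation estimates for gradients\<close>

lemma weak_div_shift_diff:
  assumes w: "weak_div a b D" and L: "a \<in> L2_compact" "b \<in> L2_compact" "D \<in> L2_compact"
  shows "weak_div (\<lambda>p. a (h + p) - a p) (\<lambda>p. b (h + p) - b p) (\<lambda>p. D (h + p) - D p)"
  unfolding weak_div_def
proof (intro allI impI)
  fix \<psi> assume t: "test_fun \<psi>"
  have m [measurable]: "a \<in> borel_measurable borel" "b \<in> borel_measurable borel" "D \<in> borel_measurable borel"
    using L by measurable
  note i = L[THEN L2_compact_integrable]
  let ?\<psi> = "\<lambda>q. \<psi> (q - h)"
  have t': "test_fun ?\<psi>" using test_fun_affine[OF t, of 1 "-h"] by simp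
  have d: "dir_deriv v ?\<psi> q = dir_deriv v \<psi> (q - h)" for v q
    using dir_deriv_affine[OF test_fun_smooth[OF t], of v "-h" 1 q] by simp
  have int: "integrable lborel (\<lambda>q. u (h + q) * f q)" "integrable lborel (\<lambda>q. u q * f q)"
    if u: "integrable lborel u" and f: "test_fun f" for u f :: cfun
  proof -
    have r: "test_fun (\<lambda>q. f (- q))" using test_fun_affine[OF f, of "-1" 0] by simp
    have "integrable lborel (\<lambda>q. u (h + q))" using integrable_isometry[OF u, of 1 h] by simp
    from integrable_mult_test_fun[OF this r, of 0] integrable_mult_test_fun[OF u r, of 0]
    show "integrable lborel (\<lambda>q. u (h + q) * f q)" "integrable lborel (\<lambda>q. u q * f q)" by simp_all
  qed
  note [measurable] = test_fun_measurable[OF t] test_fun_measurable[OF test_fun_dir_deriv[OF t]]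
  have "(\<integral>p. a (h + p) * Dx \<psi> p + b (h + p) * Dy \<psi> p \<partial>lborel) = (\<integral>p. a p * Dx ?\<psi> p + b p * Dy ?\<psi> p \<partial>lborel)"
    using integral_shift[of "\<lambda>p. a p * Dx ?\<psi> p + b p * Dy ?\<psi> p" h] unfolding d by simp
  also have "\<dots> = - (\<integral>p. D p * ?\<psi> p \<partial>lborel)" using w t' unfolding weak_div_def by simp
  also have "\<dots> = - (\<integral>p. D (h + p) * \<psi> p \<partial>lborel)"
    using integral_shift[of "\<lambda>p. D p * ?\<psi> p" h] by simp
  finally have 1: "(\<integral>p. a (h + p) * Dx \<psi> p + b (h + p) * Dy \<psi> p \<partial>lborel) = - (\<integral>p. D (h + p) * \<psi> p \<partial>lborel)" .
  have 2: "(\<integral>p. a p * Dx \<psi> p + b p * Dy \<psi> p \<partial>lborel) = - (\<integral>p. D p * \<psi> p \<partial>lborel)"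
    using w t unfolding weak_div_def by simp
  note ii = int[OF i(1) test_fun_dir_deriv[OF t]] int[OF i(2) test_fun_dir_deriv[OF t]] int[OF i(3) t]
  have "(\<integral>p. (a (h + p) - a p) * Dx \<psi> p + (b (h + p) - b p) * Dy \<psi> p \<partial>lborel) =
      (\<integral>p. a (h + p) * Dx \<psi> p + b (h + p) * Dy \<psi> p \<partial>lborel) - (\<integral>p. a p * Dx \<psi> p + b p * Dy \<psi> p \<partial>lborel)"
    using ii by (subst Bochner_Integration.integral_diff[symmetric]) (auto simp: algebra_simps)
  also have "\<dots> = - (\<integral>p. (D (h + p) - D p) * \<psi> p \<partial>lborel)"
    unfolding 1 2 using ii by (simp add: left_diff_distrib)
  finally show "(\<integral>p. (a (h + p) - a p) * Dx \<psi> p + (b (h + p) - b p) * Dy \<psi> p \<partial>lborel) =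
      - (\<integral>p. (D (h + p) - D p) * \<psi> p \<partial>lborel)" .
qed

lemma conv_shift_diff:
  assumes "integrable lborel u" "test_fun f"
  shows "conv (\<lambda>p. u (h + p) - u p) f = (\<lambda>p. conv u f (h + p) - conv u f p)"
proof
  fix p
  have [measurable]: "u \<in> borel_measurable borel" "f \<in> borel_measurable borel"
    using assms test_fun_measurable by auto
  have i: "integrable lborel (\<lambda>q. u (h + q))" using integrable_isometry[OF assms(1), of 1 h] by simp
  have "conv u f (h + p) = conv (\<lambda>p. u (h + p)) f p"
    unfolding conv_def using integral_shift[of "\<lambda>q. u q * f (h + p - q)" h] by simp
  then show "conv (\<lambda>p. u (h + p) - u p) f p = conv u f (h + p) - conv u f p"
    unfolding conv_def
    using integrable_mult_test_fun[OF assms] integrable_mult_test_fun[OF i assms(2)]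
    by (simp add: left_diff_distrib)
qed

text \<open>The system has constant coefficients, so differences of translates solve it with the
  differences of the data; the energy estimate applied to them bounds the translation differences of
  the gradient. This transfers regularity of fractional order from divergence and curl to the
  gradient.\<close>

lemma gradient_difference:
  assumes L: "a \<in> L2_compact" "b \<in> L2_compact" "D \<in> L2_compact" "K \<in> L2_compact"
    and w: "weak_div a b D" "weak_div b (\<lambda>p. - a p) K"
    and g: "g \<in> L2_compact"
      "weak_div a (\<lambda>_. 0) g \<or> weak_div (\<lambda>_. 0) a g \<or> weak_div b (\<lambda>_. 0) g \<or> weak_div (\<lambda>_. 0) b g"
  shows "L2sq (\<lambda>p. g (h + p) - g p) \<le> L2sq (\<lambda>p. D (h + p) - D p) + L2sq (\<lambda>p. K (h + p) - K p)"
proof (rule L2sq_difference_Fatou)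
  note i = L[THEN L2_compact_integrable]
  show gi: "integrable lborel g" by (rule L2_compact_integrable[OF g(1)])
  fix k
  let ?d = "\<lambda>u p. u (h + p) - u p :: complex"
  have d0: "(\<lambda>p. conv (\<lambda>_. 0) f p) = (\<lambda>p. 0)" for f by (simp add: conv_def[abs_def])
  have dd0: "dir_deriv v (\<lambda>_. 0) p = 0" for v p by (rule dir_deriv_eqI[OF has_derivative_const])
  have conv_g: "conv (?d g) (moll k) \<in> {Dx (conv (?d a) (moll k)), Dy (conv (?d a) (moll k)),
     Dx (conv (?d b) (moll k)), Dy (conv (?d b) (moll k))}"
  proof -
    have z: "(\<lambda>_. 0) \<in> L2_compact" by (simp add: L2_compact_def L2sq_def)
    have x: "conv (?d g) (moll k) = Dx (conv (?d u) (moll k))" if "weak_div u (\<lambda>_. 0) g" "u \<in> L2_compact" for u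
    proof
      fix p
      show "conv (?d g) (moll k) p = Dx (conv (?d u) (moll k)) p"
        using weak_div_conv[OF weak_div_shift_diff[OF that(1,2) z g(1), of h] _ _ moll_test_fun, of k p]
          L2_compact_integrable[OF L2_compact_diff[OF L2_compact_shift[OF that(2)] that(2)], of h]
        by (simp add: d0 dd0)
    qed
    have y: "conv (?d g) (moll k) = Dy (conv (?d u) (moll k))" if "weak_div (\<lambda>_. 0) u g" "u \<in> L2_compact" for u
    proof
      fix p
      show "conv (?d g) (moll k) p = Dy (conv (?d u) (moll k)) p"
        using weak_div_conv[OF weak_div_shift_diff[OF that(1) z that(2) g(1), of h] _ _ moll_test_fun, of k p]
          L2_compact_integrable[OF L2_compact_diff[OF L2_compact_shift[OF that(2)] that(2)], of h]
        by (simp add: d0 dd0)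
    qed
    show ?thesis using g(2) x y L(1,2) by blast
  qed
  have "L2sq (\<lambda>p. conv g (moll k) (h + p) - conv g (moll k) p) = L2sq (conv (?d g) (moll k))"
    by (simp add: conv_shift_diff gi moll_test_fun)
  also have "\<dots> \<le> L2sq (Dx (conv (?d a) (moll k))) + L2sq (Dy (conv (?d a) (moll k))) +
     L2sq (Dx (conv (?d b) (moll k))) + L2sq (Dy (conv (?d b) (moll k)))"
    using conv_g by (auto simp: add.assoc intro: add_increasing add_increasing2)
  also have "\<dots> \<le> L2sq (?d D) + L2sq (?d K)"
  proof (rule energy_conv)
    show "weak_div (?d b) (\<lambda>p. - ?d a p) (?d K)"
      using weak_div_shift_diff[OF w(2) L(2) L2_compact_uminus[OF L(1)] L(4), of h] by simp
  qed (intro weak_div_shift_diff w L2_compact_diff L2_compact_shift L)+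
  finally show "L2sq (\<lambda>p. conv g (moll k) (h + p) - conv g (moll k) p) \<le> L2sq (?d D) + L2sq (?d K)" .
qed

section \<open>Local spaces and the fundamental lemma\<close>

definition L1_local :: "cfun set" where
  "L1_local = {u \<in> borel_measurable borel. \<forall>R. integrable lborel (\<lambda>p. indicator (cball 0 R) p * u p)}"

definition L2_local :: "cfun set" where
  "L2_local = {u \<in> borel_measurable borel. \<forall>R. (\<lambda>p. indicator (cball 0 R) p * u p) \<in> L2_compact}"

lemma L2_local_measurable [measurable_dest]: "u \<in> L2_local \<Longrightarrow> u \<in> borel_measurable borel"
  by (simp add: L2_local_def)

lemma L2_local_L1_local: "u \<in> L2_local \<Longrightarrow> u \<in> L1_local"
  by (simp add: L2_local_def L1_local_def L2_compact_integrable)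

lemma cind_measurable [measurable]: "(indicator (cball 0 R) :: cfun) \<in> borel_measurable borel"
  by measurable

lemma L2_local_I:
  assumes "u \<in> borel_measurable borel" "\<And>R. \<exists>v \<in> L2_compact. \<forall>p. norm p \<le> R \<longrightarrow> u p = v p"
  shows "u \<in> L2_local"
  unfolding L2_local_def
proof (intro CollectI conjI allI assms(1))
  fix R
  obtain v where v: "v \<in> L2_compact" "\<And>p. norm p \<le> R \<Longrightarrow> u p = v p" using assms(2) by blast
  have "(\<lambda>p. indicator (cball 0 R) p * u p) = (\<lambda>p. indicator (cball 0 R) p * v p)"
    using v(2) by (auto simp: fun_eq_iff indicator_def)
  then show "(\<lambda>p. indicator (cball 0 R) p * u p) \<in> L2_compact"
    using L2_compact_bounded_mult[OF v(1) cind_measurable, of R 1] by (simp add: indicator_def)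
qed

lemma L2_local_mult_compact:
  assumes u: "u \<in> L2_local" and f: "f \<in> borel_measurable borel" "\<And>p. norm (f p) \<le> B" "\<And>p. norm p > R \<Longrightarrow> f p = 0"
  shows "(\<lambda>p. f p * u p) \<in> L2_compact"
proof -
  have "(\<lambda>p. indicator (cball 0 R) p * u p) \<in> L2_compact" using u by (simp add: L2_local_def)
  from L2_compact_bounded_mult[OF this f(1,2)]
  have "(\<lambda>p. f p * (indicator (cball 0 R) p * u p)) \<in> L2_compact" .
  also have "(\<lambda>p. f p * (indicator (cball 0 R) p * u p)) = (\<lambda>p. f p * u p)"
    using f(3) by (auto simp: fun_eq_iff indicator_def)
  finally show ?thesis .
qed

lemma L2_local_test_fun:
  assumes u: "u \<in> L2_local" and f: "test_fun f" shows "(\<lambda>p. f p * u p) \<in> L2_compact"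
proof -
  obtain R where R: "\<And>p. norm p > R \<Longrightarrow> f p = 0" using f unfolding test_fun_iff by blast
  obtain B where B: "\<And>p. norm (f p) \<le> B" using f test_fun_bounded by metis
  show ?thesis by (rule L2_local_mult_compact[OF u test_fun_measurable[OF f] B R])
qed

lemma L1_local_test_fun:
  assumes u: "u \<in> L1_local" and f: "test_fun f" shows "integrable lborel (\<lambda>p. u p * f p)"
proof -
  obtain R where R: "\<And>p. norm p > R \<Longrightarrow> f p = 0" using f unfolding test_fun_iff by blast
  have t: "test_fun (\<lambda>q. f (- q))" using test_fun_affine[OF f, of "-1" 0] by simp
  have "integrable lborel (\<lambda>p. indicator (cball 0 R) p * u p)" using u by (simp add: L1_local_def)
  from integrable_mult_test_fun[OF this t, of 0]
  have "integrable lborel (\<lambda>p. indicator (cball 0 R) p * u p * f p)" by simp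
  also have "(\<lambda>p. indicator (cball 0 R) p * u p * f p) = (\<lambda>p. u p * f p)"
    using R by (auto simp: fun_eq_iff indicator_def)
  finally show ?thesis .
qed

lemmas L2_local_integrable_test_fun = L1_local_test_fun[OF L2_local_L1_local]

lemma L2_local_add: "u \<in> L2_local \<Longrightarrow> v \<in> L2_local \<Longrightarrow> (\<lambda>p. u p + v p) \<in> L2_local"
  by (auto simp: L2_local_def distrib_left intro!: L2_compact_add)

lemma L2_local_bounded_mult:
  assumes u: "u \<in> L2_local" and f: "f \<in> borel_measurable borel" "\<And>p. norm (f p) \<le> B"
  shows "(\<lambda>p. f p * u p) \<in> L2_local"
proof (rule L2_local_I)
  show "(\<lambda>p. f p * u p) \<in> borel_measurable borel" using u f by measurable
  fix R
  have "(\<lambda>p. f p * (indicator (cball 0 R) p * u p)) \<in> L2_compact"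
    by (rule L2_compact_bounded_mult[OF _ f]) (use u in \<open>simp add: L2_local_def\<close>)
  then show "\<exists>v\<in>L2_compact. \<forall>p. norm p \<le> R \<longrightarrow> f p * u p = v p"
    by (rule bexI[rotated]) auto
qed

lemma L2_local_cmult: "u \<in> L2_local \<Longrightarrow> (\<lambda>p. c * u p) \<in> L2_local"
  by (rule L2_local_bounded_mult[where B = "norm c"]) auto

lemma L2_local_uminus: "u \<in> L2_local \<Longrightarrow> (\<lambda>p. - u p) \<in> L2_local"
  using L2_local_cmult[of u "-1"] by simp

lemma L2_local_diff: "u \<in> L2_local \<Longrightarrow> v \<in> L2_local \<Longrightarrow> (\<lambda>p. u p - v p) \<in> L2_local"
  using L2_local_add[OF _ L2_local_uminus, of u v] by simp

lemma L2_compact_subset_local: "u \<in> L2_compact \<Longrightarrow> u \<in> L2_local"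
  by (rule L2_local_I) auto

lemma L1_local_diff: "u \<in> L1_local \<Longrightarrow> v \<in> L1_local \<Longrightarrow> (\<lambda>p. u p - v p) \<in> L1_local"
  by (auto simp: L1_local_def right_diff_distrib)

text \<open>The indicator of a slightly larger ball, mollified at scale one.\<close>

lemma smooth_cutoff:
  obtains \<zeta> where "test_fun \<zeta>" "\<And>p. norm p \<le> R \<Longrightarrow> \<zeta> p = 1" "\<And>p. norm p > R + 2 \<Longrightarrow> \<zeta> p = 0"
    "\<And>p. norm (\<zeta> p) \<le> 1"
proof -
  let ?u = "\<lambda>p::plane. of_real (indicator (cball 0 (R + 1)) p) :: complex"
  have u: "integrable lborel ?u"
    using emeasure_cball_plane_finite[of "R + 1"]
    by (intro integrable_of_real integrable_real_indicator) auto
  note m = moll_re_integrable[of 0] moll_re_integral[of 0]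
  have c: "conv ?u (moll 0) p = (\<integral>q. ?u (p - q) * moll 0 q \<partial>lborel)" for p
    by (rule conv_flip) auto
  have t1: "test_fun (conv ?u (moll 0))"
    by (rule conv_test_fun[OF u _ moll_test_fun, of "R + 1"]) simp
  have t2: "conv ?u (moll 0) p = 0" if "norm p > R + 2" for p
    by (rule conv_support[of "R + 1" _ 1]) (use that in \<open>auto simp: moll_def moll_re_support\<close>)
  have t3: "conv ?u (moll 0) p = 1" if p: "norm p \<le> R" for p
  proof -
    have "?u (p - q) * moll 0 q = of_real (moll_re 0 q)" for q
    proof (cases "norm q \<le> 1")
      case True
      then show ?thesis using norm_triangle_ineq4[of p q] p by (simp add: moll_def)
    qed (simp add: moll_def moll_re_support)
    then show ?thesis unfolding c by (simp add: m)
  qed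
  have t4: "norm (conv ?u (moll 0) p) \<le> 1" for p
  proof -
    have "norm (conv ?u (moll 0) p) \<le> (\<integral>q. moll_re 0 q \<partial>lborel)"
      unfolding c using conv_moll_integrable[OF u, of p 0]
      by (intro Bochner_Integration.integral_norm_bound_integral m)
        (auto simp: moll_def norm_mult moll_re_nonneg indicator_def)
    then show ?thesis by (simp add: m)
  qed
  show thesis by (rule that[OF t1 t3 t2 t4])
qed

text \<open>Localised by a cutoff, \<open>u\<close> has vanishing mollifications, as each is the pairing of \<open>u\<close> with a test
  function; the mollifications converge to \<open>u\<close> almost everywhere.\<close>

lemma fundamental_lemma:
  assumes u: "u \<in> L1_local" and 0: "\<And>\<psi>. test_fun \<psi> \<Longrightarrow> (\<integral>p. u p * \<psi> p \<partial>lborel) = 0"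
  shows "AE p in lborel. u p = 0"
proof -
  have "AE p in lborel. norm p \<le> real n \<longrightarrow> u p = 0" for n :: nat
  proof -
    obtain \<zeta> where \<zeta>: "test_fun \<zeta>" "\<And>p. norm p \<le> real n \<Longrightarrow> \<zeta> p = 1"
      by (rule smooth_cutoff[of "real n"]) blast
    have i: "integrable lborel (\<lambda>p. u p * \<zeta> p)" by (rule L1_local_test_fun[OF u \<zeta>(1)])
    have c0: "conv (\<lambda>p. u p * \<zeta> p) (moll k) p = 0" for k p
    proof -
      have "test_fun (\<lambda>q. \<zeta> q * moll k (p - q))"
        using test_fun_mult[OF \<zeta>(1) smooth_affine[OF test_fun_smooth[OF moll_test_fun], of k p "-1"]] by simp
      from 0[OF this] show ?thesis by (simp add: conv_def mult.assoc)
    qed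
    from conv_moll_AE_subseq[OF i] obtain r :: "nat \<Rightarrow> nat" where
      "AE p in lborel. (\<lambda>n. conv (\<lambda>p. u p * \<zeta> p) (moll (r n)) p) \<longlonglongrightarrow> u p * \<zeta> p" by blast
    then have "AE p in lborel. u p * \<zeta> p = 0"
      by eventually_elim (simp add: c0 LIMSEQ_const_iff)
    then show ?thesis by eventually_elim (use \<zeta>(2) in fastforce)
  qed
  then have "AE p in lborel. \<forall>n::nat. norm p \<le> real n \<longrightarrow> u p = 0" unfolding AE_all_countable by blast
  then show ?thesis by eventually_elim (metis real_arch_simple)
qed

section \<open>Calculus of weak equations\<close>

lemma weak_div_cong_AE:
  assumes "weak_div a b D" "AE p in lborel. D p = D' p" "D \<in> borel_measurable borel" "D' \<in> borel_measurable borel"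
  shows "weak_div a b D'"
proof -
  have "(\<integral>p. D p * \<psi> p \<partial>lborel) = (\<integral>p. D' p * \<psi> p \<partial>lborel)" if "test_fun \<psi>" for \<psi>
    using assms(2-4) test_fun_measurable[OF that] by (intro integral_cong_AE) auto
  then show ?thesis using assms(1) by (simp add: weak_div_def)
qed

lemma weak_div_add:
  assumes "weak_div a b D" "weak_div a' b' D'"
    and L: "a \<in> L2_local" "b \<in> L2_local" "D \<in> L2_local" "a' \<in> L2_local" "b' \<in> L2_local" "D' \<in> L2_local"
  shows "weak_div (\<lambda>p. a p + a' p) (\<lambda>p. b p + b' p) (\<lambda>p. D p + D' p)"
  unfolding weak_div_def
proof (intro allI impI)
  fix \<psi> assume t: "test_fun \<psi>"
  note d = test_fun_dir_deriv[OF t]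
  note i = L(1,2,4,5)[THEN L2_local_integrable_test_fun, OF d] L(3,6)[THEN L2_local_integrable_test_fun, OF t]
  have "(\<integral>p. (a p + a' p) * Dx \<psi> p + (b p + b' p) * Dy \<psi> p \<partial>lborel) =
      (\<integral>p. a p * Dx \<psi> p + b p * Dy \<psi> p \<partial>lborel) + (\<integral>p. a' p * Dx \<psi> p + b' p * Dy \<psi> p \<partial>lborel)"
    using i by (subst Bochner_Integration.integral_add[symmetric]) (auto simp: algebra_simps)
  also have "\<dots> = - (\<integral>p. D p * \<psi> p \<partial>lborel) + - (\<integral>p. D' p * \<psi> p \<partial>lborel)"
    using assms(1,2) t unfolding weak_div_def by simp
  also have "\<dots> = - (\<integral>p. (D p + D' p) * \<psi> p \<partial>lborel)"
    using i by (simp add: distrib_right)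
  finally show "(\<integral>p. (a p + a' p) * Dx \<psi> p + (b p + b' p) * Dy \<psi> p \<partial>lborel) = - (\<integral>p. (D p + D' p) * \<psi> p \<partial>lborel)" .
qed

lemma weak_div_uminus:
  assumes "weak_div a b D"
  shows "weak_div (\<lambda>p. - a p) (\<lambda>p. - b p) (\<lambda>p. - D p)"
  unfolding weak_div_def
proof (intro allI impI)
  fix \<psi> assume t: "test_fun \<psi>"
  have "(\<integral>p. - a p * Dx \<psi> p + - b p * Dy \<psi> p \<partial>lborel) = - (\<integral>p. a p * Dx \<psi> p + b p * Dy \<psi> p \<partial>lborel)"
    by (subst integral_minus[symmetric]) (simp add: algebra_simps)
  also have "\<dots> = - (\<integral>p. - D p * \<psi> p \<partial>lborel)" using assms t by (simp add: weak_div_def)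
  finally show "(\<integral>p. - a p * Dx \<psi> p + - b p * Dy \<psi> p \<partial>lborel) = - (\<integral>p. - D p * \<psi> p \<partial>lborel)" .
qed

text \<open>The product rule, obtained by testing with \<open>f \<psi>\<close>.\<close>

lemma weak_div_localize:
  assumes w: "weak_div a b D" and L: "a \<in> L2_local" "b \<in> L2_local" "D \<in> L2_local" and f: "test_fun f"
  shows "weak_div (\<lambda>p. f p * a p) (\<lambda>p. f p * b p) (\<lambda>p. f p * D p + (Dx f p * a p + Dy f p * b p))"
  unfolding weak_div_def
proof (intro allI impI)
  fix \<psi> assume t: "test_fun \<psi>"
  note s = test_fun_smooth[OF f] test_fun_smooth[OF t]
  note df = test_fun_dir_deriv[OF f]
  have ft: "test_fun (\<lambda>p. f p * \<psi> p)" "test_fun (\<lambda>p. f p * dir_deriv v \<psi> p)" "test_fun (\<lambda>p. dir_deriv v f p * \<psi> p)" for v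
    by (intro test_fun_mult f df s smooth_dir_deriv)+
  note i = L(3)[THEN L2_local_integrable_test_fun, OF ft(1)]
    L(1,2)[THEN L2_local_integrable_test_fun, OF ft(2)] L(1,2)[THEN L2_local_integrable_test_fun, OF ft(3)]
  have "(\<integral>p. f p * a p * Dx \<psi> p + f p * b p * Dy \<psi> p \<partial>lborel) =
    (\<integral>p. (a p * Dx (\<lambda>p. f p * \<psi> p) p + b p * Dy (\<lambda>p. f p * \<psi> p) p)
      - (a p * (Dx f p * \<psi> p) + b p * (Dy f p * \<psi> p)) \<partial>lborel)"
    by (simp add: dir_deriv_mult s algebra_simps)
  also have "\<dots> = (\<integral>p. a p * Dx (\<lambda>p. f p * \<psi> p) p + b p * Dy (\<lambda>p. f p * \<psi> p) p \<partial>lborel)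
      - (\<integral>p. a p * (Dx f p * \<psi> p) + b p * (Dy f p * \<psi> p) \<partial>lborel)"
    using i L(1,2)[THEN L2_local_integrable_test_fun, OF test_fun_dir_deriv[OF ft(1)]]
    by (intro Bochner_Integration.integral_diff) auto
  also have "\<dots> = - ((\<integral>p. D p * (f p * \<psi> p) \<partial>lborel) + (\<integral>p. a p * (Dx f p * \<psi> p) + b p * (Dy f p * \<psi> p) \<partial>lborel))"
    using w ft(1) by (simp add: weak_div_def)
  also have "\<dots> = - (\<integral>p. D p * (f p * \<psi> p) + (a p * (Dx f p * \<psi> p) + b p * (Dy f p * \<psi> p)) \<partial>lborel)"
    using i by (subst Bochner_Integration.integral_add) auto
  also have "\<dots> = - (\<integral>p. (f p * D p + (Dx f p * a p + Dy f p * b p)) * \<psi> p \<partial>lborel)"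
    by (simp add: algebra_simps)
  finally show "(\<integral>p. f p * a p * Dx \<psi> p + f p * b p * Dy \<psi> p \<partial>lborel) =
    - (\<integral>p. (f p * D p + (Dx f p * a p + Dy f p * b p)) * \<psi> p \<partial>lborel)" .
qed

lemma zero_L2_local: "(\<lambda>_. 0) \<in> L2_local"
  by (rule L2_compact_subset_local) (simp add: L2_compact_def L2sq_def)

lemma bounded_energyI:
  assumes u: "u \<in> L2_compact" and g: "g1 \<in> L2_compact" "g2 \<in> L2_compact"
    and w: "weak_div u (\<lambda>_. 0) g1" "weak_div (\<lambda>_. 0) u g2"
  shows "bounded_energy u"
proof -
  have d0: "conv (\<lambda>_. 0) f = (\<lambda>_. 0)" for f by (simp add: conv_def[abs_def])
  have dd0: "dir_deriv v (\<lambda>_. 0) p = 0" for v p by (rule dir_deriv_eqI[OF has_derivative_const])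
  have "Dx (conv u (moll k)) = conv g1 (moll k)" "Dy (conv u (moll k)) = conv g2 (moll k)" for k
    using weak_div_conv[OF w(1) L2_compact_integrable[OF u] _ moll_test_fun, of k]
      weak_div_conv[OF w(2) _ L2_compact_integrable[OF u] moll_test_fun, of k]
    by (auto simp: d0 dd0 fun_eq_iff)
  then have "L2sq (Dx (conv u (moll k))) + L2sq (Dy (conv u (moll k))) \<le> L2sq g1 + L2sq g2" for k
    by (simp add: add_mono L2sq_conv_moll_le L2_compact_integrable g)
  moreover have "L2sq g1 + L2sq g2 < \<infinity>"
    using g[THEN L2_compact_L2sq] by (simp add: ennreal_add_eq_top top.not_eq_extremum[symmetric])
  ultimately show ?thesis unfolding bounded_energy_def using u by blast
qed

lemma bounded_energy_localize:
  assumes L: "u \<in> L2_local" "g1 \<in> L2_local" "g2 \<in> L2_local"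
    and w: "weak_div u (\<lambda>_. 0) g1" "weak_div (\<lambda>_. 0) u g2" and f: "test_fun f"
  shows "bounded_energy (\<lambda>p. f p * u p)"
proof (rule bounded_energyI)
  show "weak_div (\<lambda>p. f p * u p) (\<lambda>_. 0) (\<lambda>p. f p * g1 p + Dx f p * u p)"
    using weak_div_localize[OF w(1) L(1) zero_L2_local L(2) f] by simp
  show "weak_div (\<lambda>_. 0) (\<lambda>p. f p * u p) (\<lambda>p. f p * g2 p + Dy f p * u p)"
    using weak_div_localize[OF w(2) zero_L2_local L(1) L(3) f] by simp
qed (intro L2_compact_add L2_local_test_fun L f test_fun_dir_deriv)+

text \<open>Weak derivatives are supplied only for the localised functions \<open>\<zeta> n * h\<close>. By the fundamental
  lemma they agree almost everywhere where the cutoffs are one, so they stabilise on bounded sets and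
  their limit is a weak derivative of \<open>h\<close>.\<close>

lemma patch_weak_derivative:
  fixes \<zeta> :: "nat \<Rightarrow> cfun"
  assumes h: "h \<in> L2_local"
    and \<zeta>: "\<And>n. test_fun (\<zeta> n)" "\<And>n p. norm p \<le> real n \<Longrightarrow> \<zeta> n p = 1" "\<And>n p. norm p > real n + 2 \<Longrightarrow> \<zeta> n p = 0"
    and g: "\<And>n. g n \<in> borel_measurable borel" "\<And>n. L2sq (g n) < \<infinity>"
    and w: "\<And>n \<psi>. test_fun \<psi> \<Longrightarrow> (\<integral>p. \<zeta> n p * h p * dir_deriv v \<psi> p \<partial>lborel) = - (\<integral>p. g n p * \<psi> p \<partial>lborel)"
  obtains G where "G \<in> L2_local"
    "\<And>\<psi>. test_fun \<psi> \<Longrightarrow> (\<integral>p. h p * dir_deriv v \<psi> p \<partial>lborel) = - (\<integral>p. G p * \<psi> p \<partial>lborel)"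
proof -
  note [measurable] = g(1)
  have gl: "g n \<in> L2_local" for n
  proof (rule L2_local_I)
    fix R
    have "L2sq (\<lambda>p. indicator (cball 0 R) p * g n p) \<le> ennreal (1\<^sup>2) * L2sq (g n)"
      by (rule L2sq_bounded_mult) (auto simp: indicator_def)
    then have "(\<lambda>p. indicator (cball 0 R) p * g n p) \<in> L2_compact"
      unfolding L2_compact_def using g(2)[of n] by (intro CollectI conjI exI[of _ R]) auto
    then show "\<exists>v\<in>L2_compact. \<forall>p. norm p \<le> R \<longrightarrow> g n p = v p" by (rule bexI[rotated]) auto
  qed (rule g)
  have main: "(\<integral>p. h p * dir_deriv v \<psi> p \<partial>lborel) = - (\<integral>p. g n p * \<psi> p \<partial>lborel)"
    if t: "test_fun \<psi>" and s: "\<And>p. norm p > real n \<Longrightarrow> dir_deriv v \<psi> p = 0" for n \<psi>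
  proof -
    have "(\<lambda>p. \<zeta> n p * h p * dir_deriv v \<psi> p) = (\<lambda>p. h p * dir_deriv v \<psi> p)"
    proof
      fix p show "\<zeta> n p * h p * dir_deriv v \<psi> p = h p * dir_deriv v \<psi> p"
        using s[of p] \<zeta>(2)[of p n] by (cases "norm p \<le> real n") auto
    qed
    then show ?thesis using w[OF t, of n] by simp
  qed
  \<comment> \<open>\<open>\<zeta> k * \<psi>\<close> vanishes beyond radius \<open>k + 2\<close>, where \<open>\<zeta> n\<close> and \<open>\<zeta> m\<close> are still one.\<close>
  have eq: "AE p in lborel. norm p \<le> real k \<longrightarrow> g n p = g m p" if nm: "n \<ge> k + 3" "m \<ge> k + 3" for k n m
  proof -
    have "(\<lambda>p. \<zeta> k p * (g n p - g m p)) \<in> L1_local"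
      by (intro L2_local_L1_local L2_compact_subset_local L2_local_test_fun L2_local_diff gl \<zeta>)
    moreover have "(\<integral>p. \<zeta> k p * (g n p - g m p) * \<psi> p \<partial>lborel) = 0" if t: "test_fun \<psi>" for \<psi>
    proof -
      have t': "test_fun (\<lambda>p. \<zeta> k p * \<psi> p)" by (intro test_fun_mult \<zeta> test_fun_smooth t)
      have z: "dir_deriv v (\<lambda>p. \<zeta> k p * \<psi> p) p = 0" if "norm p > real k + 2" for p
      proof -
        have "open {p::plane. real k + 2 < norm p}" by (intro open_Collect_less continuous_intros)
        then have "((\<lambda>p. \<zeta> k p * \<psi> p) has_derivative (\<lambda>v. 0)) (at p)"
          by (rule has_derivative_transform_within_open[OF has_derivative_const]) (use that \<zeta>(3) in simp_all)
        then show ?thesis by (rule dir_deriv_eqI)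
      qed
      have e: "(\<integral>p. g n p * (\<zeta> k p * \<psi> p) \<partial>lborel) = (\<integral>p. g m p * (\<zeta> k p * \<psi> p) \<partial>lborel)"
        using main[OF t', of n] main[OF t', of m] z nm by force
      have "(\<integral>p. \<zeta> k p * (g n p - g m p) * \<psi> p \<partial>lborel) = (\<integral>p. g n p * (\<zeta> k p * \<psi> p) - g m p * (\<zeta> k p * \<psi> p) \<partial>lborel)"
        by (simp add: algebra_simps)
      also have "\<dots> = 0"
        using L2_local_integrable_test_fun[OF gl t'] e by (subst Bochner_Integration.integral_diff) auto
      finally show ?thesis .
    qed
    ultimately have "AE p in lborel. \<zeta> k p * (g n p - g m p) = 0" by (rule fundamental_lemma)
    then show ?thesis by eventually_elim (auto simp: \<zeta>(2))
  qed
  have "AE p in lborel. \<forall>n\<ge>k + 3. norm p \<le> real k \<longrightarrow> g n p = g (k + 3) p" for k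
  proof -
    have "AE p in lborel. \<forall>n\<in>{k + 3..}. norm p \<le> real k \<longrightarrow> g n p = g (k + 3) p"
      by (subst AE_ball_countable) (auto intro: eq)
    then show ?thesis unfolding Ball_def atLeast_iff .
  qed
  then have ev: "AE p in lborel. \<forall>k. \<forall>n\<ge>k + 3. norm p \<le> real k \<longrightarrow> g n p = g (k + 3) p"
    unfolding AE_all_countable by blast
  define G where "G p = lim (\<lambda>n. g n p)" for p
  have Gm [measurable]: "G \<in> borel_measurable borel" unfolding G_def by measurable
  have G: "AE p in lborel. \<forall>k. norm p \<le> real k \<longrightarrow> G p = g (k + 3) p"
    using ev
  proof eventually_elim
    case (elim p)
    show ?case
    proof (intro allI impI)
      fix k assume "norm p \<le> real k"
      then have "\<forall>\<^sub>F n in sequentially. g n p = g (k + 3) p"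
        using elim by (intro eventually_sequentiallyI[of "k + 3"]) blast
      then have "(\<lambda>n. g n p) \<longlonglongrightarrow> g (k + 3) p" by (rule tendsto_eventually)
      then show "G p = g (k + 3) p" unfolding G_def by (rule limI)
    qed
  qed
  show thesis
  proof (rule that)
    show "G \<in> L2_local"
      unfolding L2_local_def L2_compact_def
    proof (intro CollectI conjI allI Gm)
      fix R :: real
      show "(\<lambda>p. indicator (cball 0 R) p * G p) \<in> borel_measurable borel" by measurable
      show "\<exists>Ra. \<forall>p. Ra < norm p \<longrightarrow> indicator (cball 0 R) p * G p = 0" by (intro exI[of _ R]) auto
      obtain k :: nat where k: "R \<le> real k" using real_arch_simple by blast
      have "L2sq (\<lambda>p. indicator (cball 0 R) p * G p) = L2sq (\<lambda>p. indicator (cball 0 R) p * g (k + 3) p)"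
        unfolding L2sq_def
      proof (rule nn_integral_cong_AE)
        show "AE p in lborel. ennreal ((norm (indicator (cball 0 R) p * G p))\<^sup>2) = ennreal ((norm (indicator (cball 0 R) p * g (k + 3) p))\<^sup>2)"
          using G
        proof eventually_elim
          case (elim p)
          then show ?case using k by (cases "norm p \<le> R") (auto dest!: spec[of _ k])
        qed
      qed
      also have "\<dots> < \<infinity>" using gl[of "k + 3"] by (simp add: L2_local_def L2_compact_def)
      finally show "L2sq (\<lambda>p. indicator (cball 0 R) p * G p) < \<infinity>" .
    qed
    fix \<psi> assume t: "test_fun \<psi>"
    obtain R where R: "\<And>p. norm p > R \<Longrightarrow> \<psi> p = 0" "\<And>p v. norm p > R \<Longrightarrow> dir_deriv v \<psi> p = 0"
      using test_fun_support[OF t] by metis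
    obtain k :: nat where k: "R \<le> real k" using real_arch_simple by blast
    have [measurable]: "\<psi> \<in> borel_measurable borel" by (rule test_fun_measurable[OF t])
    have "(\<integral>p. G p * \<psi> p \<partial>lborel) = (\<integral>p. g (k + 3) p * \<psi> p \<partial>lborel)"
    proof (rule integral_cong_AE)
      show "AE p in lborel. G p * \<psi> p = g (k + 3) p * \<psi> p"
        using G
      proof eventually_elim
        case (elim p)
        then show ?case using k R(1)[of p] by (cases "norm p \<le> R") (auto dest!: spec[of _ k])
      qed
    qed measurable
    then show "(\<integral>p. h p * dir_deriv v \<psi> p \<partial>lborel) = - (\<integral>p. G p * \<psi> p \<partial>lborel)"
    proof -
      have "dir_deriv v \<psi> p = 0" if "norm p > real (k + 3)" for p
        using R(2)[of p v] that k by simp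
      from main[OF t this] show "(\<integral>p. G p * \<psi> p \<partial>lborel) = (\<integral>p. g (k + 3) p * \<psi> p \<partial>lborel) \<Longrightarrow> ?thesis"
        by simp
    qed
  qed
qed

section \<open>From Lebesgue measurable functions to Borel representatives\<close>

lemma borel_representative:
  assumes "u \<in> borel_measurable lebesgue"
  obtains u' :: cfun where "u' \<in> borel_measurable borel" "AE p in lborel. u p = u' p"
proof -
  have "(\<lambda>p. Re (u p)) \<in> borel_measurable lebesgue" "(\<lambda>p. Im (u p)) \<in> borel_measurable lebesgue"
    using assms by measurable
  from this[THEN completion_ex_borel_measurable_real]
  obtain r i where ri: "r \<in> borel_measurable lborel" "AE p in lborel. Re (u p) = r p"
     "i \<in> borel_measurable lborel" "AE p in lborel. Im (u p) = i p" by blast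
  show thesis
  proof (rule that[of "\<lambda>p. Complex (r p) (i p)"])
    have "(\<lambda>p. of_real (r p) + \<i> * of_real (i p)) \<in> borel_measurable borel" using ri(1,3) by simp
    then show "(\<lambda>p. Complex (r p) (i p)) \<in> borel_measurable borel" by (simp add: Complex_eq)
    show "AE p in lborel. u p = Complex (r p) (i p)"
      using ri(2,4) by eventually_elim (simp add: complex_eq_iff)
  qed
qed

lemma AE_lborel_lebesgue: "AE p in lborel. P p \<Longrightarrow> AE p in lebesgue. P p"
  by (rule AE_completion)

lemma borel_lebesgue: "(u::cfun) \<in> borel_measurable borel \<Longrightarrow> u \<in> borel_measurable lebesgue"
  by (rule measurable_completion) simp

lemma lebesgue_integral_representative:
  fixes u u' :: cfun
  assumes "u \<in> borel_measurable lebesgue" "u' \<in> borel_measurable borel" "AE p in lborel. u p = u' p"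
  shows "(\<integral>p. u p \<partial>lebesgue) = (\<integral>p. u' p \<partial>lborel)"
proof -
  have "(\<integral>p. u p \<partial>lebesgue) = (\<integral>p. u' p \<partial>lebesgue)"
    by (intro integral_cong_AE assms borel_lebesgue AE_lborel_lebesgue)
  also have "\<dots> = (\<integral>p. u' p \<partial>lborel)" using assms(2) by (intro integral_completion) simp
  finally show ?thesis .
qed

lemma regular_representative:
  assumes "u \<in> borel_measurable lebesgue" "u' \<in> borel_measurable borel" "AE p in lborel. u p = u' p"
    and t: "test_fun \<psi>"
  shows "regular u \<psi> = (\<integral>p. u' p * \<psi> p \<partial>lborel)"
  unfolding regular_def
proof (rule lebesgue_integral_representative)
  have [measurable]: "\<psi> \<in> borel_measurable borel" by (rule test_fun_measurable[OF t])
  show "(\<lambda>p. u p * \<psi> p) \<in> borel_measurable lebesgue"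
    by (intro borel_measurable_times assms(1) borel_lebesgue test_fun_measurable[OF t])
  show "(\<lambda>p. u' p * \<psi> p) \<in> borel_measurable borel" using assms(2) by measurable
  show "AE p in lborel. u p * \<psi> p = u' p * \<psi> p" using assms(3) by eventually_elim simp
qed

lemma regular_borel:
  "u \<in> borel_measurable borel \<Longrightarrow> test_fun \<psi> \<Longrightarrow> regular u \<psi> = (\<integral>p. u p * \<psi> p \<partial>lborel)"
  by (rule regular_representative) (auto intro: borel_lebesgue)

lemma L2sq_lebesgue:
  assumes "u \<in> borel_measurable lebesgue" "u' \<in> borel_measurable borel" "AE p in lborel. u p = u' p"
  shows "(\<integral>\<^sup>+p. ennreal ((norm (u p))\<^sup>2) \<partial>lebesgue) = L2sq u'"
proof -
  have "(\<integral>\<^sup>+p. ennreal ((norm (u p))\<^sup>2) \<partial>lebesgue) = (\<integral>\<^sup>+p. ennreal ((norm (u' p))\<^sup>2) \<partial>lebesgue)"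
  proof (rule nn_integral_cong_AE)
    show "AE p in lebesgue. ennreal ((norm (u p))\<^sup>2) = ennreal ((norm (u' p))\<^sup>2)"
      using AE_lborel_lebesgue[OF assms(3)] by eventually_elim simp
  qed
  also have "\<dots> = L2sq u'" unfolding L2sq_def by (rule nn_integral_completion)
  finally show ?thesis .
qed

lemma L2_representative:
  assumes "u \<in> L2" obtains u' where "u' \<in> borel_measurable borel" "AE p in lborel. u p = u' p" "L2sq u' < \<infinity>"
proof -
  have m: "u \<in> borel_measurable lebesgue" and i: "integrable lebesgue (\<lambda>p. (norm (u p))\<^sup>2)"
    using assms by (auto simp: L2_def)
  obtain u' where u': "u' \<in> borel_measurable borel" "AE p in lborel. u p = u' p" by (rule borel_representative[OF m])
  have "L2sq u' < \<infinity>"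
    using i unfolding integrable_iff_bounded L2sq_lebesgue[OF m u', symmetric] by simp
  with u' show thesis by (rule that)
qed

lemma L2_I:
  assumes "u \<in> borel_measurable lebesgue" "u' \<in> borel_measurable borel" "AE p in lborel. u p = u' p" "L2sq u' < \<infinity>"
  shows "u \<in> L2"
  unfolding L2_def integrable_iff_bounded
  using assms(1,4) L2sq_lebesgue[OF assms(1-3)] by auto

lemma set_integrable_representative:
  fixes f f' :: "plane \<Rightarrow> 'b::{banach, second_countable_topology}"
  assumes "f \<in> borel_measurable lebesgue" "f' \<in> borel_measurable borel" "AE p in lborel. f p = f' p"
  shows "set_integrable lebesgue (cball 0 R) f \<longleftrightarrow> integrable lborel (\<lambda>p. indicator (cball 0 R) p *\<^sub>R f' p)"
proof -
  have m1: "(\<lambda>p. indicator (cball 0 R) p *\<^sub>R f p) \<in> borel_measurable lebesgue"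
    using assms(1) by (intro borel_measurable_scaleR borel_measurable_indicator) auto
  have m2: "(\<lambda>p. indicator (cball 0 R) p *\<^sub>R f' p) \<in> borel_measurable lborel"
    using assms(2) by simp
  have "set_integrable lebesgue (cball 0 R) f \<longleftrightarrow> integrable lebesgue (\<lambda>p. indicator (cball 0 R) p *\<^sub>R f' p)"
    unfolding set_integrable_def
  proof (intro integrable_cong_AE m1 measurable_completion[OF m2])
    show "AE p in lebesgue. indicat_real (cball 0 R) p *\<^sub>R f p = indicat_real (cball 0 R) p *\<^sub>R f' p"
      using AE_lborel_lebesgue[OF assms(3)] by eventually_elim simp
  qed
  also have "\<dots> \<longleftrightarrow> integrable lborel (\<lambda>p. indicator (cball 0 R) p *\<^sub>R f' p)"
    by (rule integrable_completion[OF m2])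
  finally show ?thesis .
qed

lemma set_integrable_compact:
  fixes f :: "plane \<Rightarrow> 'b::{banach, second_countable_topology}"
  assumes "\<And>R. set_integrable lebesgue (cball (0::plane) R) f" "compact K"
  shows "set_integrable lebesgue K f"
proof -
  obtain R where "\<And>x. x \<in> K \<Longrightarrow> norm x \<le> R"
    using compact_imp_bounded[OF assms(2)] unfolding bounded_iff by blast
  then have "K \<subseteq> cball 0 R" by auto
  then show ?thesis using assms by (intro set_integrable_subset[OF assms(1)]) (auto simp: lmeasurable_compact fmeasurableD)
qed

lemma L1_loc_representative:
  assumes "u \<in> L1_loc" obtains u' where "u' \<in> L1_local" "AE p in lborel. u p = u' p"
proof -
  have m: "u \<in> borel_measurable lebesgue" using assms by (simp add: L1_loc_def)
  obtain u' where u': "u' \<in> borel_measurable borel" "AE p in lborel. u p = u' p" by (rule borel_representative[OF m])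
  have "integrable lborel (\<lambda>p. indicator (cball 0 R) p * u' p)" for R
  proof -
    have "integrable lborel (\<lambda>p. indicat_real (cball 0 R) p *\<^sub>R u' p)"
      using assms set_integrable_representative[OF m u', of R] by (auto simp: L1_loc_def)
    then show ?thesis by (simp add: scaleR_conv_of_real of_real_indicator)
  qed
  then show thesis using that[of u'] u' by (simp add: L1_local_def)
qed

lemma L2_loc_representative:
  assumes "u \<in> L2_loc" obtains u' where "u' \<in> L2_local" "AE p in lborel. u p = u' p"
proof -
  have m: "u \<in> borel_measurable lebesgue" using assms by (simp add: L2_loc_def)
  obtain u' where u': "u' \<in> borel_measurable borel" "AE p in lborel. u p = u' p" by (rule borel_representative[OF m])
  note [measurable] = u'(1)
  have "(\<lambda>p. indicator (cball 0 R) p * u' p) \<in> L2_compact" for R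
  proof -
    have "(\<lambda>p. (norm (u p))\<^sup>2) \<in> borel_measurable lebesgue" "AE p in lborel. (norm (u p))\<^sup>2 = (norm (u' p))\<^sup>2"
      using m u'(2) by (auto elim: eventually_mono)
    then have i: "integrable lborel (\<lambda>p. indicat_real (cball 0 R) p *\<^sub>R (norm (u' p))\<^sup>2)"
      using assms set_integrable_representative[of "\<lambda>p. (norm (u p))\<^sup>2" "\<lambda>p. (norm (u' p))\<^sup>2" R] by (auto simp: L2_loc_def)
    have "L2sq (\<lambda>p. indicator (cball 0 R) p * u' p) = (\<integral>\<^sup>+p. ennreal (norm (indicat_real (cball 0 R) p *\<^sub>R (norm (u' p))\<^sup>2)) \<partial>lborel)"
      unfolding L2sq_def by (intro nn_integral_cong) (auto split: split_indicator)
    also have "\<dots> < \<infinity>" using i by (simp add: integrable_iff_bounded)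
    finally show ?thesis unfolding L2_compact_def by (intro CollectI conjI exI[of _ R]) auto
  qed
  then show thesis using that[of u'] u' by (simp add: L2_local_def)
qed

lemma L2_local_L1_loc: assumes u: "u \<in> L2_local" shows "u \<in> L1_loc"
proof -
  have m [measurable]: "u \<in> borel_measurable borel" using u by measurable
  have "set_integrable lebesgue (cball 0 R) u" for R
    using L2_local_L1_local[OF u] set_integrable_representative[OF borel_lebesgue[OF m] m, of R]
    by (auto simp: L1_local_def scaleR_conv_of_real of_real_indicator)
  then show ?thesis unfolding L1_loc_def using set_integrable_compact borel_lebesgue[OF m] by blast
qed

text \<open>The chosen density of a distribution is determined almost everywhere, by the fundamental lemma.\<close>

lemma density_of_AE:
  assumes u: "u \<in> L2_local" and T: "T =\<^sub>D regular u"
  shows "density_of T \<in> borel_measurable lebesgue" "AE p in lborel. density_of T p = u p"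
proof -
  have "density_of T \<in> L1_loc \<and> T =\<^sub>D regular (density_of T)"
    unfolding density_of_def by (rule someI[of _ u]) (use L2_local_L1_loc[OF u] T in blast)
  then have d: "density_of T \<in> L1_loc" "T =\<^sub>D regular (density_of T)" by auto
  then show m: "density_of T \<in> borel_measurable lebesgue" by (simp add: L1_loc_def)
  obtain d' where d': "d' \<in> L1_local" "AE p in lborel. density_of T p = d' p" by (rule L1_loc_representative[OF d(1)])
  have um: "u \<in> borel_measurable borel" "d' \<in> borel_measurable borel" using u d' by (auto simp: L1_local_def)
  have "AE p in lborel. d' p - u p = 0"
  proof (rule fundamental_lemma)
    show "(\<lambda>p. d' p - u p) \<in> L1_local" by (intro L1_local_diff d' L2_local_L1_local u)
    fix \<psi> assume t: "test_fun \<psi>"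
    have "regular (density_of T) \<psi> = regular u \<psi>" using d(2) T t by (simp add: distr_eq_def)
    then have "(\<integral>p. d' p * \<psi> p \<partial>lborel) = (\<integral>p. u p * \<psi> p \<partial>lborel)"
      by (simp add: regular_representative[OF m um(2) d'(2) t] regular_borel[OF um(1) t])
    then show "(\<integral>p. (d' p - u p) * \<psi> p \<partial>lborel) = 0"
      using L1_local_test_fun[OF d'(1) t] L1_local_test_fun[OF L2_local_L1_local[OF u] t]
      by (simp add: left_diff_distrib)
  qed
  with d'(2) show "AE p in lborel. density_of T p = u p" by eventually_elim simp
qed

lemma coeff_mult_eq:
  fixes c c' :: "plane \<Rightarrow> real"
  assumes u: "u \<in> L2_local" and T: "T =\<^sub>D regular u"
    and c: "c' \<in> borel_measurable borel" "AE p in lborel. c p = c' p" and t: "test_fun \<psi>"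
  shows "coeff_mult c T \<psi> = (\<integral>p. of_real (c' p) * u p * \<psi> p \<partial>lborel)"
  unfolding coeff_mult_def
proof (rule regular_representative[OF _ _ _ t])
  have um [measurable]: "u \<in> borel_measurable borel" using u by measurable
  note d = density_of_AE[OF u T]
  have "AE p in lborel. of_real (c p) * density_of T p = of_real (c' p) * u p"
    using c(2) d(2) by eventually_elim simp
  then show "AE p in lborel. of_real (c p) * density_of T p = of_real (c' p) * u p" .
  show m: "(\<lambda>p. of_real (c' p) * u p) \<in> borel_measurable borel" using c(1) by measurable
  show "(\<lambda>p. of_real (c p) * density_of T p) \<in> borel_measurable lebesgue"
  proof -
    have "AE p in lebesgue. of_real (c' p) * u p = of_real (c p) * density_of T p"
      using AE_lborel_lebesgue[OF c(2)] AE_lborel_lebesgue[OF d(2)] by eventually_elim simp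
    then show ?thesis
      using borel_lebesgue[OF m] by (rule borel_measurable_AE[rotated])
  qed
qed

lemma sobolev_1_derivative:
  assumes "u \<in> sobolev 1"
  shows "u \<in> L2" "\<exists>g\<in>L2. dx (regular u) =\<^sub>D regular g" "\<exists>g\<in>L2. dy (regular u) =\<^sub>D regular g"
proof -
  show "u \<in> L2" by (rule assms[unfolded sobolev_def mem_Collect_eq, THEN conjunct1])
  have *: "\<exists>g\<in>L2. (dx ^^ i) ((dy ^^ j) (regular u)) =\<^sub>D regular g" if "i + j \<le> 1" for i j
  proof -
    have "i + j \<le> nat \<lfloor>1::real\<rfloor>" using that by simp
    from assms[unfolded sobolev_def mem_Collect_eq, THEN conjunct2, THEN spec, THEN spec, THEN mp, OF this]
    show ?thesis by (elim bexE conjE) (rule bexI)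
  qed
  from *[of 1 0] show "\<exists>g\<in>L2. dx (regular u) =\<^sub>D regular g" by simp
  from *[of 0 1] show "\<exists>g\<in>L2. dy (regular u) =\<^sub>D regular g" by simp
qed

text \<open>A locally \<open>H\<^sup>1\<close> function has a Borel representative with a weak gradient on the whole plane, so that
  from here on the calculus of \<open>weak_div\<close> applies.\<close>

lemma sobolev_loc_1_representative:
  assumes h: "h \<in> sobolev_loc 1"
  obtains h' gx gy where "h \<in> borel_measurable lebesgue" "AE p in lborel. h p = h' p"
    "h' \<in> L2_local" "gx \<in> L2_local" "gy \<in> L2_local"
    "weak_div h' (\<lambda>_. 0) gx" "weak_div (\<lambda>_. 0) h' gy"
proof -
  have "\<exists>\<zeta>. test_fun \<zeta> \<and> (\<forall>p. norm p \<le> real n \<longrightarrow> \<zeta> p = 1) \<and> (\<forall>p. norm p > real n + 2 \<longrightarrow> \<zeta> p = 0)" for n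
    by (rule smooth_cutoff[of "real n"]) blast
  then obtain \<zeta> :: "nat \<Rightarrow> cfun" where \<zeta>: "\<And>n. test_fun (\<zeta> n)"
    "\<And>n p. norm p \<le> real n \<Longrightarrow> \<zeta> n p = 1" "\<And>n p. norm p > real n + 2 \<Longrightarrow> \<zeta> n p = 0" by metis
  have S: "(\<lambda>p. \<zeta> n p * h p) \<in> sobolev 1" for n using h \<zeta>(1) by (simp add: sobolev_loc_def)
  have Sm: "(\<lambda>p. \<zeta> n p * h p) \<in> borel_measurable lebesgue" for n
    using sobolev_1_derivative(1)[OF S] by (simp add: L2_def)
  have hm: "h \<in> borel_measurable lebesgue"
  proof (rule borel_measurable_LIMSEQ_metric[OF Sm])
    fix p :: plane
    obtain N :: nat where N: "norm p \<le> real N" using real_arch_simple by blast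
    show "(\<lambda>n. \<zeta> n p * h p) \<longlonglongrightarrow> h p"
    proof (rule tendsto_eventually, rule eventually_sequentiallyI[of N])
      fix n assume "N \<le> n"
      then have "norm p \<le> real n" using N by linarith
      then show "\<zeta> n p * h p = h p" by (simp add: \<zeta>(2))
    qed
  qed
  obtain h' where h': "h' \<in> borel_measurable borel" "AE p in lborel. h p = h' p" by (rule borel_representative[OF hm])
  note [measurable] = h'(1)
  have \<zeta>m [measurable]: "\<zeta> n \<in> borel_measurable borel" for n by (rule test_fun_measurable[OF \<zeta>(1)])
  have \<zeta>h: "AE p in lborel. \<zeta> n p * h p = \<zeta> n p * h' p" for n using h'(2) by eventually_elim simp
  have L2sq: "L2sq (\<lambda>p. \<zeta> n p * h' p) < \<infinity>" for n
  proof -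
    obtain v where v: "v \<in> borel_measurable borel" "AE p in lborel. \<zeta> n p * h p = v p" "L2sq v < \<infinity>"
      using L2_representative[OF sobolev_1_derivative(1)[OF S]] by blast
    have "L2sq (\<lambda>p. \<zeta> n p * h' p) = L2sq v"
      using L2sq_lebesgue[OF Sm v(1,2)] L2sq_lebesgue[OF Sm _ \<zeta>h] by simp
    then show ?thesis using v(3) by simp
  qed
  have hl: "h' \<in> L2_local"
  proof (rule L2_local_I[OF h'(1)])
    fix R :: real
    obtain N :: nat where N: "R \<le> real N" using real_arch_simple by blast
    have "\<forall>p. norm p > real N + 2 \<longrightarrow> \<zeta> N p * h' p = 0" using \<zeta>(3) by simp
    then have "(\<lambda>p. \<zeta> N p * h' p) \<in> L2_compact"
      unfolding L2_compact_def using L2sq[of N] by (intro CollectI conjI exI[of _ "real N + 2"]) auto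
    then show "\<exists>v\<in>L2_compact. \<forall>p. norm p \<le> R \<longrightarrow> h' p = v p"
      by (rule bexI[rotated]) (use \<zeta>(2) N in auto)
  qed
  have der: "\<exists>G\<in>L2_local. \<forall>\<psi>. test_fun \<psi> \<longrightarrow> (\<integral>p. h' p * dir_deriv v \<psi> p \<partial>lborel) = - (\<integral>p. G p * \<psi> p \<partial>lborel)"
    if ex: "\<And>n. \<exists>g\<in>L2. (\<lambda>\<phi>. - regular (\<lambda>p. \<zeta> n p * h p) (dir_deriv v \<phi>)) =\<^sub>D regular g" for v
  proof -
    have "\<exists>g. g \<in> borel_measurable borel \<and> L2sq g < \<infinity> \<and>
        (\<forall>\<psi>. test_fun \<psi> \<longrightarrow> (\<integral>p. \<zeta> n p * h' p * dir_deriv v \<psi> p \<partial>lborel) = - (\<integral>p. g p * \<psi> p \<partial>lborel))" for n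
    proof -
      obtain g where g: "g \<in> L2" "(\<lambda>\<phi>. - regular (\<lambda>p. \<zeta> n p * h p) (dir_deriv v \<phi>)) =\<^sub>D regular g" using ex by blast
      obtain g' where g': "g' \<in> borel_measurable borel" "AE p in lborel. g p = g' p" "L2sq g' < \<infinity>"
        using L2_representative[OF g(1)] by blast
      have gm: "g \<in> borel_measurable lebesgue" using g(1) by (simp add: L2_def)
      have "(\<integral>p. \<zeta> n p * h' p * dir_deriv v \<psi> p \<partial>lborel) = - (\<integral>p. g' p * \<psi> p \<partial>lborel)" if t: "test_fun \<psi>" for \<psi>
      proof -
        have "- regular (\<lambda>p. \<zeta> n p * h p) (dir_deriv v \<psi>) = regular g \<psi>"
          using g(2) t unfolding distr_eq_def by blast
        moreover have "regular (\<lambda>p. \<zeta> n p * h p) (dir_deriv v \<psi>) = (\<integral>p. \<zeta> n p * h' p * dir_deriv v \<psi> p \<partial>lborel)"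
          by (rule regular_representative[OF Sm _ \<zeta>h test_fun_dir_deriv[OF t]]) measurable
        ultimately show ?thesis
          unfolding regular_representative[OF gm g'(1,2) t] by (metis minus_minus)
      qed
      then show ?thesis using g' by blast
    qed
    then obtain g where g: "\<And>n. g n \<in> borel_measurable borel" "\<And>n. L2sq (g n) < \<infinity>"
      "\<And>n \<psi>. test_fun \<psi> \<Longrightarrow> (\<integral>p. \<zeta> n p * h' p * dir_deriv v \<psi> p \<partial>lborel) = - (\<integral>p. g n p * \<psi> p \<partial>lborel)" by metis
    show ?thesis
    proof (rule patch_weak_derivative[where h = h' and \<zeta> = \<zeta> and g = g and v = v])
      fix G assume "G \<in> L2_local" "\<And>\<psi>. test_fun \<psi> \<Longrightarrow> (\<integral>p. h' p * dir_deriv v \<psi> p \<partial>lborel) = - (\<integral>p. G p * \<psi> p \<partial>lborel)"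
      then show ?thesis by (intro bexI[of _ G] allI impI)
    qed (rule hl, rule \<zeta>(1), rule \<zeta>(2), assumption, rule \<zeta>(3), assumption,
        rule g(1), rule g(2), rule g(3), assumption)
  qed
  obtain gx where gx: "gx \<in> L2_local" "\<And>\<psi>. test_fun \<psi> \<Longrightarrow> (\<integral>p. h' p * Dx \<psi> p \<partial>lborel) = - (\<integral>p. gx p * \<psi> p \<partial>lborel)"
    using der[of "(1, 0)"] sobolev_1_derivative(2)[OF S] unfolding dx_def by blast
  obtain gy where gy: "gy \<in> L2_local" "\<And>\<psi>. test_fun \<psi> \<Longrightarrow> (\<integral>p. h' p * Dy \<psi> p \<partial>lborel) = - (\<integral>p. gy p * \<psi> p \<partial>lborel)"
    using der[of "(0, 1)"] sobolev_1_derivative(3)[OF S] unfolding dy_def by blast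
  show thesis
    by (rule that[OF hm h'(2) hl gx(1) gy(1)]) (simp_all add: weak_div_def gx(2) gy(2))
qed

section \<open>From translation estimates to Gagliardo seminorms\<close>

text \<open>Discs of radius \<open>r k\<close> have area proportional to \<open>(r k)\<^sup>2\<close>, so the sum is dominated by a geometric
  series.\<close>

lemma dyadic_series_finite:
  fixes c r K :: "nat \<Rightarrow> real" and \<rho> :: real
  assumes "\<And>k. 0 \<le> c k" "\<And>k. 0 \<le> r k" "0 \<le> B" "0 < \<rho>" "\<rho> < 1" "\<And>k. c k * (r k)\<^sup>2 \<le> B * \<rho> ^ k"
  shows "(\<integral>\<^sup>+h. (\<Sum>k. ennreal (c k) * indicator (cball (0::plane) (r k)) h) \<partial>lborel) < \<infinity>"
proof -
  define V where "V = unit_ball_vol (real DIM(plane))"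
  have V: "V \<ge> 0" unfolding V_def by simp
  have "(\<integral>\<^sup>+h. (\<Sum>k. ennreal (c k) * indicator (cball (0::plane) (r k)) h) \<partial>lborel) =
      (\<Sum>k. \<integral>\<^sup>+h. ennreal (c k) * indicator (cball (0::plane) (r k)) h \<partial>lborel)"
    by (rule nn_integral_suminf) measurable
  also have "\<dots> = (\<Sum>k. ennreal (V * (c k * (r k)\<^sup>2)))"
    using assms(1,2) V
    by (intro suminf_cong) (simp add: nn_integral_cmult_indicator emeasure_cball V_def ennreal_mult[symmetric] power2_eq_square mult_ac)
  also have "\<dots> \<le> (\<Sum>k. ennreal (V * (B * \<rho> ^ k)))"
    using assms V by (intro suminf_le ennreal_leI mult_left_mono) auto
  also have "\<dots> < \<infinity>"
  proof -
    have "(\<Sum>k. ennreal (V * (B * \<rho> ^ k))) \<noteq> top"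
      using assms V by (intro ennreal_suminf_neq_top summable_mult summable_geometric) auto
    then show ?thesis by (simp add: top.not_eq_extremum)
  qed
  finally show ?thesis .
qed

lemma le_suminf_ennreal: "f n \<le> (\<Sum>k. f k)" for f :: "nat \<Rightarrow> ennreal"
  using sum_le_suminf[of f "{n}"] by simp

text \<open>A point with \<open>1 / 2 ^ Suc k < \<bar>h\<bar> \<le> 1 / 2 ^ k\<close> is charged to the disc of radius \<open>1 / 2 ^ k\<close>.
  The weight on that disc is of order \<open>2 ^ (k (b - a))\<close> and its area of order \<open>2 ^ (- 2 k)\<close>.\<close>

lemma singular_kernel_near:
  fixes a b :: real
  assumes C: "0 \<le> C" and ab: "0 < a" "0 < b" "b < a + 2"
  shows "(\<integral>\<^sup>+h. ennreal (C * norm (h::plane) powr a) * ennreal (1 / norm h powr b) * indicator (cball 0 1) h \<partial>lborel) < \<infinity>"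
proof -
  define r :: "nat \<Rightarrow> real" where "r k = (1 / 2) ^ k" for k
  define c where "c k = C * r k powr a * (1 / (r (Suc k)) powr b)" for k
  have r: "r k > 0" "r k \<le> 1" for k by (simp_all add: r_def power_le_one)
  have rp: "r k = (1 / 2) powr real k" for k by (simp add: r_def powr_realpow)
  have "(\<integral>\<^sup>+h. ennreal (C * norm (h::plane) powr a) * ennreal (1 / norm h powr b) * indicator (cball 0 1) h \<partial>lborel)
      \<le> (\<integral>\<^sup>+h. (\<Sum>k. ennreal (c k) * indicator (cball (0::plane) (r k)) h) \<partial>lborel)"
  proof (rule nn_integral_mono)
    fix h :: plane
    show "ennreal (C * norm h powr a) * ennreal (1 / norm h powr b) * indicator (cball 0 1) h \<le>
        (\<Sum>k. ennreal (c k) * indicator (cball 0 (r k)) h)"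
    \<comment> \<open>At \<open>h = 0\<close> the integrand is zero, since \<open>0 powr a = 0\<close>.\<close>
    proof (cases "h = 0 \<or> norm h > 1")
      case False
      then have h: "0 < norm h" "norm h \<le> 1" by auto
      have "\<exists>k. r (Suc k) < norm h"
      proof -
        obtain k where "(1 / 2) ^ k < norm h" using real_arch_pow_inv[OF h(1), of "1 / 2"] by auto
        moreover have "r (Suc k) \<le> (1 / 2) ^ k" by (simp add: r_def)
        ultimately have "r (Suc k) < norm h" by linarith
        then show ?thesis ..
      qed
      \<comment> \<open>Minimality of \<open>k\<close> gives the opposite bound \<open>norm h \<le> r k\<close>.\<close>
      define k where "k = (LEAST k. r (Suc k) < norm h)"
      have k1: "r (Suc k) < norm h" unfolding k_def by (rule LeastI_ex) fact
      have k2: "norm h \<le> r k"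
      proof (cases k)
        case 0 then show ?thesis using h by (simp add: r_def)
      next
        case (Suc j)
        then have "\<not> r (Suc j) < norm h" using not_less_Least[of j "\<lambda>k. r (Suc k) < norm h"] unfolding k_def[symmetric] by simp
        then show ?thesis using Suc by simp
      qed
      have "C * norm h powr a * (1 / norm h powr b) \<le> c k"
        unfolding c_def
      proof (intro mult_mono)
        show "norm h powr a \<le> r k powr a" using k2 ab by (intro powr_mono2) auto
        show "1 / norm h powr b \<le> 1 / r (Suc k) powr b"
          using k1 ab r(1)[of "Suc k"] h by (intro divide_left_mono powr_mono2 mult_pos_pos) auto
      qed (use C in simp_all)
      then have "ennreal (C * norm h powr a) * ennreal (1 / norm h powr b) \<le> ennreal (c k)"
      proof -
        have "ennreal (C * norm h powr a) * ennreal (1 / norm h powr b) = ennreal (C * norm h powr a * (1 / norm h powr b))"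
          using C by (intro ennreal_mult[symmetric]) auto
        then show "C * norm h powr a * (1 / norm h powr b) \<le> c k \<Longrightarrow> ?thesis" by (simp only: ennreal_leI)
      qed
      then have "ennreal (C * norm h powr a) * ennreal (1 / norm h powr b) * indicator (cball 0 1) h \<le>
          ennreal (c k) * indicator (cball 0 (r k)) h"
        using h k2 by simp
      also have "\<dots> \<le> (\<Sum>k. ennreal (c k) * indicator (cball 0 (r k)) h)" by (rule le_suminf_ennreal)
      finally show ?thesis .
    qed (use ab in auto)
  qed
  also have "\<dots> < \<infinity>"
  proof (rule dyadic_series_finite)
    show "c k * (r k)\<^sup>2 \<le> C * 2 powr b * ((1 / 2) powr (a + 2 - b)) ^ k" for k
    proof -
      have "r k powr a = (1 / 2) powr (a * k)" "(r k)\<^sup>2 = (1 / 2) powr (2 * k)"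
        using r(1)[of k] unfolding rp by (simp_all add: powr_powr mult.commute powr_realpow[symmetric] del: powr_realpow)
      moreover have "1 / r (Suc k) powr b = 2 powr b * (1 / 2) powr (- b * k)"
      proof -
        have "1 / r (Suc k) powr b = (1 / 2) powr (- b * (k + 1))"
          unfolding rp by (simp add: powr_powr powr_minus_divide mult.commute)
        also have "\<dots> = (1 / 2) powr (- b) * (1 / 2) powr (- b * k)"
          by (simp add: powr_add[symmetric] algebra_simps)
        also have "(1 / 2) powr (- b) = 2 powr b" by (simp add: powr_divide powr_minus divide_simps)
        finally show ?thesis .
      qed
      ultimately have "c k * (r k)\<^sup>2 = C * 2 powr b * ((1 / 2) powr (a * k) * (1 / 2) powr (- b * k) * (1 / 2) powr (2 * k))"
        unfolding c_def by (simp only: mult_ac)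
      also have "(1 / 2) powr (a * k) * (1 / 2) powr (- b * k) * (1 / 2) powr (2 * k) = (1 / 2 :: real) powr ((a + 2 - b) * k)"
        by (simp add: powr_add[symmetric] algebra_simps)
      also have "\<dots> = ((1 / 2) powr (a + 2 - b)) ^ k"
        by (simp add: powr_powr[symmetric] powr_realpow)
      finally show ?thesis by simp
    qed
    show "(1 / 2) powr (a + 2 - b) < (1::real)" using ab by (simp add: powr01_less_one)
  qed (use C r in \<open>auto simp: c_def less_imp_le\<close>)
  finally show ?thesis .
qed

text \<open>The same decomposition with growing discs; the decay exponent \<open>b > 2\<close> beats the area.\<close>

lemma singular_kernel_far:
  fixes b :: real
  assumes N: "N < \<infinity>" and b: "b > 2"
  shows "(\<integral>\<^sup>+h. N * ennreal (1 / norm (h::plane) powr b) * indicator (- cball 0 1) h \<partial>lborel) < \<infinity>"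
proof -
  define r :: "nat \<Rightarrow> real" where "r k = 2 ^ k" for k
  define c where "c k = enn2real N * (1 / (r k) powr b)" for k
  have r: "r k > 0" "r k \<ge> 1" for k by (simp_all add: r_def)
  have rp: "r k = 2 powr real k" for k by (simp add: r_def powr_realpow)
  have "(\<integral>\<^sup>+h. N * ennreal (1 / norm (h::plane) powr b) * indicator (- cball 0 1) h \<partial>lborel)
      \<le> (\<integral>\<^sup>+h. (\<Sum>k. ennreal (c k) * indicator (cball (0::plane) (r (Suc k))) h) \<partial>lborel)"
  proof (rule nn_integral_mono)
    fix h :: plane
    show "N * ennreal (1 / norm h powr b) * indicator (- cball 0 1) h \<le>
        (\<Sum>k. ennreal (c k) * indicator (cball 0 (r (Suc k))) h)"
    proof (cases "norm h > 1")
      case h: True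
      have "\<exists>k. norm h \<le> r (Suc k)"
      proof -
        obtain k where "norm h < 2 ^ k" using real_arch_pow[of 2 "norm h"] by auto
        also have "(2::real) ^ k \<le> r (Suc k)" by (simp add: r_def)
        finally show ?thesis by (intro exI[of _ k]) simp
      qed
      \<comment> \<open>Minimality of \<open>k\<close> gives the opposite bound \<open>r k \<le> norm h\<close>.\<close>
      define k where "k = (LEAST k. norm h \<le> r (Suc k))"
      have k1: "norm h \<le> r (Suc k)" unfolding k_def by (rule LeastI_ex) fact
      have k2: "r k \<le> norm h"
      proof (cases k)
        case 0 then show ?thesis using h by (simp add: r_def)
      next
        case (Suc j)
        then have "\<not> norm h \<le> r (Suc j)" using not_less_Least[of j "\<lambda>k. norm h \<le> r (Suc k)"] unfolding k_def[symmetric] by simp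
        then show ?thesis using Suc by simp
      qed
      have "1 / norm h powr b \<le> 1 / r k powr b"
        using k2 b r(1)[of k] h by (intro divide_left_mono powr_mono2 mult_pos_pos) auto
      then have "N * ennreal (1 / norm h powr b) \<le> N * ennreal (1 / r k powr b)"
        by (intro mult_left_mono ennreal_leI) auto
      also have "\<dots> = ennreal (c k)" unfolding c_def using N by (subst ennreal_mult) simp_all
      finally have "N * ennreal (1 / norm h powr b) * indicator (- cball 0 1) h \<le>
          ennreal (c k) * indicator (cball 0 (r (Suc k))) h"
        using h k1 by simp
      also have "\<dots> \<le> (\<Sum>k. ennreal (c k) * indicator (cball 0 (r (Suc k))) h)"
        by (rule le_suminf_ennreal[of "\<lambda>k. ennreal (c k) * indicator (cball 0 (r (Suc k))) h"])
      finally show ?thesis .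
    qed auto
  qed
  also have "\<dots> < \<infinity>"
  proof (rule dyadic_series_finite)
    show "c k * (r (Suc k))\<^sup>2 \<le> enn2real N * 4 * (2 powr (2 - b)) ^ k" for k
    proof -
      have "1 / r k powr b = 2 powr (- b * k)"
        unfolding rp by (simp add: powr_powr powr_minus_divide mult.commute)
      moreover have "(r (Suc k))\<^sup>2 = 4 * 2 powr (2 * k)"
      proof -
        have "(r (Suc k))\<^sup>2 = 4 * (r k)\<^sup>2" by (simp add: r_def power2_eq_square)
        also have "(r k)\<^sup>2 = 2 powr (2 * k)"
          using r(1)[of k] unfolding rp by (simp add: powr_powr mult.commute powr_realpow[symmetric] del: powr_realpow)
        finally show ?thesis .
      qed
      ultimately have "c k * (r (Suc k))\<^sup>2 = enn2real N * 4 * (2 powr (- b * k) * 2 powr (2 * k))"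
        unfolding c_def by (simp only: mult_ac)
      also have "2 powr (- b * k) * 2 powr (2 * k) = (2::real) powr ((2 - b) * k)"
        by (simp add: powr_add[symmetric] algebra_simps)
      also have "\<dots> = (2 powr (2 - b)) ^ k"
        by (simp add: powr_powr[symmetric] powr_realpow)
      finally show ?thesis by simp
    qed
    show "2 powr (2 - b) < (1::real)" using b by (simp add: powr_less_one)
  qed (use r in \<open>auto simp: c_def less_imp_le\<close>)
  finally show ?thesis .
qed

text \<open>The substitution \<open>q = p + h\<close> turns the Gagliardo seminorm into a weighted integral of translation
  differences.\<close>

lemma gagliardo_sq_eq:
  assumes [measurable]: "u \<in> borel_measurable borel"
  shows "gagliardo_sq \<sigma> u =
    (\<integral>\<^sup>+h. L2sq (\<lambda>p. u (h + p) - u p) * ennreal (1 / norm h powr (2 + 2 * \<sigma>)) \<partial>lborel)"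
proof -
  let ?b = "2 + 2 * \<sigma>"
  let ?F = "\<lambda>p q. ennreal ((norm (u p - u q))\<^sup>2 / dist p q powr ?b)"
  have "gagliardo_sq \<sigma> u = (\<integral>\<^sup>+p. \<integral>\<^sup>+q. ?F p q \<partial>lborel \<partial>lborel)"
    unfolding gagliardo_sq_def by (simp only: nn_integral_completion)
  also have "\<dots> = (\<integral>\<^sup>+p. \<integral>\<^sup>+h. ennreal ((norm (u (h + p) - u p))\<^sup>2) * ennreal (1 / norm h powr ?b) \<partial>lborel \<partial>lborel)"
  proof (rule nn_integral_cong)
    fix p
    have m: "?F p \<in> borel_measurable borel" by measurable
    have "(\<integral>\<^sup>+q. ?F p q \<partial>lborel) = (\<integral>\<^sup>+h. ?F p (p + h) \<partial>lborel)"
      using nn_integral_shift[OF m, of p] by simp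
    also have "\<dots> = (\<integral>\<^sup>+h. ennreal ((norm (u (h + p) - u p))\<^sup>2) * ennreal (1 / norm h powr ?b) \<partial>lborel)"
      by (intro nn_integral_cong)
        (simp add: dist_norm ennreal_mult[symmetric] norm_minus_commute add.commute)
    finally show "(\<integral>\<^sup>+q. ?F p q \<partial>lborel) = \<dots>" .
  qed
  also have "\<dots> = (\<integral>\<^sup>+h. \<integral>\<^sup>+p. ennreal ((norm (u (h + p) - u p))\<^sup>2) * ennreal (1 / norm h powr ?b) \<partial>lborel \<partial>lborel)"
    by (rule lborel_pair.Fubini') measurable
  also have "\<dots> = (\<integral>\<^sup>+h. L2sq (\<lambda>p. u (h + p) - u p) * ennreal (1 / norm h powr ?b) \<partial>lborel)"
    unfolding L2sq_def by (intro nn_integral_cong nn_integral_multc) measurable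
  finally show ?thesis .
qed

text \<open>The exponent \<open>2 + 2 \<sigma>\<close> of the kernel is compensated at the origin by \<open>\<bar>h\<bar> powr a\<close>, as
  \<open>a > 2 \<sigma>\<close>; at infinity square integrability of \<open>u\<close> suffices.\<close>

lemma gagliardo_finite:
  assumes u [measurable]: "u \<in> borel_measurable borel" and fin: "L2sq u < \<infinity>" and \<sigma>: "0 < \<sigma>" "2 * \<sigma> < a" and C: "0 \<le> C"
    and bound: "\<And>h. L2sq (\<lambda>p. u (h + p) - u p) \<le> ennreal (C * norm h powr a)"
  shows "gagliardo_sq \<sigma> u < \<infinity>"
proof -
  define N where "N = 2 * L2sq u + 2 * L2sq u"
  have N: "N < \<infinity>" unfolding N_def using fin
    by (simp add: ennreal_mult_eq_top_iff ennreal_add_eq_top top.not_eq_extremum[symmetric])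
  have far: "L2sq (\<lambda>p. u (h + p) - u p) \<le> N" for h
    using L2sq_add_le[of "\<lambda>p. u (h + p)" "\<lambda>p. - u p"] L2sq_shift[of u h] by (simp add: N_def)
  let ?w = "\<lambda>h::plane. ennreal (1 / norm h powr (2 + 2 * \<sigma>))"
  have "gagliardo_sq \<sigma> u \<le> (\<integral>\<^sup>+h. (ennreal (C * norm h powr a) * ?w h * indicator (cball 0 1) h) + (N * ?w h * indicator (- cball 0 1) h) \<partial>lborel)"
    unfolding gagliardo_sq_eq[OF u]
  proof (rule nn_integral_mono)
    fix h :: plane
    show "L2sq (\<lambda>p. u (h + p) - u p) * ?w h \<le> (ennreal (C * norm h powr a) * ?w h * indicator (cball 0 1) h) + (N * ?w h * indicator (- cball 0 1) h)"
      using mult_right_mono[OF bound[of h], of "?w h"] mult_right_mono[OF far[of h], of "?w h"]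
      by (auto split: split_indicator)
  qed
  also have "\<dots> = (\<integral>\<^sup>+h. ennreal (C * norm h powr a) * ?w h * indicator (cball 0 1) h \<partial>lborel) + (\<integral>\<^sup>+h. N * ?w h * indicator (- cball 0 1) h \<partial>lborel)"
    by (rule nn_integral_add) measurable
  also have "\<dots> < \<infinity>"
    using singular_kernel_near[OF C, of a "2 + 2 * \<sigma>"] singular_kernel_far[OF N, of "2 + 2 * \<sigma>"] \<sigma>
    by (simp add: ennreal_add_eq_top top.not_eq_extremum[symmetric])
  finally show ?thesis .
qed

section \<open>Functions with jumps across lines\<close>

text \<open>The condition \<open>\<parallel>u (\<cdot> + h) - u\<parallel> \<le> C \<bar>h\<bar> powr (1 / 2)\<close> in \<open>L\<^sup>2\<close>, that is, the Besov class
  \<open>B\<close> of order \<open>1 / 2\<close> with indices \<open>2\<close> and \<open>\<infinity>\<close>. It is the sharp regularity of a jump.\<close>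

definition half_holder :: "cfun \<Rightarrow> bool" where
  "half_holder u \<longleftrightarrow> (\<exists>C\<ge>0. \<forall>h. L2sq (\<lambda>p. u (h + p) - u p) \<le> ennreal (C * norm h))"

text \<open>For \<open>\<bar>h\<bar> > 1\<close> the trivial bound by the norm of \<open>u\<close> is already of the required form.\<close>

lemma half_holderI:
  assumes u [measurable]: "u \<in> borel_measurable borel" and fin: "L2sq u < \<infinity>" and C: "C \<ge> 0"
    and bound: "\<And>h. norm h \<le> 1 \<Longrightarrow> L2sq (\<lambda>p. u (h + p) - u p) \<le> ennreal (C * norm h)"
  shows "half_holder u"
proof -
  define N where "N = enn2real (2 * L2sq u + 2 * L2sq u)"
  have N: "2 * L2sq u + 2 * L2sq u = ennreal N" "N \<ge> 0" unfolding N_def using fin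
    by (auto simp: ennreal_mult_eq_top_iff ennreal_add_eq_top top.not_eq_extremum[symmetric])
  have far: "L2sq (\<lambda>p. u (h + p) - u p) \<le> ennreal N" for h
    using L2sq_add_le[of "\<lambda>p. u (h + p)" "\<lambda>p. - u p"] L2sq_shift[of u h] by (simp add: N(1)[symmetric])
  have "L2sq (\<lambda>p. u (h + p) - u p) \<le> ennreal ((C + N) * norm h)" for h
  proof (cases "norm h \<le> 1")
    case True
    from bound[OF this] show ?thesis
      by (rule order_trans) (use N in \<open>auto intro!: ennreal_leI mult_right_mono\<close>)
  next
    case False
    have "N \<le> (C + N) * norm h" using False N C by (metis add_increasing le_add_same_cancel2 less_imp_le mult_left_mono mult.right_neutral not_le order_trans add_nonneg_nonneg)
    with far[of h] show ?thesis by (meson ennreal_leI order_trans)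
  qed
  then show ?thesis unfolding half_holder_def using C N by (intro exI[of _ "C + N"]) auto
qed

lemma half_holder_add:
  assumes [measurable]: "u \<in> borel_measurable borel" "v \<in> borel_measurable borel"
    and "half_holder u" "half_holder v"
  shows "half_holder (\<lambda>p. u p + v p)"
proof -
  obtain C1 C2 where C: "C1 \<ge> 0" "C2 \<ge> 0" "\<And>h. L2sq (\<lambda>p. u (h + p) - u p) \<le> ennreal (C1 * norm h)"
    "\<And>h. L2sq (\<lambda>p. v (h + p) - v p) \<le> ennreal (C2 * norm h)"
    using assms(3,4) unfolding half_holder_def by blast
  have "L2sq (\<lambda>p. (u (h + p) + v (h + p)) - (u p + v p)) \<le> ennreal ((2 * C1 + 2 * C2) * norm h)" for h
  proof -
    have "L2sq (\<lambda>p. (u (h + p) - u p) + (v (h + p) - v p)) \<le> 2 * L2sq (\<lambda>p. u (h + p) - u p) + 2 * L2sq (\<lambda>p. v (h + p) - v p)"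
      by (rule L2sq_add_le) measurable
    also have "\<dots> \<le> 2 * ennreal (C1 * norm h) + 2 * ennreal (C2 * norm h)"
      by (intro add_mono mult_left_mono C) auto
    also have "\<dots> = ennreal (2 * (C1 * norm h)) + ennreal (2 * (C2 * norm h))" by (simp add: ennreal_mult')
    also have "\<dots> = ennreal ((2 * C1 + 2 * C2) * norm h)"
      using C by (simp add: ennreal_plus[symmetric] algebra_simps del: ennreal_plus)
    finally show ?thesis by (simp add: algebra_simps)
  qed
  then show ?thesis unfolding half_holder_def using C by (intro exI[of _ "2 * C1 + 2 * C2"]) auto
qed

lemma half_holder_uminus: "half_holder u \<Longrightarrow> half_holder (\<lambda>p. - u p)"
proof -
  have "L2sq (\<lambda>p. - u (h + p) - - u p) = L2sq (\<lambda>p. u (h + p) - u p)" for h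
    using L2sq_uminus[of "\<lambda>p. u (h + p) - u p"] by simp
  then show "half_holder u \<Longrightarrow> half_holder (\<lambda>p. - u p)" unfolding half_holder_def by simp
qed

lemma bounded_energy_half_holder:
  assumes e: "bounded_energy u" shows "half_holder u"
proof -
  have u: "u \<in> L2_compact" using e by (simp add: bounded_energy_def)
  obtain C where C: "C \<ge> 0" "\<And>h. L2sq (\<lambda>p. u (h + p) - u p) \<le> ennreal (C * (norm h)\<^sup>2)"
    using bounded_energy_difference[OF e] by blast
  show ?thesis
  proof (rule half_holderI[OF _ L2_compact_L2sq[OF u] C(1)])
    show "u \<in> borel_measurable borel" using u by measurable
    fix h :: plane assume h: "norm h \<le> 1"
    have "C * (norm h)\<^sup>2 \<le> C * norm h"
      using h C(1) by (intro mult_left_mono) (auto simp: power2_eq_square mult_left_le)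
    with C(2)[of h] show "L2sq (\<lambda>p. u (h + p) - u p) \<le> ennreal (C * norm h)"
      by (meson ennreal_leI order_trans)
  qed
qed

text \<open>Bounded parts lie on finitely many lines \<open>z \<bullet> e = c\<close>. Replacing the edges by the lines that
  carry them loses nothing, because the strip estimate is an estimate for lines.\<close>

definition on_lines :: "plane set \<Rightarrow> bool" where
  "on_lines \<Gamma> \<longleftrightarrow> (\<forall>R. \<exists>F :: (plane \<times> real) set. finite F \<and> (\<forall>x\<in>F. norm (fst x) = 1) \<and>
     (\<forall>z\<in>\<Gamma>. norm z \<le> R \<longrightarrow> (\<exists>x\<in>F. z \<bullet> fst x = snd x)))"

lemma segment_on_line: "\<exists>e c. norm (e::plane) = 1 \<and> (\<forall>z\<in>closed_segment a b. z \<bullet> e = c)"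
proof (cases "a = b")
  case True
  then show ?thesis by (intro exI[of _ "(1, 0)"] exI[of _ "a \<bullet> (1, 0)"]) (auto simp: norm_Pair)
next
  case False
  define v where "v = b - a"
  define e where "e = (1 / norm v) *\<^sub>R (- snd v, fst v)"
  have v: "norm v > 0" using False by (simp add: v_def)
  have "norm (- snd v, fst v) = norm v" by (cases v) (simp add: norm_Pair add.commute)
  then have e: "norm e = 1" using v unfolding e_def norm_scaleR by simp
  have ve: "v \<bullet> e = 0" unfolding e_def by (cases v) (simp add: inner_Pair)
  have "z \<bullet> e = a \<bullet> e" if z: "z \<in> closed_segment a b" for z
  proof -
    obtain t where "z = (1 - t) *\<^sub>R a + t *\<^sub>R b" using z unfolding closed_segment_def by blast
    then have "z = a + t *\<^sub>R v" unfolding v_def by (simp add: algebra_simps)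
    then show ?thesis by (simp add: inner_add_left ve)
  qed
  then show ?thesis using e by blast
qed

lemma piecewise_straight_on_lines:
  assumes "piecewise_straight_boundary A" shows "on_lines (frontier A)"
  unfolding on_lines_def
proof
  fix R
  obtain E where E: "finite E" "frontier A \<inter> cball 0 R = (\<Union>(a, b)\<in>E. closed_segment a b)"
    using assms unfolding piecewise_straight_boundary_def by blast
  obtain e c where ec: "\<And>a b. norm (e a b :: plane) = 1" "\<And>a b z. z \<in> closed_segment a b \<Longrightarrow> z \<bullet> e a b = (c a b :: real)"
    using segment_on_line by metis
  show "\<exists>F. finite F \<and> (\<forall>x\<in>F. norm (fst x) = 1) \<and>
     (\<forall>z\<in>frontier A. norm z \<le> R \<longrightarrow> (\<exists>x\<in>F. z \<bullet> fst x = snd x))"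
  proof (intro exI[of _ "(\<lambda>(a, b). (e a b, c a b)) ` E"] conjI ballI impI)
    fix z assume "z \<in> frontier A" "norm z \<le> R"
    then have "z \<in> (\<Union>(a, b)\<in>E. closed_segment a b)" unfolding E(2)[symmetric] by simp
    then obtain a b where "(a, b) \<in> E" "z \<in> closed_segment a b" by blast
    then show "\<exists>x\<in>(\<lambda>(a, b). (e a b, c a b)) ` E. z \<bullet> fst x = snd x"
      using ec(2)[of z a b] by (intro bexI[of _ "(e a b, c a b)"] image_eqI[of _ _ "(a, b)"]) simp_all
  qed (use E ec in auto)
qed

lemma on_lines_Union:
  assumes "finite I" "\<And>i. i \<in> I \<Longrightarrow> on_lines (\<Gamma> i)" shows "on_lines (\<Union>i\<in>I. \<Gamma> i)"
  unfolding on_lines_def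
proof
  fix R :: real
  define Q where "Q i F \<longleftrightarrow> finite F \<and> (\<forall>x\<in>F. norm (fst x) = 1) \<and>
     (\<forall>z\<in>\<Gamma> i. norm z \<le> R \<longrightarrow> (\<exists>x\<in>F. z \<bullet> fst x = snd x))" for i F
  have "\<forall>i\<in>I. \<exists>F. Q i F"
    using assms(2) unfolding on_lines_def Q_def by (intro ballI) (rule spec)
  from bchoice[OF this] obtain F where F: "\<And>i. i \<in> I \<Longrightarrow> Q i (F i)" by blast
  show "\<exists>F. finite F \<and> (\<forall>x\<in>F. norm (fst x) = 1) \<and>
     (\<forall>z\<in>\<Union>i\<in>I. \<Gamma> i. norm z \<le> R \<longrightarrow> (\<exists>x\<in>F. z \<bullet> fst x = snd x))"
  proof (intro exI[of _ "\<Union>i\<in>I. F i"] conjI ballI impI)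
    show "finite (\<Union>i\<in>I. F i)" using assms(1) F unfolding Q_def by simp
    show "norm (fst x) = 1" if x: "x \<in> (\<Union>i\<in>I. F i)" for x
    proof -
      obtain i where "i \<in> I" "x \<in> F i" using x by blast
      then show ?thesis using F[of i] unfolding Q_def by simp
    qed
    fix z assume "z \<in> (\<Union>i\<in>I. \<Gamma> i)" and zR: "norm z \<le> R"
    then obtain i where i: "i \<in> I" "z \<in> \<Gamma> i" by blast
    have "\<exists>x\<in>F i. z \<bullet> fst x = snd x" using F[OF i(1)] i(2) zR unfolding Q_def by simp
    then obtain x where "x \<in> F i" "z \<bullet> fst x = snd x" ..
    then show "\<exists>x\<in>\<Union>i\<in>I. F i. z \<bullet> fst x = snd x" using i(1) by (intro bexI[of _ x]) auto
  qed
qed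

lemma on_lines_negligible:
  assumes "on_lines \<Gamma>" shows "negligible \<Gamma>"
proof -
  have "negligible (\<Gamma> \<inter> cball 0 (real n))" for n
  proof -
    obtain F where F: "finite F" "\<forall>x\<in>F. norm (fst x) = 1"
      "\<forall>z\<in>\<Gamma>. norm z \<le> real n \<longrightarrow> (\<exists>x\<in>F. z \<bullet> fst x = snd x)"
      using assms[unfolded on_lines_def, THEN spec, of "real n"] by (elim exE conjE)
    have "negligible (\<Union>x\<in>F. {z. fst x \<bullet> z = snd x})"
    proof (rule negligible_Union[OF finite_imageI[OF F(1)]])
      fix T assume "T \<in> (\<lambda>x. {z. fst x \<bullet> z = snd x}) ` F"
      then obtain x where "x \<in> F" "T = {z. fst x \<bullet> z = snd x}" by blast
      then show "negligible T" using F(2) by (metis negligible_hyperplane norm_zero zero_neq_one)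
    qed
    moreover have "\<Gamma> \<inter> cball 0 (real n) \<subseteq> (\<Union>x\<in>F. {z. fst x \<bullet> z = snd x})"
    proof
      fix z assume "z \<in> \<Gamma> \<inter> cball 0 (real n)"
      then have "\<exists>x\<in>F. z \<bullet> fst x = snd x" using F(3) by simp
      then show "z \<in> (\<Union>x\<in>F. {z. fst x \<bullet> z = snd x})" by (simp add: inner_commute)
    qed
    ultimately show ?thesis by (rule negligible_subset)
  qed
  then have "negligible (\<Union>n::nat. \<Gamma> \<inter> cball 0 (real n))" by (intro negligible_countable_Union) auto
  moreover have "\<Gamma> \<subseteq> (\<Union>n::nat. \<Gamma> \<inter> cball 0 (real n))"
  proof
    fix z assume z: "z \<in> \<Gamma>"
    obtain n :: nat where "norm z \<le> real n" using real_arch_simple by blast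
    with z show "z \<in> (\<Union>n::nat. \<Gamma> \<inter> cball 0 (real n))" by auto
  qed
  ultimately show ?thesis by (rule negligible_subset)
qed

text \<open>Write the difference as \<open>m (h + p) (W (h + p) - W p) + (m (h + p) - m p) W p\<close>. The first term is
  of order \<open>\<bar>h\<bar>\<close> in the norm. The second lives where the segment from \<open>p\<close> to \<open>p + h\<close> crosses the
  interface, hence in strips of width \<open>\<bar>h\<bar>\<close> around finitely many lines, where the squared norm of \<open>W\<close>
  is of order \<open>\<bar>h\<bar>\<close>.\<close>

lemma jump_multiplier_half_holder:
  fixes m :: "plane \<Rightarrow> real"
  assumes e: "bounded_energy W" and m [measurable]: "m \<in> borel_measurable borel" and B: "\<And>p. \<bar>m p\<bar> \<le> B"
    and \<Gamma>: "on_lines \<Gamma>" and jump: "\<And>p q. m p \<noteq> m q \<Longrightarrow> closed_segment p q \<inter> \<Gamma> \<noteq> {}"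
  shows "half_holder (\<lambda>p. of_real (m p) * W p)"
proof -
  have W: "W \<in> L2_compact" using e by (simp add: bounded_energy_def)
  have Wm [measurable]: "W \<in> borel_measurable borel" using W by measurable
  have B0: "B \<ge> 0" using order_trans[OF abs_ge_zero B] .
  obtain R where R: "\<And>p. norm p > R \<Longrightarrow> W p = 0" using W by (auto simp: L2_compact_def)
  obtain C1 where C1: "C1 \<ge> 0" "\<And>h. L2sq (\<lambda>p. W (h + p) - W p) \<le> ennreal (C1 * (norm h)\<^sup>2)"
    using bounded_energy_difference[OF e] by blast
  obtain C2 where C2: "C2 \<ge> 0" "\<And>e c d. norm e = 1 \<Longrightarrow> d \<ge> 0 \<Longrightarrow>
    (\<integral>\<^sup>+p. indicator {p. \<bar>p \<bullet> e - c\<bar> \<le> d} p * ennreal ((norm (W p))\<^sup>2) \<partial>lborel) \<le> ennreal (C2 * d)"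
    using bounded_energy_strip[OF e] by blast
  obtain F where F: "finite F" "\<forall>x\<in>F. norm (fst x) = 1"
      "\<forall>z\<in>\<Gamma>. norm z \<le> R + 1 \<longrightarrow> (\<exists>x\<in>F. z \<bullet> fst x = snd x)"
    using \<Gamma>[unfolded on_lines_def, THEN spec, of "R + 1"] by (elim exE conjE)
  have mW: "(\<lambda>p. of_real (m p) * W p) \<in> L2_compact"
    by (rule L2_compact_bounded_mult[OF W, where B = B]) (use B in auto)
  define S where "S h x = {p. \<bar>p \<bullet> fst x - snd x\<bar> \<le> norm h}" for h :: plane and x :: "plane \<times> real"
  have Sb [measurable]: "S h x \<in> sets borel" for h x
    unfolding S_def by (intro borel_closed closed_Collect_le continuous_intros)
  define K where "K = 2 * (B\<^sup>2 * C1) + 2 * (\<Sum>x\<in>F. (2 * B)\<^sup>2 * C2)"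
  show ?thesis
  proof (rule half_holderI[OF _ L2_compact_L2sq[OF mW], of K])
    show "(\<lambda>p. of_real (m p) * W p) \<in> borel_measurable borel" by measurable
    show "K \<ge> 0" unfolding K_def using C1(1) C2(1) by (intro add_nonneg_nonneg mult_nonneg_nonneg sum_nonneg) auto
    fix h :: plane assume h: "norm h \<le> 1"
    let ?u = "\<lambda>p. of_real (m (h + p)) * (W (h + p) - W p) :: complex"
    let ?v = "\<lambda>p. (of_real (m (h + p)) - of_real (m p)) * W p :: complex"
    have "L2sq (\<lambda>p. of_real (m (h + p)) * W (h + p) - of_real (m p) * W p) = L2sq (\<lambda>p. ?u p + ?v p)"
      by (simp add: algebra_simps)
    also have "\<dots> \<le> 2 * L2sq ?u + 2 * L2sq ?v" by (rule L2sq_add_le) measurable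
    also have "L2sq ?u \<le> ennreal (B\<^sup>2) * L2sq (\<lambda>p. W (h + p) - W p)"
      by (rule L2sq_bounded_mult) (use B in auto)
    also have "\<dots> \<le> ennreal (B\<^sup>2) * ennreal (C1 * (norm h)\<^sup>2)" by (intro mult_left_mono C1) auto
    also have "\<dots> \<le> ennreal (B\<^sup>2 * C1 * norm h)"
    proof -
      have "C1 * (norm h)\<^sup>2 \<le> C1 * norm h"
        using h C1(1) by (intro mult_left_mono) (auto simp: power2_eq_square mult_left_le)
      then show ?thesis using C1(1)
        by (subst ennreal_mult[symmetric]) (auto intro!: ennreal_leI mult_left_mono simp: mult.assoc)
    qed
    also have "L2sq ?v \<le> ennreal ((\<Sum>x\<in>F. (2 * B)\<^sup>2 * C2) * norm h)"
    proof -
      have "L2sq ?v \<le> (\<integral>\<^sup>+p. (\<Sum>x\<in>F. ennreal ((2 * B)\<^sup>2) * (indicator (S h x) p * ennreal ((norm (W p))\<^sup>2))) \<partial>lborel)"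
        unfolding L2sq_def
      proof (rule nn_integral_mono)
        fix p
        show "ennreal ((norm (?v p))\<^sup>2) \<le> (\<Sum>x\<in>F. ennreal ((2 * B)\<^sup>2) * (indicator (S h x) p * ennreal ((norm (W p))\<^sup>2)))"
        proof (cases "m (h + p) = m p \<or> norm p > R")
          case True
          then have "?v p = 0" using R[of p] by auto
          then show ?thesis by (simp only: norm_zero zero_power2 ennreal_0 zero_le)
        next
          case False
          \<comment> \<open>The crossing point stays in the disc of radius \<open>R + 1\<close>, on which \<open>F\<close> lists the lines.\<close>
          then obtain z where z: "z \<in> closed_segment p (h + p)" "z \<in> \<Gamma>"
            using jump[of p "h + p"] by (metis IntE ex_in_conv)
          have zp: "norm (p - z) \<le> norm h"
            using segment_bound(1)[OF z(1)] by (simp add: norm_minus_commute)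
          have "norm z \<le> R + 1" using zp h False norm_triangle_ineq2[of z p] by (simp add: norm_minus_commute)
          then obtain x where x: "x \<in> F" "z \<bullet> fst x = snd x" using F(3) z(2) by blast
          have nx: "norm (fst x) = 1" using F(2) x(1) by auto
          have "\<bar>p \<bullet> fst x - snd x\<bar> = \<bar>(p - z) \<bullet> fst x\<bar>" using x(2) by (simp add: inner_diff_left)
          also have "\<dots> \<le> norm (p - z) * norm (fst x)" by (rule Cauchy_Schwarz_ineq2)
          finally have pS: "p \<in> S h x" unfolding S_def using zp nx by simp
          have "norm (of_real (m (h + p)) - of_real (m p) :: complex) \<le> 2 * B"
            using B[of "h + p"] B[of p] norm_triangle_ineq4[of "of_real (m (h + p)) :: complex" "of_real (m p)"] by simp
          then have "(norm (?v p))\<^sup>2 \<le> (2 * B)\<^sup>2 * (norm (W p))\<^sup>2"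
            unfolding norm_mult power_mult_distrib[of "norm (of_real (m (h + p)) - of_real (m p) :: complex)"]
            by (intro mult_right_mono power_mono) auto
          then have "ennreal ((norm (?v p))\<^sup>2) \<le> ennreal ((2 * B)\<^sup>2) * (indicator (S h x) p * ennreal ((norm (W p))\<^sup>2))"
            using pS by (simp add: ennreal_mult[symmetric] ennreal_leI)
          also have "\<dots> \<le> (\<Sum>x\<in>F. ennreal ((2 * B)\<^sup>2) * (indicator (S h x) p * ennreal ((norm (W p))\<^sup>2)))"
            by (rule member_le_sum[OF x(1) _ F(1)]) auto
          finally show ?thesis .
        qed
      qed
      also have "\<dots> = (\<Sum>x\<in>F. ennreal ((2 * B)\<^sup>2) * (\<integral>\<^sup>+p. indicator (S h x) p * ennreal ((norm (W p))\<^sup>2) \<partial>lborel))"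
        by (subst nn_integral_sum) (auto simp: nn_integral_cmult)
      also have "\<dots> \<le> (\<Sum>x\<in>F. ennreal ((2 * B)\<^sup>2) * ennreal (C2 * norm h))"
      proof (intro sum_mono mult_left_mono)
        fix x assume "x \<in> F"
        then have "norm (fst x) = 1" using F(2) by auto
        from C2(2)[OF this norm_ge_zero[of h], of "snd x"]
        show "(\<integral>\<^sup>+p. indicator (S h x) p * ennreal ((norm (W p))\<^sup>2) \<partial>lborel) \<le> ennreal (C2 * norm h)"
          unfolding S_def .
      qed auto
      also have "\<dots> = ennreal ((\<Sum>x\<in>F. (2 * B)\<^sup>2 * C2) * norm h)"
      proof -
        have "ennreal ((2 * B)\<^sup>2) * ennreal (C2 * norm h) = ennreal ((2 * B)\<^sup>2 * C2 * norm h)"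
          using C2(1) by (subst ennreal_mult[symmetric]) (auto simp: mult.assoc)
        then show ?thesis
          using C2(1) unfolding sum_distrib_right by (simp only:) (intro sum_ennreal, simp)
      qed
      finally show ?thesis .
    qed
    also have "2 * ennreal (B\<^sup>2 * C1 * norm h) + 2 * ennreal ((\<Sum>x\<in>F. (2 * B)\<^sup>2 * C2) * norm h) =
        ennreal (2 * (B\<^sup>2 * C1 * norm h)) + ennreal (2 * ((\<Sum>x\<in>F. (2 * B)\<^sup>2 * C2) * norm h))"
      by (simp only: ennreal_mult' ennreal_numeral zero_le_numeral)
    also have "\<dots> = ennreal (K * norm h)"
      unfolding K_def using C1(1) C2(1)
      by (subst ennreal_plus[symmetric]) (auto intro!: mult_nonneg_nonneg sum_nonneg simp: algebra_simps)
    finally show "L2sq (\<lambda>p. of_real (m (h + p)) * W (h + p) - of_real (m p) * W p) \<le> ennreal (K * norm h)"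
      by (simp add: add_mono mult_left_mono)
  qed
qed

section \<open>Membership in Sobolev spaces\<close>

text \<open>The translation differences are of order \<open>\<bar>h\<bar>\<close>, which beats every kernel of order \<open>s < 1\<close>.\<close>

lemma sobolev_below_one:
  assumes s: "0 \<le> s" "s < 1" and u: "u \<in> L2" and u': "u' \<in> borel_measurable borel" "AE p in lborel. u p = u' p"
    and e: "bounded_energy u'"
  shows "u \<in> sobolev s"
proof -
  have um: "u \<in> borel_measurable lebesgue" using u by (simp add: L2_def)
  have "u' \<in> L2_compact" using e by (simp add: bounded_energy_def)
  then have fin: "L2sq u' < \<infinity>" by (rule L2_compact_L2sq)
  have u'2: "u' \<in> L2" by (rule L2_I[OF borel_lebesgue u'(1) _ fin]) (simp_all add: u'(1))
  have eq: "regular u =\<^sub>D regular u'"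
    unfolding distr_eq_def using regular_representative[OF um u'] regular_borel[OF u'(1)] by simp
  have fl: "\<lfloor>s\<rfloor> = 0" using s by (simp add: floor_eq_iff)
  have g: "0 < s \<Longrightarrow> gagliardo_sq s u' < \<infinity>"
  proof -
    assume s0: "0 < s"
    obtain C where C: "C \<ge> 0" "\<And>h. L2sq (\<lambda>p. u' (h + p) - u' p) \<le> ennreal (C * (norm h)\<^sup>2)"
      using bounded_energy_difference[OF e] by blast
    have sq: "norm h powr 2 = (norm h)\<^sup>2" for h :: plane
      by (cases "h = 0") (auto simp: powr_numeral)
    have "L2sq (\<lambda>p. u' (h + p) - u' p) \<le> ennreal (C * norm h powr 2)" for h
      unfolding sq by (rule C(2))
    from gagliardo_finite[OF u'(1) fin s0 _ C(1) this] s show ?thesis by simp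
  qed
  have fr: "frac s = s" by (simp add: frac_def fl)
  show ?thesis
    unfolding sobolev_def mem_Collect_eq fl fr
  proof (intro conjI allI impI u)
    fix i j :: nat assume "i + j \<le> nat 0"
    then have "i = 0" "j = 0" by auto
    then show "\<exists>g\<in>L2. (dx ^^ i) ((dy ^^ j) (regular u)) =\<^sub>D regular g \<and>
        (i + j = nat 0 \<and> 0 < s \<longrightarrow> gagliardo_sq s g < \<infinity>)"
      using u'2 eq g by (intro bexI[of _ u']) auto
  qed
qed

lemma sobolev_above_one:
  assumes s: "1 < s" "s < 3 / 2" and u: "u \<in> L2" and u': "u' \<in> borel_measurable borel" "AE p in lborel. u p = u' p"
    and g: "gx \<in> L2_compact" "gy \<in> L2_compact" "half_holder gx" "half_holder gy"
    and w: "weak_div u' (\<lambda>_. 0) gx" "weak_div (\<lambda>_. 0) u' gy"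
  shows "u \<in> sobolev s"
proof -
  have um: "u \<in> borel_measurable lebesgue" using u by (simp add: L2_def)
  have gm: "gx \<in> borel_measurable borel" "gy \<in> borel_measurable borel" using g by auto
  have g2: "v \<in> L2" if "v \<in> L2_compact" for v
    by (rule L2_I[of v v]) (use that in \<open>auto intro: borel_lebesgue simp: L2_compact_def\<close>)
  have eqx: "dx (regular u) =\<^sub>D regular gx"
    unfolding distr_eq_def dx_def
    using w(1) regular_representative[OF um u'] regular_borel[OF gm(1)] test_fun_dir_deriv
    by (simp add: weak_div_def)
  have eqy: "dy (regular u) =\<^sub>D regular gy"
    unfolding distr_eq_def dy_def
    using w(2) regular_representative[OF um u'] regular_borel[OF gm(2)] test_fun_dir_deriv
    by (simp add: weak_div_def)
  have fl: "\<lfloor>s\<rfloor> = 1" using s by (simp add: floor_eq_iff)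
  have fr: "frac s = s - 1" by (simp add: frac_def fl)
  have gag: "gagliardo_sq (s - 1) v < \<infinity>" if v: "v \<in> L2_compact" "half_holder v" for v
  proof -
    obtain C where C: "C \<ge> 0" "\<And>h. L2sq (\<lambda>p. v (h + p) - v p) \<le> ennreal (C * norm h)"
      using v(2) unfolding half_holder_def by blast
    have "L2sq (\<lambda>p. v (h + p) - v p) \<le> ennreal (C * norm h powr 1)" for h using C(2)[of h] by simp
    from gagliardo_finite[OF _ L2_compact_L2sq[OF v(1)] _ _ C(1) this] s v(1) show ?thesis by auto
  qed
  show ?thesis
    unfolding sobolev_def mem_Collect_eq fl fr
  proof (intro conjI allI impI u)
    fix i j :: nat assume "i + j \<le> nat 1"
    then consider "i = 0" "j = 0" | "i = 1" "j = 0" | "i = 0" "j = 1" by force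
    then show "\<exists>g\<in>L2. (dx ^^ i) ((dy ^^ j) (regular u)) =\<^sub>D regular g \<and>
        (i + j = nat 1 \<and> 0 < s - 1 \<longrightarrow> gagliardo_sq (s - 1) g < \<infinity>)"
    proof cases
      case 1 then show ?thesis using u by (intro bexI[of _ u]) (auto simp: distr_eq_def)
    next
      case 2 then show ?thesis using eqx gag[OF g(1,3)] g2[OF g(1)] by (intro bexI[of _ gx]) auto
    next
      case 3 then show ?thesis using eqy gag[OF g(2,4)] g2[OF g(2)] by (intro bexI[of _ gy]) auto
    qed
  qed
qed

section \<open>Regularity for the div-curl system\<close>

text \<open>The two equations say that the field \<open>(- d, w)\<close> has divergence \<open>F\<close> and curl \<open>G\<close>. Localising with \<open>f\<close>
  adds terms of order zero, so the energy estimate applies to \<open>(- f d, f w)\<close>.\<close>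

lemma bounded_energy_from_system:
  assumes L: "w \<in> L2_local" "d \<in> L2_local" "F \<in> L2_local" "G \<in> L2_local"
    and sys: "weak_div (\<lambda>p. - d p) w F" "weak_div w d G" and f: "test_fun f"
  shows "bounded_energy (\<lambda>p. f p * w p)" "bounded_energy (\<lambda>p. f p * d p)"
proof -
  note md = L2_local_uminus[OF L(2)]
  note tf = f test_fun_dir_deriv[OF f]
  define D where "D p = f p * F p + (Dx f p * - d p + Dy f p * w p)" for p
  define K where "K p = f p * G p + (Dx f p * w p + Dy f p * d p)" for p
  have DK: "D \<in> L2_compact" "K \<in> L2_compact"
    unfolding D_def K_def by (intro L2_compact_add L2_local_test_fun L md tf)+
  have wD: "weak_div (\<lambda>p. f p * - d p) (\<lambda>p. f p * w p) D"
    unfolding D_def by (rule weak_div_localize[OF sys(1) md L(1) L(3) f])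
  have wK: "weak_div (\<lambda>p. f p * w p) (\<lambda>p. - (f p * - d p)) K"
    unfolding K_def using weak_div_localize[OF sys(2) L(1,2,4) f] by simp
  have c: "(\<lambda>p. f p * - d p) \<in> L2_compact" "(\<lambda>p. f p * w p) \<in> L2_compact" "(\<lambda>p. f p * d p) \<in> L2_compact"
    by (intro L2_local_test_fun L md f)+
  note en = energy_conv[OF c(1,2) DK wD wK]
  have fin: "L2sq D + L2sq K < \<infinity>"
    using DK[THEN L2_compact_L2sq] by (simp add: ennreal_add_eq_top top.not_eq_extremum[symmetric])
  show "bounded_energy (\<lambda>p. f p * w p)"
    unfolding bounded_energy_def
  proof (intro conjI exI[of _ "L2sq D + L2sq K"] allI c fin)
    fix k
    show "L2sq (Dx (conv (\<lambda>p. f p * w p) (moll k))) + L2sq (Dy (conv (\<lambda>p. f p * w p) (moll k))) \<le> L2sq D + L2sq K"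
      by (rule order_trans[OF _ en[of k]]) (simp add: add_increasing add.assoc)
  qed
  have neg: "L2sq (dir_deriv v (conv (\<lambda>p. f p * - d p) (moll k))) = L2sq (dir_deriv v (conv (\<lambda>p. f p * d p) (moll k)))" for v k
  proof -
    have "dir_deriv v (conv (\<lambda>p. f p * - d p) (moll k)) = conv (\<lambda>p. f p * - d p) (dir_deriv v (moll k))"
      by (rule conv_dir_deriv[OF L2_compact_integrable[OF c(1)] moll_test_fun])
    also have "\<dots> = (\<lambda>p. - conv (\<lambda>p. f p * d p) (dir_deriv v (moll k)) p)"
      using conv_uminus[of "\<lambda>p. f p * d p"] by simp
    also have "conv (\<lambda>p. f p * d p) (dir_deriv v (moll k)) = dir_deriv v (conv (\<lambda>p. f p * d p) (moll k))"
      by (rule conv_dir_deriv[OF L2_compact_integrable[OF c(3)] moll_test_fun, symmetric])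
    finally show ?thesis by simp
  qed
  show "bounded_energy (\<lambda>p. f p * d p)"
    unfolding bounded_energy_def
  proof (intro conjI exI[of _ "L2sq D + L2sq K"] allI c fin)
    fix k
    show "L2sq (Dx (conv (\<lambda>p. f p * d p) (moll k))) + L2sq (Dy (conv (\<lambda>p. f p * d p) (moll k))) \<le> L2sq D + L2sq K"
      unfolding neg[symmetric] by (rule order_trans[OF _ en[of k]]) (simp add: add_increasing2 add.assoc)
  qed
qed

text \<open>The field \<open>(f a, f b)\<close> has curl \<open>m f w\<close> and divergence \<open>f d\<close>, up to products of \<open>a\<close>, \<open>b\<close> with
  derivatives of \<open>f\<close>. Everything here is in \<open>H\<^sup>1\<close> except for the jumps of \<open>m\<close>, so divergence and curl
  are \<open>half_holder\<close>, and the gradient inherits this.\<close>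

lemma gradients_half_holder:
  fixes m :: "plane \<Rightarrow> real"
  assumes L: "w \<in> L2_local" "d \<in> L2_local" "F \<in> L2_local" "G \<in> L2_local"
    and sys: "weak_div (\<lambda>p. - d p) w F" "weak_div w d G"
    and H: "a \<in> L2_local" "b \<in> L2_local" "a1 \<in> L2_local" "a2 \<in> L2_local" "b1 \<in> L2_local" "b2 \<in> L2_local"
    and grad: "weak_div a (\<lambda>_. 0) a1" "weak_div (\<lambda>_. 0) a a2" "weak_div b (\<lambda>_. 0) b1" "weak_div (\<lambda>_. 0) b b2"
    and div: "weak_div a b d" and curl: "weak_div b (\<lambda>p. - a p) (\<lambda>p. of_real (m p) * w p)"
    and m: "m \<in> borel_measurable borel" "\<And>p. \<bar>m p\<bar> \<le> B"
    and \<Gamma>: "on_lines \<Gamma>" "\<And>p q. m p \<noteq> m q \<Longrightarrow> closed_segment p q \<inter> \<Gamma> \<noteq> {}"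
    and f: "test_fun f"
    and g: "g \<in> L2_compact"
      "weak_div (\<lambda>p. f p * a p) (\<lambda>_. 0) g \<or> weak_div (\<lambda>_. 0) (\<lambda>p. f p * a p) g \<or>
       weak_div (\<lambda>p. f p * b p) (\<lambda>_. 0) g \<or> weak_div (\<lambda>_. 0) (\<lambda>p. f p * b p) g"
  shows "half_holder g"
proof -
  note tf = f test_fun_dir_deriv[OF f]
  have mw: "(\<lambda>p. of_real (m p) * w p) \<in> L2_local"
    by (rule L2_local_bounded_mult[OF L(1), where B = B]) (use m in auto)
  define D where "D p = f p * d p + (Dx f p * a p + Dy f p * b p)" for p
  define K where "K p = f p * (of_real (m p) * w p) + (Dx f p * b p + Dy f p * - a p)" for p
  have DK: "D \<in> L2_compact" "K \<in> L2_compact"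
    unfolding D_def K_def by (intro L2_compact_add L2_local_test_fun L H mw L2_local_uminus tf)+
  have wD: "weak_div (\<lambda>p. f p * a p) (\<lambda>p. f p * b p) D"
    unfolding D_def by (rule weak_div_localize[OF div H(1,2) L(2) f])
  have wK: "weak_div (\<lambda>p. f p * b p) (\<lambda>p. - (f p * a p)) K"
    unfolding K_def using weak_div_localize[OF curl H(2) L2_local_uminus[OF H(1)] mw f] by simp
  have c: "(\<lambda>p. f p * a p) \<in> L2_compact" "(\<lambda>p. f p * b p) \<in> L2_compact"
    by (intro L2_local_test_fun H f)+
  have meas: "(\<lambda>p. h p * u p) \<in> borel_measurable borel" if "test_fun h" "u \<in> L2_local" for h u
    using L2_local_test_fun[OF that(2,1)] by (rule L2_compact_measurable)
  have ha: "half_holder (\<lambda>p. h p * a p)" if "test_fun h" for h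
    by (intro bounded_energy_half_holder bounded_energy_localize[OF H(1,3,4) grad(1,2) that])
  have hb: "half_holder (\<lambda>p. h p * b p)" if "test_fun h" for h
    by (intro bounded_energy_half_holder bounded_energy_localize[OF H(2,5,6) grad(3,4) that])
  note be = bounded_energy_from_system[OF L sys f]
  have "half_holder (\<lambda>p. of_real (m p) * (f p * w p))"
    by (rule jump_multiplier_half_holder[OF be(1) m \<Gamma>])
  then have hmw: "half_holder (\<lambda>p. f p * (of_real (m p) * w p))" by (simp add: mult.left_commute)
  have hD: "half_holder D"
    unfolding D_def
    by (intro half_holder_add borel_measurable_add meas L H tf ha hb bounded_energy_half_holder[OF be(2)])
  have "half_holder (\<lambda>p. - (Dy f p * a p))" by (intro half_holder_uminus ha tf)
  then have hK: "half_holder K"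
    unfolding K_def
    by (intro half_holder_add borel_measurable_add meas mw H L2_local_uminus tf hb hmw) simp
  obtain C1 C2 where C: "C1 \<ge> 0" "\<And>h. L2sq (\<lambda>p. D (h + p) - D p) \<le> ennreal (C1 * norm h)"
    "C2 \<ge> 0" "\<And>h. L2sq (\<lambda>p. K (h + p) - K p) \<le> ennreal (C2 * norm h)"
    using hD hK unfolding half_holder_def by blast
  have "L2sq (\<lambda>p. g (h + p) - g p) \<le> ennreal ((C1 + C2) * norm h)" for h
  proof -
    have "L2sq (\<lambda>p. g (h + p) - g p) \<le> L2sq (\<lambda>p. D (h + p) - D p) + L2sq (\<lambda>p. K (h + p) - K p)"
      by (rule gradient_difference[OF c DK wD wK g])
    also have "\<dots> \<le> ennreal (C1 * norm h) + ennreal (C2 * norm h)" by (intro add_mono C)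
    also have "\<dots> = ennreal ((C1 + C2) * norm h)"
      using C(1,3) by (simp add: ennreal_plus[symmetric] distrib_right del: ennreal_plus)
    finally show ?thesis .
  qed
  then show ?thesis unfolding half_holder_def using C by (intro exI[of _ "C1 + C2"]) auto
qed

section \<open>Piecewise constant coefficients\<close>

text \<open>Away from the union \<open>\<Gamma>\<close> of the boundaries, a null set, every point belongs to exactly one
  subdomain. A function that is constant on each subdomain hence agrees almost everywhere with a
  finite sum of indicators, which is bounded and Borel. If it takes different values at two points, one
  of them lies in some subdomain and the other does not, so the segment between them meets \<open>\<Gamma>\<close>.\<close>

lemma partition_coefficients:
  fixes n :: "plane \<Rightarrow> real" and \<phi> :: "real \<Rightarrow> real"
  assumes P: "periodic_polygonal_partition K J P"
    and n: "\<forall>j\<in>{1..J}. \<exists>c. \<forall>p\<in>P j. n p = c"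
  obtains \<Gamma> m m' B where "on_lines \<Gamma>" "m \<in> borel_measurable borel" "m' \<in> borel_measurable borel"
    "\<forall>p. \<bar>m p\<bar> \<le> B" "\<forall>p. \<bar>m' p\<bar> \<le> B"
    "\<forall>p q. m p \<noteq> m q \<longrightarrow> closed_segment p q \<inter> \<Gamma> \<noteq> {}"
    "AE p in lborel. m p = (n p)\<^sup>2" "AE p in lborel. 1 / (n p)\<^sup>2 = m' p"
proof -
  from n obtain c where c: "\<And>j p. j \<in> {1..J} \<Longrightarrow> p \<in> P j \<Longrightarrow> n p = c j" by metis
  have disj: "disjoint_family_on P {1..J}" and cl: "closure (\<Union>j\<in>{1..J}. P j) = UNIV"
    and op: "\<And>j. j \<in> {1..J} \<Longrightarrow> open (P j)" and ps: "\<And>j. j \<in> {1..J} \<Longrightarrow> piecewise_straight_boundary (P j)"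
    using P unfolding periodic_polygonal_partition_def lipschitz_open_set_def by auto
  define \<Gamma> where "\<Gamma> = (\<Union>j\<in>{1..J}. frontier (P j))"
  have \<Gamma>: "on_lines \<Gamma>" unfolding \<Gamma>_def by (intro on_lines_Union piecewise_straight_on_lines ps) auto
  define M where "M g p = (\<Sum>j\<in>{1..J}. indicator (P j) p * g (c j))" for g :: "real \<Rightarrow> real" and p
  have [measurable]: "P j \<in> sets borel" if "j \<in> {1..J}" for j using op[OF that] by (rule borel_open)
  have Mm: "M g \<in> borel_measurable borel" for g
    unfolding M_def by (intro borel_measurable_sum borel_measurable_times borel_measurable_indicator) auto
  have Mb: "\<bar>M g p\<bar> \<le> (\<Sum>j\<in>{1..J}. \<bar>g (c j)\<bar>)" for g p
    unfolding M_def by (rule order_trans[OF sum_abs sum_mono]) (auto simp: abs_mult split: split_indicator)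
  have Mv: "M g p = g (n p)" if j: "j \<in> {1..J}" "p \<in> P j" for g p j
  proof -
    have "indicator (P i) p * g (c i) = (if i = j then g (c j) else 0)" if i: "i \<in> {1..J}" for i
    proof (cases "i = j")
      case False
      then have "P i \<inter> P j = {}" using disj i j(1) unfolding disjoint_family_on_def by blast
      then have "p \<notin> P i" using j(2) by blast
      then show ?thesis using False by simp
    qed (use j in simp)
    then have "M g p = (\<Sum>i\<in>{1..J}. if i = j then g (c j) else 0)" unfolding M_def by (rule sum.cong[OF refl])
    also have "\<dots> = g (n p)" using j c[OF j] by simp
    finally show ?thesis .
  qed
  \<comment> \<open>The closure of a finite union is the union of the closures.\<close>
  have cover: "p \<in> \<Gamma> \<or> (\<exists>j\<in>{1..J}. p \<in> P j)" for p
  proof -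
    have "closure (\<Union>j\<in>{1..J}. P j) \<subseteq> (\<Union>j\<in>{1..J}. closure (P j))"
      by (intro closure_minimal closed_UN UN_mono closure_subset) auto
    then have "p \<in> (\<Union>j\<in>{1..J}. closure (P j))" using cl by blast
    then show ?thesis unfolding \<Gamma>_def frontier_def using op by (auto simp: interior_open)
  qed
  have "AE p in lborel. p \<notin> \<Gamma>"
    using on_lines_negligible[OF \<Gamma>] by (metis AE_completion_iff AE_not_in negligible_iff_null_sets)
  then have AEM: "AE p in lborel. M g p = g (n p)" for g
    by eventually_elim (use cover Mv in blast)
  have jump: "closed_segment p q \<inter> \<Gamma> \<noteq> {}" if "M g p \<noteq> M g q" for g p q
  proof -
    have "\<exists>j\<in>{1..J}. (p \<in> P j) \<noteq> (q \<in> P j)"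
    proof (rule ccontr)
      assume "\<not> ?thesis"
      then have "M g p = M g q" unfolding M_def by (intro sum.cong refl) (auto simp: indicator_def)
      with that show False by simp
    qed
    then obtain j where j: "j \<in> {1..J}" "(p \<in> P j) \<noteq> (q \<in> P j)" by blast
    have "closed_segment p q \<inter> frontier (P j) \<noteq> {}"
    proof (rule connected_Int_frontier)
      show "connected (closed_segment p q)" by (rule connected_segment)
      show "closed_segment p q \<inter> P j \<noteq> {}" using j(2) ends_in_segment[of p q] by blast
      show "closed_segment p q - P j \<noteq> {}" using j(2) ends_in_segment[of p q] by blast
    qed
    then show ?thesis unfolding \<Gamma>_def using j(1) by blast
  qed
  define B where "B = max (\<Sum>j\<in>{1..J}. \<bar>(c j)\<^sup>2\<bar>) (\<Sum>j\<in>{1..J}. \<bar>1 / (c j)\<^sup>2\<bar>)"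
  show thesis
  proof (rule that[of \<Gamma> "M (\<lambda>x. x\<^sup>2)" "M (\<lambda>x. 1 / x\<^sup>2)" B])
    show "\<forall>p. \<bar>M (\<lambda>x. x\<^sup>2) p\<bar> \<le> B" "\<forall>p. \<bar>M (\<lambda>x. 1 / x\<^sup>2) p\<bar> \<le> B"
      unfolding B_def by (intro allI order_trans[OF Mb] max.cobounded1 max.cobounded2)+
    show "\<forall>p q. M (\<lambda>x. x\<^sup>2) p \<noteq> M (\<lambda>x. x\<^sup>2) q \<longrightarrow> closed_segment p q \<inter> \<Gamma> \<noteq> {}"
      by (intro allI impI jump)
    show "AE p in lborel. 1 / (n p)\<^sup>2 = M (\<lambda>x. 1 / x\<^sup>2) p"
      using AEM[of "\<lambda>x. 1 / x\<^sup>2"] by eventually_elim simp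
  qed (fact \<Gamma> Mm AEM)+
qed

section \<open>The regularity theorem\<close>

text \<open>Three ranges of the order: below one the \<open>H\<^sup>1\<close> translation estimate decides, order one is the
  hypothesis, and above one the localised gradient, given by the product rule, must be
  \<open>half_holder\<close>.\<close>

lemma sobolev_loc_from_representative:
  assumes s: "0 \<le> s" "s < 3 / 2" and h1: "h \<in> sobolev_loc 1"
    and h: "h \<in> borel_measurable lebesgue" "AE p in lborel. h p = a p"
    and L: "a \<in> L2_local" "a1 \<in> L2_local" "a2 \<in> L2_local"
    and grad: "weak_div a (\<lambda>_. 0) a1" "weak_div (\<lambda>_. 0) a a2"
    and hh: "\<And>f g. test_fun f \<Longrightarrow> g \<in> L2_compact \<Longrightarrow>
      weak_div (\<lambda>p. f p * a p) (\<lambda>_. 0) g \<or> weak_div (\<lambda>_. 0) (\<lambda>p. f p * a p) g \<Longrightarrow> half_holder g"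
  shows "h \<in> sobolev_loc s"
  unfolding sobolev_loc_def
proof (intro CollectI allI impI)
  fix f assume f: "test_fun f"
  have S1: "(\<lambda>p. f p * h p) \<in> sobolev 1" using h1 f by (simp add: sobolev_loc_def)
  have fa: "(\<lambda>p. f p * a p) \<in> borel_measurable borel"
    by (rule L2_compact_measurable[OF L2_local_test_fun[OF L(1) f]])
  have AE: "AE p in lborel. f p * h p = f p * a p" using h(2) by eventually_elim simp
  consider "s < 1" | "s = 1" | "1 < s" by linarith
  then show "(\<lambda>p. f p * h p) \<in> sobolev s"
  proof cases
    case 1
    show ?thesis
      by (rule sobolev_below_one[OF s(1) 1 sobolev_1_derivative(1)[OF S1] fa AE])
        (rule bounded_energy_localize[OF L grad f])
  next
    case 2 then show ?thesis using S1 by simp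
  next
    case 3
    have w1: "weak_div (\<lambda>p. f p * a p) (\<lambda>_. 0) (\<lambda>p. f p * a1 p + Dx f p * a p)"
      using weak_div_localize[OF grad(1) L(1) zero_L2_local L(2) f] by simp
    have w2: "weak_div (\<lambda>_. 0) (\<lambda>p. f p * a p) (\<lambda>p. f p * a2 p + Dy f p * a p)"
      using weak_div_localize[OF grad(2) zero_L2_local L(1) L(3) f] by simp
    have c: "(\<lambda>p. f p * a1 p + Dx f p * a p) \<in> L2_compact" "(\<lambda>p. f p * a2 p + Dy f p * a p) \<in> L2_compact"
      by (intro L2_compact_add L2_local_test_fun L f test_fun_dir_deriv)+
    show ?thesis
      by (rule sobolev_above_one[OF 3 s(2) sobolev_1_derivative(1)[OF S1] fa AE c
            hh[OF f c(1) disjI1[OF w1]] hh[OF f c(2) disjI2[OF w2]] w1 w2])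
  qed
qed

lemma weak_div_cmult:
  assumes "weak_div a b D"
  shows "weak_div (\<lambda>p. c * a p) (\<lambda>p. c * b p) (\<lambda>p. c * D p)"
  unfolding weak_div_def
proof (intro allI impI)
  fix \<psi> assume t: "test_fun \<psi>"
  have "(\<integral>p. c * a p * Dx \<psi> p + c * b p * Dy \<psi> p \<partial>lborel) = c * (\<integral>p. a p * Dx \<psi> p + b p * Dy \<psi> p \<partial>lborel)"
    by (subst integral_mult_right_zero[symmetric]) (simp add: algebra_simps)
  also have "\<dots> = - (\<integral>p. c * D p * \<psi> p \<partial>lborel)"
    using assms t by (simp add: weak_div_def mult.assoc)
  finally show "(\<integral>p. c * a p * Dx \<psi> p + c * b p * Dy \<psi> p \<partial>lborel) = - (\<integral>p. c * D p * \<psi> p \<partial>lborel)" .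
qed

text \<open>Both cases of the theorem reduce to this situation: \<open>w\<close> stands for \<open>curl (a, b) / n\<^sup>2\<close> and \<open>d\<close> for
  \<open>div (a, b)\<close>, and \<open>(w, d)\<close> solves a Cauchy--Riemann system with square integrable right-hand side.\<close>

lemma interface_regularity:
  assumes P: "periodic_polygonal_partition K J P"
    and n: "\<forall>j\<in>{1..J}. \<exists>c. \<forall>p\<in>P j. n p = c"
    and s: "0 \<le> s" "s < 3 / 2"
    and hx: "hx \<in> sobolev_loc 1" "hx \<in> borel_measurable lebesgue" "AE p in lborel. hx p = a p"
    and hy: "hy \<in> sobolev_loc 1" "hy \<in> borel_measurable lebesgue" "AE p in lborel. hy p = b p"
    and H: "a \<in> L2_local" "b \<in> L2_local" "a1 \<in> L2_local" "a2 \<in> L2_local" "b1 \<in> L2_local" "b2 \<in> L2_local"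
    and grad: "weak_div a (\<lambda>_. 0) a1" "weak_div (\<lambda>_. 0) a a2" "weak_div b (\<lambda>_. 0) b1" "weak_div (\<lambda>_. 0) b b2"
    and L: "w \<in> L2_local" "d \<in> L2_local" "F \<in> L2_local" "G \<in> L2_local"
    and sys: "weak_div (\<lambda>p. - d p) w F" "weak_div w d G"
    and div: "weak_div a b d"
    and curl: "AE p in lborel. b1 p - a2 p = of_real ((n p)\<^sup>2) * w p"
  shows "hx \<in> sobolev_loc s \<and> hy \<in> sobolev_loc s"
proof -
  obtain \<Gamma> m m' B where co: "on_lines \<Gamma>" "m \<in> borel_measurable borel" "m' \<in> borel_measurable borel"
    "\<forall>p. \<bar>m p\<bar> \<le> B" "\<forall>p. \<bar>m' p\<bar> \<le> B"
    "\<forall>p q. m p \<noteq> m q \<longrightarrow> closed_segment p q \<inter> \<Gamma> \<noteq> {}"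
    "AE p in lborel. m p = (n p)\<^sup>2" "AE p in lborel. 1 / (n p)\<^sup>2 = m' p"
    by (rule partition_coefficients[OF P n])
  note \<Gamma> = co(1) co(6)[rule_format] and m = co(2) co(4)[rule_format] co(7)
  have mw: "(\<lambda>p. of_real (m p) * w p) \<in> L2_local"
    by (rule L2_local_bounded_mult[OF L(1), where B = B]) (use m in auto)
  have c0: "weak_div b (\<lambda>p. - a p) (\<lambda>p. b1 p + - a2 p)"
    using weak_div_add[OF grad(3) weak_div_uminus[OF grad(2)] H(2) zero_L2_local H(5)] H
    by (simp add: L2_local_uminus zero_L2_local)
  have curl': "weak_div b (\<lambda>p. - a p) (\<lambda>p. of_real (m p) * w p)"
  proof (rule weak_div_cong_AE[OF c0])
    show "AE p in lborel. b1 p + - a2 p = of_real (m p) * w p"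
      using curl m(3) by eventually_elim simp
    show "(\<lambda>p. b1 p + - a2 p) \<in> borel_measurable borel"
      by (rule L2_local_measurable) (intro L2_local_add L2_local_uminus H)
    show "(\<lambda>p. of_real (m p) * w p) \<in> borel_measurable borel" by (rule L2_local_measurable[OF mw])
  qed
  note gh = gradients_half_holder[OF L sys H grad div curl' m(1,2) \<Gamma>]
  have "hx \<in> sobolev_loc s"
    by (rule sobolev_loc_from_representative[OF s hx H(1,3,4) grad(1,2)]) (rule gh, auto)
  moreover have "hy \<in> sobolev_loc s"
    by (rule sobolev_loc_from_representative[OF s hy H(2,5,6) grad(3,4)]) (rule gh, auto)
  ultimately show ?thesis by blast
qed

lemma weak_partialD:
  "weak_div a (\<lambda>_. 0) D \<Longrightarrow> test_fun \<psi> \<Longrightarrow> (\<integral>p. a p * Dx \<psi> p \<partial>lborel) = - (\<integral>p. D p * \<psi> p \<partial>lborel)"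
  "weak_div (\<lambda>_. 0) a D \<Longrightarrow> test_fun \<psi> \<Longrightarrow> (\<integral>p. a p * Dy \<psi> p \<partial>lborel) = - (\<integral>p. D p * \<psi> p \<partial>lborel)"
  by (simp_all add: weak_div_def)

text \<open>The two components of \<open>M h = f\<close> are exactly the Cauchy--Riemann system for
  \<open>w = curl h / n\<^sup>2\<close> and \<open>d = div h\<close>.\<close>

lemma solves_M_regularity:
  assumes P: "periodic_polygonal_partition K J P" and n0: "\<And>p. n p > 0"
    and n: "\<forall>j\<in>{1..J}. \<exists>c. \<forall>p\<in>P j. n p = c"
    and s: "0 \<le> s" "s < 3 / 2"
    and hx: "hx \<in> sobolev_loc 1" and hy: "hy \<in> sobolev_loc 1"
    and f: "fx \<in> L2_loc" "fy \<in> L2_loc" and M: "solves_M n (hx, hy) (fx, fy)"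
  shows "hx \<in> sobolev_loc s \<and> hy \<in> sobolev_loc s"
proof -
  obtain a a1 a2 where a: "hx \<in> borel_measurable lebesgue" "AE p in lborel. hx p = a p"
    "a \<in> L2_local" "a1 \<in> L2_local" "a2 \<in> L2_local" "weak_div a (\<lambda>_. 0) a1" "weak_div (\<lambda>_. 0) a a2"
    by (rule sobolev_loc_1_representative[OF hx])
  obtain b b1 b2 where b: "hy \<in> borel_measurable lebesgue" "AE p in lborel. hy p = b p"
    "b \<in> L2_local" "b1 \<in> L2_local" "b2 \<in> L2_local" "weak_div b (\<lambda>_. 0) b1" "weak_div (\<lambda>_. 0) b b2"
    by (rule sobolev_loc_1_representative[OF hy])
  obtain F where F: "F \<in> L2_local" "AE p in lborel. fx p = F p" by (rule L2_loc_representative[OF f(1)])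
  obtain G where G: "G \<in> L2_local" "AE p in lborel. fy p = G p" by (rule L2_loc_representative[OF f(2)])
  obtain \<Gamma> m m' B where co: "on_lines \<Gamma>" "m \<in> borel_measurable borel" "m' \<in> borel_measurable borel"
    "\<forall>p. \<bar>m p\<bar> \<le> B" "\<forall>p. \<bar>m' p\<bar> \<le> B"
    "\<forall>p q. m p \<noteq> m q \<longrightarrow> closed_segment p q \<inter> \<Gamma> \<noteq> {}"
    "AE p in lborel. m p = (n p)\<^sup>2" "AE p in lborel. 1 / (n p)\<^sup>2 = m' p"
    by (rule partition_coefficients[OF P n])
  note m' = co(3) co(5)[rule_format] co(8)
  have fm: "fx \<in> borel_measurable lebesgue" "fy \<in> borel_measurable lebesgue" using f by (auto simp: L2_loc_def)
  note meas = a(3)[THEN L2_local_measurable] b(3)[THEN L2_local_measurable]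
    F(1)[THEN L2_local_measurable] G(1)[THEN L2_local_measurable]
  define u where "u p = b1 p - a2 p" for p
  define w where "w p = of_real (m' p) * u p" for p
  define d where "d p = a1 p + b2 p" for p
  have u: "u \<in> L2_local" unfolding u_def by (intro L2_local_diff a b)
  have w: "w \<in> L2_local" unfolding w_def
    by (rule L2_local_bounded_mult[OF u, where B = B]) (use m' in auto)
  have d: "d \<in> L2_local" unfolding d_def by (intro L2_local_add a b)
  have um: "u \<in> borel_measurable borel" by (rule L2_local_measurable[OF u])
  have rx: "regular hx \<psi> = (\<integral>p. a p * \<psi> p \<partial>lborel)" and ry: "regular hy \<psi> = (\<integral>p. b p * \<psi> p \<partial>lborel)"
    if "test_fun \<psi>" for \<psi>
    using regular_representative[OF a(1) meas(1) a(2) that] regular_representative[OF b(1) meas(2) b(2) that] by auto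
  have int: "integrable lborel (\<lambda>p. v p * \<psi> p)" if "v \<in> L2_local" "test_fun \<psi>" for v \<psi>
    by (rule L2_local_integrable_test_fun[OF that])
  have curl: "curl_of_vector (regular hx, regular hy) =\<^sub>D regular u"
    unfolding distr_eq_def
  proof (intro allI impI)
    fix \<psi> assume t: "test_fun \<psi>"
    show "curl_of_vector (regular hx, regular hy) \<psi> = regular u \<psi>"
      unfolding regular_borel[OF um t] u_def
      using int[OF b(4) t] int[OF a(5) t]
      by (simp add: dx_def dy_def rx ry t test_fun_dir_deriv weak_partialD(1)[OF b(6) t] weak_partialD(2)[OF a(7) t] left_diff_distrib)
  qed
  have c: "coeff_mult (\<lambda>p. 1 / (n p)\<^sup>2) (curl_of_vector (regular hx, regular hy)) \<psi> = (\<integral>p. w p * \<psi> p \<partial>lborel)"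
    if t: "test_fun \<psi>" for \<psi>
    unfolding w_def by (rule coeff_mult_eq[OF u curl m'(1,3) t])
  have dv: "divergence (regular hx, regular hy) \<psi> = (\<integral>p. d p * \<psi> p \<partial>lborel)" if t: "test_fun \<psi>" for \<psi>
    unfolding d_def using int[OF a(4) t] int[OF b(5) t]
    by (simp add: dx_def dy_def rx ry t test_fun_dir_deriv weak_partialD(1)[OF a(6) t] weak_partialD(2)[OF b(7) t] distrib_right)
  have M': "dy (coeff_mult (\<lambda>p. 1 / (n p)\<^sup>2) (curl_of_vector (regular hx, regular hy))) \<psi> - dx (divergence (regular hx, regular hy)) \<psi> = regular fx \<psi>"
    "- dx (coeff_mult (\<lambda>p. 1 / (n p)\<^sup>2) (curl_of_vector (regular hx, regular hy))) \<psi> - dy (divergence (regular hx, regular hy)) \<psi> = regular fy \<psi>"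
    if t: "test_fun \<psi>" for \<psi>
    using M t
    by (simp_all add: solves_M_def M_op_def curl_of_scalar_def grad_def distr_eq_def del: curl_of_vector.simps divergence.simps)
  have s1: "weak_div (\<lambda>p. - d p) w F"
    unfolding weak_div_def
  proof (intro allI impI)
    fix \<psi> assume t: "test_fun \<psi>"
    note td = test_fun_dir_deriv[OF t]
    have "- (\<integral>p. w p * Dy \<psi> p \<partial>lborel) + (\<integral>p. d p * Dx \<psi> p \<partial>lborel) = (\<integral>p. F p * \<psi> p \<partial>lborel)"
      using M'(1)[OF t] unfolding dx_def dy_def c[OF td] dv[OF td] regular_representative[OF fm(1) meas(3) F(2) t] by simp
    then show "(\<integral>p. - d p * Dx \<psi> p + w p * Dy \<psi> p \<partial>lborel) = - (\<integral>p. F p * \<psi> p \<partial>lborel)"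
      using int[OF d td] int[OF w td] by (simp add: algebra_simps)
  qed
  have s2: "weak_div w d (\<lambda>p. - G p)"
    unfolding weak_div_def
  proof (intro allI impI)
    fix \<psi> assume t: "test_fun \<psi>"
    note td = test_fun_dir_deriv[OF t]
    have "(\<integral>p. w p * Dx \<psi> p \<partial>lborel) + (\<integral>p. d p * Dy \<psi> p \<partial>lborel) = (\<integral>p. G p * \<psi> p \<partial>lborel)"
      using M'(2)[OF t] unfolding dx_def dy_def c[OF td] dv[OF td] regular_representative[OF fm(2) meas(4) G(2) t] by simp
    then show "(\<integral>p. w p * Dx \<psi> p + d p * Dy \<psi> p \<partial>lborel) = - (\<integral>p. - G p * \<psi> p \<partial>lborel)"
      using int[OF d td] int[OF w td] by simp
  qed
  have div: "weak_div a b d"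
    unfolding d_def using weak_div_add[OF a(6) b(7) a(3) zero_L2_local a(4) zero_L2_local b(3) b(5)] by simp
  show ?thesis
  proof (rule interface_regularity[OF P n s hx a(1,2) hy b(1,2) a(3) b(3) a(4,5) b(4,5) a(6,7) b(6,7) w d F(1) L2_local_uminus[OF G(1)] s1 s2 div])
    show "AE p in lborel. b1 p - a2 p = of_real ((n p)\<^sup>2) * w p"
      using m'(3)
    proof eventually_elim
      case (elim p)
      have "(n p)\<^sup>2 * m' p = 1" using elim n0[of p] by (simp add: elim[symmetric])
      then have "of_real ((n p)\<^sup>2) * of_real (m' p) = (1 :: complex)" by (metis of_real_1 of_real_mult)
      then show ?case unfolding w_def u_def by (simp add: mult.assoc[symmetric])
    qed
  qed
qed

text \<open>The third component of \<open>1 / n\<^sup>2\<close> times the curl is \<open>w\<close>; the first two, \<open>w1\<close> and \<open>w2\<close>, are square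
  integrable because \<open>h\<close> is in \<open>H\<^sup>1\<close>. The first two Maxwell equations express the gradient of \<open>w\<close> by
  \<open>w1\<close>, \<open>w2\<close> and \<open>h\<close>, and the divergence condition gives \<open>d = - \<i> \<beta> h\<^sub>z\<close>, whose gradient is square
  integrable as well.\<close>

lemma solves_maxwell_regularity:
  assumes P: "periodic_polygonal_partition K J P" and n0: "\<And>p. n p > 0"
    and n: "\<forall>j\<in>{1..J}. \<exists>c. \<forall>p\<in>P j. n p = c"
    and s: "0 \<le> s" "s < 3 / 2"
    and hx: "hx \<in> sobolev_loc 1" and hy: "hy \<in> sobolev_loc 1" and hz: "hz \<in> sobolev_loc 1"
    and M: "solves_maxwell n \<beta> \<kappa> (hx, hy, hz)"
  shows "hx \<in> sobolev_loc s \<and> hy \<in> sobolev_loc s"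
proof -
  obtain a a1 a2 where a: "hx \<in> borel_measurable lebesgue" "AE p in lborel. hx p = a p"
    "a \<in> L2_local" "a1 \<in> L2_local" "a2 \<in> L2_local" "weak_div a (\<lambda>_. 0) a1" "weak_div (\<lambda>_. 0) a a2"
    by (rule sobolev_loc_1_representative[OF hx])
  obtain b b1 b2 where b: "hy \<in> borel_measurable lebesgue" "AE p in lborel. hy p = b p"
    "b \<in> L2_local" "b1 \<in> L2_local" "b2 \<in> L2_local" "weak_div b (\<lambda>_. 0) b1" "weak_div (\<lambda>_. 0) b b2"
    by (rule sobolev_loc_1_representative[OF hy])
  obtain z z1 z2 where z: "hz \<in> borel_measurable lebesgue" "AE p in lborel. hz p = z p"
    "z \<in> L2_local" "z1 \<in> L2_local" "z2 \<in> L2_local" "weak_div z (\<lambda>_. 0) z1" "weak_div (\<lambda>_. 0) z z2"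
    by (rule sobolev_loc_1_representative[OF hz])
  obtain \<Gamma> m m' B where co: "on_lines \<Gamma>" "m \<in> borel_measurable borel" "m' \<in> borel_measurable borel"
    "\<forall>p. \<bar>m p\<bar> \<le> B" "\<forall>p. \<bar>m' p\<bar> \<le> B"
    "\<forall>p q. m p \<noteq> m q \<longrightarrow> closed_segment p q \<inter> \<Gamma> \<noteq> {}"
    "AE p in lborel. m p = (n p)\<^sup>2" "AE p in lborel. 1 / (n p)\<^sup>2 = m' p"
    by (rule partition_coefficients[OF P n])
  note m' = co(3) co(5)[rule_format] co(8)
  note meas = a(3)[THEN L2_local_measurable] b(3)[THEN L2_local_measurable] z(3)[THEN L2_local_measurable]
  define i\<beta> where "i\<beta> = \<i> * complex_of_real \<beta>"
  define u1 where "u1 p = z2 p - i\<beta> * b p" for p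
  define u2 where "u2 p = i\<beta> * a p - z1 p" for p
  define u where "u p = b1 p - a2 p" for p
  define w1 where "w1 p = of_real (m' p) * u1 p" for p
  define w2 where "w2 p = of_real (m' p) * u2 p" for p
  define w where "w p = of_real (m' p) * u p" for p
  define d where "d p = - i\<beta> * z p" for p
  have uL: "u1 \<in> L2_local" "u2 \<in> L2_local" "u \<in> L2_local"
    unfolding u1_def u2_def u_def by (intro L2_local_diff L2_local_cmult a b z)+
  have wL: "w1 \<in> L2_local" "w2 \<in> L2_local" "w \<in> L2_local"
    unfolding w1_def w2_def w_def
    by (rule L2_local_bounded_mult[where B = B]; use m' uL in simp)+
  have dL: "d \<in> L2_local" unfolding d_def by (intro L2_local_cmult z)
  note um = uL[THEN L2_local_measurable]
  have rx: "regular hx \<psi> = (\<integral>p. a p * \<psi> p \<partial>lborel)" and ry: "regular hy \<psi> = (\<integral>p. b p * \<psi> p \<partial>lborel)"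
    and rz: "regular hz \<psi> = (\<integral>p. z p * \<psi> p \<partial>lborel)" if "test_fun \<psi>" for \<psi>
    using regular_representative[OF a(1) meas(1) a(2) that] regular_representative[OF b(1) meas(2) b(2) that]
      regular_representative[OF z(1) meas(3) z(2) that] by auto
  have int: "integrable lborel (\<lambda>p. v p * \<psi> p)" if "v \<in> L2_local" "test_fun \<psi>" for v \<psi>
    by (rule L2_local_integrable_test_fun[OF that])
  let ?T1 = "\<lambda>\<phi>. dy (regular hz) \<phi> - i\<beta> * regular hy \<phi>"
  let ?T2 = "\<lambda>\<phi>. i\<beta> * regular hx \<phi> - dx (regular hz) \<phi>"
  let ?T3 = "\<lambda>\<phi>. dx (regular hy) \<phi> - dy (regular hx) \<phi>"
  have T: "?T1 =\<^sub>D regular u1" "?T2 =\<^sub>D regular u2" "?T3 =\<^sub>D regular u"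
  proof -
    have *: "?T1 \<psi> = regular u1 \<psi> \<and> ?T2 \<psi> = regular u2 \<psi> \<and> ?T3 \<psi> = regular u \<psi>" if t: "test_fun \<psi>" for \<psi>
      unfolding um[THEN regular_borel[OF _ t]] u1_def u2_def u_def
      using int[OF b(4) t] int[OF a(5) t] int[OF z(4) t] int[OF z(5) t] int[OF a(3) t] int[OF b(3) t]
      by (simp add: dx_def dy_def rx ry rz t test_fun_dir_deriv weak_partialD(1)[OF b(6) t] weak_partialD(2)[OF a(7) t]
          weak_partialD(1)[OF z(6) t] weak_partialD(2)[OF z(7) t] left_diff_distrib mult.assoc)
    then show "?T1 =\<^sub>D regular u1" "?T2 =\<^sub>D regular u2" "?T3 =\<^sub>D regular u"
      unfolding distr_eq_def by blast+
  qed
  let ?c = "coeff_mult (\<lambda>p. 1 / (n p)\<^sup>2)"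
  have c: "?c ?T1 \<psi> = (\<integral>p. w1 p * \<psi> p \<partial>lborel)" "?c ?T2 \<psi> = (\<integral>p. w2 p * \<psi> p \<partial>lborel)"
    "?c ?T3 \<psi> = (\<integral>p. w p * \<psi> p \<partial>lborel)" if t: "test_fun \<psi>" for \<psi>
    unfolding w1_def w2_def w_def
    by (rule coeff_mult_eq[OF uL(1) T(1) m'(1,3) t], rule coeff_mult_eq[OF uL(2) T(2) m'(1,3) t],
        rule coeff_mult_eq[OF uL(3) T(3) m'(1,3) t])
  have M': "dy (?c ?T3) \<psi> - i\<beta> * ?c ?T2 \<psi> = of_real (\<kappa>\<^sup>2) * regular hx \<psi>"
    "i\<beta> * ?c ?T1 \<psi> - dx (?c ?T3) \<psi> = of_real (\<kappa>\<^sup>2) * regular hy \<psi>"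
    "dx (regular hx) \<psi> + dy (regular hy) \<psi> + i\<beta> * regular hz \<psi> = 0" if t: "test_fun \<psi>" for \<psi>
    using M t unfolding i\<beta>_def
    by (simp_all add: solves_maxwell_def distr_eq_def Let_def)
  define F where "F p = i\<beta> * z1 p + (of_real (\<kappa>\<^sup>2) * a p + i\<beta> * w2 p)" for p
  define G where "G p = - (of_real (\<kappa>\<^sup>2) * b p - i\<beta> * w1 p) + - (i\<beta> * z2 p)" for p
  have FG: "F \<in> L2_local" "G \<in> L2_local"
    unfolding F_def G_def by (intro L2_local_add L2_local_diff L2_local_uminus L2_local_cmult a b z wL)+
  have wy: "weak_div (\<lambda>_. 0) w (\<lambda>p. of_real (\<kappa>\<^sup>2) * a p + i\<beta> * w2 p)"
    unfolding weak_div_def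
  proof (intro allI impI)
    fix \<psi> assume t: "test_fun \<psi>"
    note td = test_fun_dir_deriv[OF t]
    have e1: "- (\<integral>p. w p * Dy \<psi> p \<partial>lborel) - i\<beta> * (\<integral>p. w2 p * \<psi> p \<partial>lborel) = of_real (\<kappa>\<^sup>2) * (\<integral>p. a p * \<psi> p \<partial>lborel)"
      using M'(1)[OF t] unfolding dy_def c(3)[OF td, unfolded dy_def] c(2)[OF t] rx[OF t] .
    have e2: "(\<integral>p. (of_real (\<kappa>\<^sup>2) * a p + i\<beta> * w2 p) * \<psi> p \<partial>lborel) =
        of_real (\<kappa>\<^sup>2) * (\<integral>p. a p * \<psi> p \<partial>lborel) + i\<beta> * (\<integral>p. w2 p * \<psi> p \<partial>lborel)"
      using int[OF a(3) t] int[OF wL(2) t] by (simp add: distrib_right mult.assoc)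
    have "X = - (A + B)" if "- X - B = A" for X A B :: complex
      by (simp add: that[symmetric])
    from this[OF e1] e2 show "(\<integral>p. 0 * Dx \<psi> p + w p * Dy \<psi> p \<partial>lborel) = - (\<integral>p. (of_real (\<kappa>\<^sup>2) * a p + i\<beta> * w2 p) * \<psi> p \<partial>lborel)"
      by simp
  qed
  have wx: "weak_div w (\<lambda>_. 0) (\<lambda>p. - (of_real (\<kappa>\<^sup>2) * b p - i\<beta> * w1 p))"
    unfolding weak_div_def
  proof (intro allI impI)
    fix \<psi> assume t: "test_fun \<psi>"
    note td = test_fun_dir_deriv[OF t]
    have e1: "i\<beta> * (\<integral>p. w1 p * \<psi> p \<partial>lborel) - - (\<integral>p. w p * Dx \<psi> p \<partial>lborel) = of_real (\<kappa>\<^sup>2) * (\<integral>p. b p * \<psi> p \<partial>lborel)"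
      using M'(2)[OF t] unfolding dx_def c(3)[OF td, unfolded dx_def] c(1)[OF t] ry[OF t] .
    have e2: "(\<integral>p. - (of_real (\<kappa>\<^sup>2) * b p - i\<beta> * w1 p) * \<psi> p \<partial>lborel) =
        i\<beta> * (\<integral>p. w1 p * \<psi> p \<partial>lborel) - of_real (\<kappa>\<^sup>2) * (\<integral>p. b p * \<psi> p \<partial>lborel)"
      using int[OF b(3) t] int[OF wL(1) t] by (simp add: left_diff_distrib mult.assoc)
    have "X = - (A - B)" if "A - - X = B" for X A B :: complex
      by (simp add: that[symmetric])
    from this[OF e1] e2 show "(\<integral>p. w p * Dx \<psi> p + 0 * Dy \<psi> p \<partial>lborel) = - (\<integral>p. - (of_real (\<kappa>\<^sup>2) * b p - i\<beta> * w1 p) * \<psi> p \<partial>lborel)"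
      by simp
  qed
  have dx': "weak_div (\<lambda>p. - d p) (\<lambda>_. 0) (\<lambda>p. i\<beta> * z1 p)"
    using weak_div_cmult[OF z(6), of i\<beta>] by (simp add: d_def)
  have dy': "weak_div (\<lambda>_. 0) d (\<lambda>p. - (i\<beta> * z2 p))"
    using weak_div_cmult[OF z(7), of "- i\<beta>"] by (simp add: d_def[abs_def])
  have L0: "(\<lambda>p. - d p) \<in> L2_local" "(\<lambda>p. i\<beta> * z1 p) \<in> L2_local" "(\<lambda>p. - (i\<beta> * z2 p)) \<in> L2_local"
    "(\<lambda>p. of_real (\<kappa>\<^sup>2) * a p + i\<beta> * w2 p) \<in> L2_local" "(\<lambda>p. - (of_real (\<kappa>\<^sup>2) * b p - i\<beta> * w1 p)) \<in> L2_local"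
    by (intro L2_local_add L2_local_diff L2_local_uminus L2_local_cmult a b z wL dL)+
  have s1: "weak_div (\<lambda>p. - d p) w F"
    unfolding F_def using weak_div_add[OF dx' wy L0(1) zero_L2_local L0(2) zero_L2_local wL(3) L0(4)] by simp
  have s2: "weak_div w d G"
    unfolding G_def using weak_div_add[OF wx dy' wL(3) zero_L2_local L0(5) zero_L2_local dL L0(3)] by simp
  have div: "weak_div a b d"
    unfolding weak_div_def
  proof (intro allI impI)
    fix \<psi> assume t: "test_fun \<psi>"
    note td = test_fun_dir_deriv[OF t]
    have "- (\<integral>p. a p * Dx \<psi> p \<partial>lborel) + - (\<integral>p. b p * Dy \<psi> p \<partial>lborel) + i\<beta> * (\<integral>p. z p * \<psi> p \<partial>lborel) = 0"
      using M'(3)[OF t] unfolding dx_def dy_def rx[OF td] ry[OF td] rz[OF t] .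
    then have "(\<integral>p. a p * Dx \<psi> p \<partial>lborel) + (\<integral>p. b p * Dy \<psi> p \<partial>lborel) = i\<beta> * (\<integral>p. z p * \<psi> p \<partial>lborel)"
      by (simp add: algebra_simps)
    then show "(\<integral>p. a p * Dx \<psi> p + b p * Dy \<psi> p \<partial>lborel) = - (\<integral>p. d p * \<psi> p \<partial>lborel)"
      using int[OF a(3) td] int[OF b(3) td] by (simp add: d_def mult.assoc)
  qed
  show ?thesis
  proof (rule interface_regularity[OF P n s hx a(1,2) hy b(1,2) a(3) b(3) a(4,5) b(4,5) a(6,7) b(6,7) wL(3) dL FG s1 s2 div])
    show "AE p in lborel. b1 p - a2 p = of_real ((n p)\<^sup>2) * w p"
      using m'(3)
    proof eventually_elim
      case (elim p)
      have "(n p)\<^sup>2 * m' p = 1" using elim n0[of p] by (simp add: elim[symmetric])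
      then have "of_real ((n p)\<^sup>2) * of_real (m' p) = (1 :: complex)" by (metis of_real_1 of_real_mult)
      then show ?case unfolding w_def u_def by (simp add: mult.assoc[symmetric])
    qed
  qed
qed

theorem corollary6p4:
  fixes a1 a2 \<xi> :: plane and J :: nat and P :: "nat \<Rightarrow> plane set"
    and n :: "plane \<Rightarrow> real" and \<beta> \<eta> :: real and hx hy :: cfun
  assumes "lattice_basis a1 a2"
    and "periodic_polygonal_partition (lattice_of a1 a2) J P"
    and "\<And>p. n p > 0"
    and "\<And>p k. k \<in> lattice_of a1 a2 \<Longrightarrow> n (p + k) = n p"
    and "\<And>j. j \<in> {1..J} \<Longrightarrow> \<exists>c. \<forall>p\<in>P j. n p = c"
    and "\<xi> \<in> brillouin_zone (lattice_of a1 a2)"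
    and "(hx \<in> sobolev_loc 1 \<and> hy \<in> sobolev_loc 1 \<and>
            (\<exists>fx\<in>L2_loc. \<exists>fy\<in>L2_loc. solves_M n (hx, hy) (fx, fy)))
       \<or> (\<exists>hz \<kappa>. hx \<in> sobolev_loc 1 \<and> hy \<in> sobolev_loc 1 \<and> hz \<in> sobolev_loc 1 \<and>
            solves_maxwell n \<beta> \<kappa> (hx, hy, hz))"
    and "0 < \<eta>" and "\<eta> \<le> 3 / 2"
  shows "hx \<in> sobolev_loc (3 / 2 - \<eta>) \<and> hy \<in> sobolev_loc (3 / 2 - \<eta>)"
proof -
  have s: "0 \<le> 3 / 2 - \<eta>" "3 / 2 - \<eta> < 3 / 2" using assms(8,9) by auto
  have n: "\<forall>j\<in>{1..J}. \<exists>c. \<forall>p\<in>P j. n p = c" using assms(5) by blast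
  from assms(7) show ?thesis
  proof (elim disjE exE conjE bexE)
    fix fx fy assume f: "hx \<in> sobolev_loc 1" "hy \<in> sobolev_loc 1" "fx \<in> L2_loc" "fy \<in> L2_loc" "solves_M n (hx, hy) (fx, fy)"
    show ?thesis by (rule solves_M_regularity[OF assms(2,3) n s f])
  next
    fix hz \<kappa> assume f: "hx \<in> sobolev_loc 1" "hy \<in> sobolev_loc 1" "hz \<in> sobolev_loc 1" "solves_maxwell n \<beta> \<kappa> (hx, hy, hz)"
    show ?thesis by (rule solves_maxwell_regularity[OF assms(2,3) n s f])
  qed
qed

end
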